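(* Assume that $f(t,\cdot,\cdot,\cdot)$ (for every $t\in\mathcal T$) and $g$ are continuous, that $(x,a)\mapsto\mathbb P_t^0(x,a,\cdot)$ is weakly continuous for every $t\in\mathcal T$, and that the policy class is regular (see context). Suppose that for every $\theta\in\mathrm{int}(\Theta)$ and every direction $r\in\mathbb R^{d_\theta}$ there is $h_0>0$ such that for every $s\in\bar{\mathcal T}$ the family $\{x\mapsto (V_s^{\theta+hr}(x)-V_s^\theta(x))/h:\ 0<|h|\le h_0,\ \theta+hr\in\Theta\}$ is equicontinuous on $\mathcal X$, and for every $s\in\mathcal T$ the family $\{(x,a,\lambda)\mapsto (F_s^{\theta+hr}(\lambda;x,a)-F_s^\theta(\lambda;x,a))/h:\ 0<|h|\le h_0,\ \theta+hr\in\Theta\}$ is equicontinuous on $\mathcal X\times A\times[0,\Lambda]$. Assume additionally that for all $t\in\mathcal T$, $x\in\mathcal X$, $a\in A$, $\theta\in\Theta$ the dual optimizer is unique, $\Lambda_t^{*,\theta}(x,a)=\{\lambda_t^\star(x,a,\theta)\}$, and that for every $x'\in\mathcal X$ the inner optimizer is unique, $Y^*_{t,\theta,\lambda_t^\star(x,a,\theta)}(x,a;x')=\{y_t^\star(x,a,x',\theta)\}$. Then, for all $\theta\in\mathrm{int}(\Theta)$, $t$ and $x$, the right and left directional derivatives of $V_t^\theta(x)$ coincide and are linear in $r$: there is a vector $\nabla_\theta V_t^\theta(x)\in\mathbb R^{d_\theta}$ with $$D_\theta V_t^\theta(x)[r]=\langle\nabla_\theta V_t^\theta(x),r\rangle\qquad\forall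 r\in\mathbb R^{d_\theta}.$$ Moreover, for all $t\in\mathcal T$ and $(x,a)\in\mathcal X\times A$, $D_\theta G_t^\theta(x,a)[r]=\langle\nabla_\theta G_t^\theta(x,a),r\rangle$ with $$\nabla_\theta G_t^\theta(x,a)=\int_{\mathcal X}\nabla_\theta V_{t+1}^\theta\big(y_t^\star(x,a,x',\theta)\big)\,\mathbb P_t^0(x,a,dx').$$
   Context: Model. $\mathcal X\subset\mathbb R^d$, $A\subset\mathbb R^m$ are nonempty compact sets, $T\ge1$ an integer, $\mathcal T=\{0,\dots,T-1\}$, $\bar{\mathcal T}=\{0,\dots,T\}$, $q\ge1$ an integer, $\varepsilon>0$, $c(x,y)=\|x-y\|^q$ (Euclidean norm). $\mathcal P(\mathcal X)$ is the set of Borel probability measures on $\mathcal X$ and $W_q$ the $q$-Wasserstein distance for the Euclidean metric. Rewards: Borel $f:\mathcal T\times\mathcal X\times A\times\mathcal X\to\mathbb R$, $g:\mathcal X\to\mathbb R$. For $t\in\mathcal T$, $\mathbb P_t^0$ is a Borel (nominal) transition kernel from $\mathcal X\times A$ to $\mathcal X$, and $\mathbb B_t(x,a)=\{\mathbb P\in\mathcal P(\mathcal X):W_q(\mathbb P,\mathbb P_t^0(x,a,\cdot))\le\varepsilon\}$. Policies. $\Theta\subset\mathbb R^{d_\theta}$ is compact, $\nu$ is a reference measure on $A$, and for $\theta\in\Theta$, $\pi_t^\theta(x,da)=\pi_t^\theta(x,a)\,\nu(da)$ is a probability measure on $A$ for each $(t,x)\in\mathcal T\times\mathcal X$. The policy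 class is regular if for each $t$: $(\theta,x)\mapsto\pi_t^\theta(x,\cdot)$ is weakly continuous on $\Theta\times\mathcal X$; for every $\varphi\in C(A)$, $\theta\mapsto\int_A\varphi(a)\pi_t^\theta(x,da)$ is $C^1$ on $\Theta$ with derivative continuous in $(\theta,x)$; and the score $\nabla_\theta\log\pi_t^\theta(x,a)$ exists with $\sup_{\theta,t,x,a}\|\nabla_\theta\log\pi_t^\theta(x,a)\|<\infty$. Value functions. $V_t^\theta(x)=\inf\mathbb E\big[\sum_{l=t}^{T-1}f(l,X_l,a_l,X_{l+1})+g(X_T)\big]$, the infimum being over path laws $\delta_x(dx_t)\prod_{l=t}^{T-1}\pi_l^\theta(x_l,da_l)\mathbb P_l(x_l,a_l,dx_{l+1})$ with Borel kernels $\mathbb P_l$ such that $\mathbb P_l(x',a',\cdot)\in\mathbb B_l(x',a')$ for all $(x',a')$. Dual objects. For $\lambda\ge0$, $$F_t^\theta(\lambda;x,a)=\int_{\mathcal X}\inf_{y\in\mathcal X}\{f(t,x,a,y)+V_{t+1}^\theta(y)+\lambda c(x',y)\}\,\mathbb P_t^0(x,a,dx')-\varepsilon^q\lambda,$$ $Y_{t,\theta,\lambda}^*(x,a;x')=\arg\min_{y\in\mathcal X}\{f(t,x,a,y)+V_{t+1}^\theta(y)+\lambda c(x',y)\}$, $\Lambda_t^{*,\theta}(x,a)=\arg\max_{\lambda\ge0}F_t^\theta(\lambda;x,a)$, and $G_t^\theta(x,a)=\sup_{\lambda\ge0}F_t^\theta(\lambda;x,a)$. The dynamic programming recursion is $V_T^\theta=g$,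 $V_t^\theta(x)=\int_AG_t^\theta(x,a)\pi_t^\theta(x,da)$. $\Lambda<\infty$ is a fixed constant, independent of $(t,\theta,x,a)$, with $\Lambda_t^{*,\theta}(x,a)=\arg\max_{\lambda\in[0,\Lambda]}F_t^\theta(\lambda;x,a)$ for all $(t,\theta,x,a)$ (such a constant exists). Directional derivatives. $D_\theta^+\phi(\theta)[r]=\lim_{h\downarrow0}(\phi(\theta+hr)-\phi(\theta))/h$, $D_\theta^-\phi(\theta)[r]=\lim_{h\uparrow0}(\phi(\theta+hr)-\phi(\theta))/h$; $D_\theta$ denotes their common value when they coincide. *)

theory Defs
  imports "HOL-Probability.Probability"
begin

section \<open>Probability measures on Borel subsets, weak continuity, Wasserstein distance\<close>

abbreviation borel_on :: "'a::topological_space set \<Rightarrow> 'a measure" where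
  "borel_on S \<equiv> restrict_space borel S"

abbreviation prob_measures_on :: "'a::topological_space set \<Rightarrow> 'a measure set" where
  "prob_measures_on S \<equiv> space (prob_algebra (borel_on S))"

text \<open>
  Only used for compact \<^term>\<open>S\<close>, where the bounded continuous functions are exactly the
  continuous ones.
\<close>
definition weakly_continuous_on ::
  "'u::topological_space set \<Rightarrow> 's::topological_space set \<Rightarrow> ('u \<Rightarrow> 's measure) \<Rightarrow> bool" where
  "weakly_continuous_on U S K \<longleftrightarrow>
     (\<forall>\<phi>::'s \<Rightarrow> real. continuous_on S \<phi> \<longrightarrow> continuous_on U (\<lambda>u. \<integral>s. \<phi> s \<partial>K u))"

definition couplings ::
  "'x::topological_space set \<Rightarrow> 'x measure \<Rightarrow> 'x measure \<Rightarrow> ('x \<times> 'x) measure set" where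
  "couplings S \<mu> \<mu>' =
     {\<gamma> \<in> space (prob_algebra (borel_on S \<Otimes>\<^sub>M borel_on S)).
        distr \<gamma> (borel_on S) fst = \<mu> \<and> distr \<gamma> (borel_on S) snd = \<mu>'}"

text \<open>
  Real-valued; only used for probability measures on a compact set \<^term>\<open>S\<close>, where the cost is
  bounded and the product measure is a coupling, so that the infimum is a genuine one.
\<close>
definition wasserstein ::
  "nat \<Rightarrow> 'x::euclidean_space set \<Rightarrow> 'x measure \<Rightarrow> 'x measure \<Rightarrow> real" where
  "wasserstein q S \<mu> \<mu>' =
     root q (INF \<gamma>\<in>couplings S \<mu> \<mu>'. \<integral>z. norm (fst z - snd z) ^ q \<partial>\<gamma>)"

section \<open>Optimizers, equicontinuity, directional derivatives\<close>

definition argmin_set :: "('b \<Rightarrow> real) \<Rightarrow> 'b set \<Rightarrow> 'b set" where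
  "argmin_set \<phi> S = {x. is_arg_min \<phi> (\<lambda>y. y \<in> S) x}"

definition argmax_set :: "('b \<Rightarrow> real) \<Rightarrow> 'b set \<Rightarrow> 'b set" where
  "argmax_set \<phi> S = {x. is_arg_max \<phi> (\<lambda>y. y \<in> S) x}"

definition equicontinuous_on ::
  "'b::metric_space set \<Rightarrow> ('b \<Rightarrow> 'c::metric_space) set \<Rightarrow> bool" where
  "equicontinuous_on S \<F> \<longleftrightarrow>
     (\<forall>x\<in>S. \<forall>e>0. \<exists>d>0. \<forall>\<phi>\<in>\<F>. \<forall>y\<in>S. dist y x < d \<longrightarrow> dist (\<phi> y) (\<phi> x) < e)"

definition diff_quotient :: "('p::real_vector \<Rightarrow> real) \<Rightarrow> 'p \<Rightarrow> 'p \<Rightarrow> real \<Rightarrow> real" where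
  "diff_quotient \<phi> \<theta> r h = (\<phi> (\<theta> + h *\<^sub>R r) - \<phi> \<theta>) / h"

text \<open>The right and the left directional derivative both exist and are equal to \<^term>\<open>D\<close>.\<close>
definition has_dir_deriv :: "('p::real_vector \<Rightarrow> real) \<Rightarrow> 'p \<Rightarrow> 'p \<Rightarrow> real \<Rightarrow> bool" where
  "has_dir_deriv \<phi> \<theta> r D \<longleftrightarrow>
     (diff_quotient \<phi> \<theta> r \<longlongrightarrow> D) (at_right 0) \<and>
     (diff_quotient \<phi> \<theta> r \<longlongrightarrow> D) (at_left 0)"

section \<open>The distributionally robust control problem\<close>

record ('x, 'a, 'p) dr_model =
  states   :: "'x set"
  acts     :: "'a set"
  horizon  :: nat
  expo     :: nat        \<comment> \<open>the exponent \<open>q\<close> of the transport cost\<close>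
  radius   :: real
  reward   :: "nat \<Rightarrow> 'x \<Rightarrow> 'a \<Rightarrow> 'x \<Rightarrow> real"
  terminal :: "'x \<Rightarrow> real"
  nominal  :: "nat \<Rightarrow> 'x \<times> 'a \<Rightarrow> 'x measure"
  params   :: "'p set"
  refm     :: "'a measure"
  dens     :: "nat \<Rightarrow> 'p \<Rightarrow> 'x \<Rightarrow> 'a \<Rightarrow> real"

definition kernels ::
  "('x::euclidean_space, 'a::euclidean_space, 'p::euclidean_space) dr_model
     \<Rightarrow> ('x \<times> 'a \<Rightarrow> 'x measure) set" where
  "kernels M = measurable (borel_on (states M) \<Otimes>\<^sub>M borel_on (acts M))
                          (prob_algebra (borel_on (states M)))"

definition policy ::
  "('x::euclidean_space, 'a::euclidean_space, 'p::euclidean_space) dr_model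
     \<Rightarrow> nat \<Rightarrow> 'p \<Rightarrow> 'x \<Rightarrow> 'a measure" where
  "policy M t \<theta> x = density (refm M) (\<lambda>a. ennreal (dens M t \<theta> x a))"

definition wf_model ::
  "('x::euclidean_space, 'a::euclidean_space, 'p::euclidean_space) dr_model \<Rightarrow> bool" where
  "wf_model M \<longleftrightarrow>
     compact (states M) \<and> states M \<noteq> {} \<and>
     compact (acts M) \<and> acts M \<noteq> {} \<and>
     horizon M \<ge> 1 \<and> expo M \<ge> 1 \<and> radius M > 0 \<and>
     (\<lambda>(t, x, a, y). reward M t x a y) \<in> borel_measurable
        (count_space {..<horizon M} \<Otimes>\<^sub>M borel_on (states M) \<Otimes>\<^sub>M borel_on (acts M)
           \<Otimes>\<^sub>M borel_on (states M)) \<and>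
     terminal M \<in> borel_measurable (borel_on (states M)) \<and>
     (\<forall>t<horizon M. nominal M t \<in> kernels M) \<and>
     compact (params M) \<and>
     sets (refm M) = sets (borel_on (acts M)) \<and>
     (\<forall>t<horizon M. \<forall>\<theta>\<in>params M. \<forall>x\<in>states M.
        dens M t \<theta> x \<in> borel_measurable (borel_on (acts M)) \<and>
        (\<forall>a\<in>acts M. 0 \<le> dens M t \<theta> x a) \<and>
        prob_space (policy M t \<theta> x))"

text \<open>
  Differentiability on the parameter set is differentiability relative to that set, which is
  ordinary differentiability at its interior points.  Existence of the score includes positivity
  of the density, since the logarithm is total in HOL.
\<close>
definition regular_policies ::
  "('x::euclidean_space, 'a::euclidean_space, 'p::euclidean_space) dr_model \<Rightarrow> bool" where
  "regular_policies M \<longleftrightarrow>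
     (\<forall>t<horizon M.
        weakly_continuous_on (params M \<times> states M) (acts M) (\<lambda>(\<theta>, x). policy M t \<theta> x) \<and>
        (\<forall>\<phi>::'a \<Rightarrow> real. continuous_on (acts M) \<phi> \<longrightarrow>
           (\<exists>D. continuous_on (params M \<times> states M) D \<and>
              (\<forall>\<theta>\<in>params M. \<forall>x\<in>states M.
                 ((\<lambda>\<theta>'. \<integral>a. \<phi> a \<partial>policy M t \<theta>' x) has_derivative (\<lambda>v. D (\<theta>, x) \<bullet> v))
                   (at \<theta> within params M))))) \<and>
     (\<forall>t<horizon M. \<forall>\<theta>\<in>params M. \<forall>x\<in>states M. \<forall>a\<in>acts M. 0 < dens M t \<theta> x a) \<and>
     (\<exists>score C. \<forall>t<horizon M. \<forall>\<theta>\<in>params M. \<forall>x\<in>states M. \<forall>a\<in>acts M.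
        ((\<lambda>\<theta>'. ln (dens M t \<theta>' x a)) has_derivative (\<lambda>v. score t \<theta> x a \<bullet> v))
          (at \<theta> within params M) \<and>
        norm (score t \<theta> x a) \<le> C)"

definition ambiguity_ball ::
  "('x::euclidean_space, 'a::euclidean_space, 'p::euclidean_space) dr_model
     \<Rightarrow> nat \<Rightarrow> 'x \<Rightarrow> 'a \<Rightarrow> 'x measure set" where
  "ambiguity_ball M t x a =
     {\<mu> \<in> prob_measures_on (states M).
        wasserstein (expo M) (states M) \<mu> (nominal M t (x, a)) \<le> radius M}"

text \<open>A path from time \<open>t\<close> to time \<open>s\<close>: states at \<open>t, \<dots>, s\<close>, actions at \<open>t, \<dots>, s - 1\<close>.\<close>
definition path_space ::
  "('x::euclidean_space, 'a::euclidean_space, 'p::euclidean_space) dr_model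
     \<Rightarrow> nat \<Rightarrow> nat \<Rightarrow> ((nat \<Rightarrow> 'x) \<times> (nat \<Rightarrow> 'a)) measure" where
  "path_space M t s =
     (\<Pi>\<^sub>M l\<in>{t..s}. borel_on (states M)) \<Otimes>\<^sub>M (\<Pi>\<^sub>M l\<in>{t..<s}. borel_on (acts M))"

text \<open>
  \<open>path_law M \<theta> P t x n\<close> is the law
  \<open>\<delta>\<^sub>x(dx\<^sub>t) \<Prod>\<^sub>l \<pi>\<^sub>l(x\<^sub>l, da\<^sub>l) P\<^sub>l(x\<^sub>l, a\<^sub>l, dx\<^bsub>l+1\<^esub>)\<close>, \<open>l = t, \<dots>, t + n - 1\<close>, on
  \<open>path_space M t (t + n)\<close>.
\<close>
primrec path_law ::
  "('x::euclidean_space, 'a::euclidean_space, 'p::euclidean_space) dr_model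
     \<Rightarrow> 'p \<Rightarrow> (nat \<Rightarrow> 'x \<times> 'a \<Rightarrow> 'x measure) \<Rightarrow> nat \<Rightarrow> 'x \<Rightarrow> nat
     \<Rightarrow> ((nat \<Rightarrow> 'x) \<times> (nat \<Rightarrow> 'a)) measure" where
  "path_law M \<theta> P t x 0 = return (path_space M t t) (\<lambda>l\<in>{t}. x, \<lambda>l\<in>{}. undefined)"
| "path_law M \<theta> P t x (Suc n) =
     path_law M \<theta> P t x n \<bind> (\<lambda>(\<xi>, \<alpha>).
     policy M (t + n) \<theta> (\<xi> (t + n)) \<bind> (\<lambda>a.
     P (t + n) (\<xi> (t + n), a) \<bind> (\<lambda>y.
     return (path_space M t (t + Suc n)) (\<xi>(t + Suc n := y), \<alpha>(t + n := a)))))"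

definition total_reward ::
  "('x::euclidean_space, 'a::euclidean_space, 'p::euclidean_space) dr_model
     \<Rightarrow> nat \<Rightarrow> (nat \<Rightarrow> 'x) \<times> (nat \<Rightarrow> 'a) \<Rightarrow> real" where
  "total_reward M t = (\<lambda>(\<xi>, \<alpha>).
     (\<Sum>l=t..<horizon M. reward M l (\<xi> l) (\<alpha> l) (\<xi> (Suc l))) + terminal M (\<xi> (horizon M)))"

definition admissible_kernels ::
  "('x::euclidean_space, 'a::euclidean_space, 'p::euclidean_space) dr_model
     \<Rightarrow> nat \<Rightarrow> (nat \<Rightarrow> 'x \<times> 'a \<Rightarrow> 'x measure) set" where
  "admissible_kernels M t =
     {P. \<forall>l\<in>{t..<horizon M}. P l \<in> kernels M \<and>
           (\<forall>x\<in>states M. \<forall>a\<in>acts M. P l (x, a) \<in> ambiguity_ball M l x a)}"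

definition V ::
  "('x::euclidean_space, 'a::euclidean_space, 'p::euclidean_space) dr_model
     \<Rightarrow> nat \<Rightarrow> 'p \<Rightarrow> 'x \<Rightarrow> real" where
  "V M t \<theta> x =
     (INF P\<in>admissible_kernels M t.
        \<integral>\<omega>. total_reward M t \<omega> \<partial>path_law M \<theta> P t x (horizon M - t))"

section \<open>Dual objects\<close>

definition inner_objective ::
  "('x::euclidean_space, 'a::euclidean_space, 'p::euclidean_space) dr_model
     \<Rightarrow> nat \<Rightarrow> 'p \<Rightarrow> real \<Rightarrow> 'x \<Rightarrow> 'a \<Rightarrow> 'x \<Rightarrow> 'x \<Rightarrow> real" where
  "inner_objective M t \<theta> l x a x' y =
     reward M t x a y + V M (Suc t) \<theta> y + l * norm (x' - y) ^ expo M"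

definition F ::
  "('x::euclidean_space, 'a::euclidean_space, 'p::euclidean_space) dr_model
     \<Rightarrow> nat \<Rightarrow> 'p \<Rightarrow> real \<Rightarrow> 'x \<Rightarrow> 'a \<Rightarrow> real" where
  "F M t \<theta> l x a =
     (\<integral>x'. (INF y\<in>states M. inner_objective M t \<theta> l x a x' y) \<partial>nominal M t (x, a))
       - radius M ^ expo M * l"

definition Y_opt ::
  "('x::euclidean_space, 'a::euclidean_space, 'p::euclidean_space) dr_model
     \<Rightarrow> nat \<Rightarrow> 'p \<Rightarrow> real \<Rightarrow> 'x \<Rightarrow> 'a \<Rightarrow> 'x \<Rightarrow> 'x set" where
  "Y_opt M t \<theta> l x a x' = argmin_set (inner_objective M t \<theta> l x a x') (states M)"

definition Lambda_opt ::
  "('x::euclidean_space, 'a::euclidean_space, 'p::euclidean_space) dr_model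
     \<Rightarrow> nat \<Rightarrow> 'p \<Rightarrow> 'x \<Rightarrow> 'a \<Rightarrow> real set" where
  "Lambda_opt M t \<theta> x a = argmax_set (\<lambda>l. F M t \<theta> l x a) {0..}"

definition G ::
  "('x::euclidean_space, 'a::euclidean_space, 'p::euclidean_space) dr_model
     \<Rightarrow> nat \<Rightarrow> 'p \<Rightarrow> 'x \<Rightarrow> 'a \<Rightarrow> real" where
  "G M t \<theta> x a = (SUP l\<in>{0..}. F M t \<theta> l x a)"

end

theory Submission
  imports Defs
begin

text \<open>
  Uniqueness of the optimizers makes the dynamic programming recursion elementary. The optimizers
  depend continuously on their arguments, and \<open>F\<close> is differentiable in \<open>\<lambda>\<close> at its maximizer, with
  derivative the mean transport cost of the map \<open>x' \<mapsto> y\<^sup>*(x')\<close> minus \<open>\<epsilon>\<^sup>q\<close>. The first-order condition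
  says that the push-forward of the nominal kernel under this map lies in the ambiguity ball and
  attains the dual value, so this explicit measurable kernel is a worst case; weak duality gives the
  other inequality.

  The derivative in \<open>\<theta>\<close> is obtained by backward induction in time with Danskin's envelope argument,
  applied to the inner infimum over \<open>y\<close> and to the supremum over \<open>\<lambda>\<close>. Equicontinuity of the
  difference quotients replaces their values at the moving optimizers by those at the limit
  optimizer, and bounds them uniformly, so that dominated convergence applies under the nominal
  kernel. The bounded score turns the integral against the perturbed policy into one against the
  unperturbed policy, with a density ratio that tends to 1 boundedly.
\<close>

text \<open>The gradient at time t + 1 is constructed state by state, with no statement on how it
  depends on the state. Its integrals are therefore handled through the difference quotients: these
  are continuous in the state, and their pointwise limits inherit measurability and a bound from
  them. This is why limits are taken along sequences h_n tending to 0, and why one constant B with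
  |V_{t+1}^{\<theta>+hr} - V_{t+1}^\<theta>| \<le> B |h| is carried along. The infimum over y, the
  nominal integral and the supremum over \<lambda> are nonexpansive, so the same B serves for
  \<open>F\<close> and \<open>G\<close>.

  In V_t = \<integral> G d\<pi> both the integrand and the measure move with \<theta>. The increment
  is split into the increment of \<open>G\<close> against the perturbed policy, where the density
  ratio enters, and \<open>G\<close> frozen at \<theta> against the increment of the policy.

  The constant \<Lambda> makes the range of \<lambda> compact, so that Danskin's argument applies to
  the supremum over \<lambda> as it does to the infimum over y.\<close>

section \<open>Parametric minimization\<close>

text \<open>The tube lemma: compactness of \<open>Y\<close> turns joint continuity into uniform
  convergence of the slices, the form in which a moving objective is compared with its
  limit.\<close>

lemma uniform_limit_of_continuous_on_Times:
  fixes \<phi> :: "'u::topological_space \<times> 'y::topological_space \<Rightarrow> 'c::metric_space"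
  assumes "continuous_on (U \<times> Y) \<phi>" "compact Y" "u \<in> U"
  shows "uniform_limit Y (\<lambda>v y. \<phi> (v, y)) (\<lambda>y. \<phi> (u, y)) (at u within U)"
proof (rule uniform_limitI)
  fix e :: real assume "e > 0"
  then obtain N where N: "u \<in> N" "open N" "\<forall>v\<in>N \<inter> U. \<forall>y\<in>Y. dist (\<phi> (v, y)) (\<phi> (u, y)) \<le> e / 2"
    using continuous_on_prod_compactE[OF assms, of "e / 2"] by auto
  show "\<forall>\<^sub>F v in at u within U. \<forall>y\<in>Y. dist (\<phi> (v, y)) (\<phi> (u, y)) < e"
    unfolding eventually_at_topological
    using N \<open>e > 0\<close> by (intro exI[of _ N]) force
qed

lemma continuous_on_Pair_slice:
  "continuous_on (U \<times> Y) \<phi> \<Longrightarrow> u \<in> U \<Longrightarrow> continuous_on Y (\<lambda>y. \<phi> (u, y))"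
  by (erule continuous_on_compose2) (auto intro!: continuous_intros)

text \<open>Outside the ball of radius e around \<open>p\<close> the compact remainder of
  \<open>Y\<close> has values at least k above \<open>\<psi> p\<close>. Once \<Psi> is within k/2 of
  \<psi>, no point there can do as well as \<open>p\<close>. It suffices that \<open>z i\<close> is
  at least as good as \<open>p\<close>; it need not be a minimizer.\<close>

lemma unique_argmin_tendsto:
  fixes \<psi> :: "'y::metric_space \<Rightarrow> real"
  assumes Y: "compact Y" and \<psi>: "continuous_on Y \<psi>" and p: "p \<in> Y"
    and uniq: "\<And>y. y \<in> Y \<Longrightarrow> y \<noteq> p \<Longrightarrow> \<psi> p < \<psi> y"
    and lim: "uniform_limit Y \<Psi> \<psi> \<F>"
    and z: "\<forall>\<^sub>F i in \<F>. z i \<in> Y \<and> \<Psi> i (z i) \<le> \<Psi> i p"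
  shows "(z \<longlongrightarrow> p) \<F>"
proof (rule tendstoI)
  fix e :: real assume "e > 0"
  define K where "K = Y - ball p e"
  have K: "compact K" "K \<subseteq> Y" using Y by (auto simp: K_def intro: compact_diff)
  obtain k where k: "k > 0" "\<And>y. y \<in> K \<Longrightarrow> \<psi> p + k \<le> \<psi> y"
  proof (cases "K = {}")
    case True then show ?thesis using that[of 1] by auto
  next
    case False
    then obtain w where w: "w \<in> K" "\<And>y. y \<in> K \<Longrightarrow> \<psi> w \<le> \<psi> y"
      using continuous_attains_inf[OF K(1) False continuous_on_subset[OF \<psi> K(2)]] by auto
    then have "\<psi> p < \<psi> w" using uniq[of w] \<open>e > 0\<close> w(1) by (cases "w = p") (auto simp: K_def)
    then show ?thesis using that[of "\<psi> w - \<psi> p"] w by auto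
  qed
  from half_gt_zero[OF k(1)] have "\<forall>\<^sub>F i in \<F>. \<forall>y\<in>Y. dist (\<Psi> i y) (\<psi> y) < k / 2"
    using lim unfolding uniform_limit_iff by blast
  with z show "\<forall>\<^sub>F i in \<F>. dist (z i) p < e"
  proof eventually_elim
    case (elim i)
    have "z i \<notin> K"
    proof
      assume "z i \<in> K"
      with k(2)[of "z i"] elim p have "\<psi> p + k \<le> \<psi> (z i)" "\<bar>\<Psi> i (z i) - \<psi> (z i)\<bar> < k / 2"
        "\<bar>\<Psi> i p - \<psi> p\<bar> < k / 2" "\<Psi> i (z i) \<le> \<Psi> i p"
        by (auto simp: dist_real_def)
      then show False by argo
    qed
    then show ?case using elim by (auto simp: K_def dist_commute)
  qed
qed

text \<open>Berge's maximum theorem in the single-valued case. It is the source of the continuity of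
  \<open>lstar\<close> and \<open>ystar\<close>.\<close>

lemma continuous_on_unique_argmin:
  fixes \<phi> :: "'u::topological_space \<times> 'y::metric_space \<Rightarrow> real"
  assumes \<phi>: "continuous_on (U \<times> Y) \<phi>" and Y: "compact Y"
    and p: "\<And>u. u \<in> U \<Longrightarrow> p u \<in> Y"
    and uniq: "\<And>u y. u \<in> U \<Longrightarrow> y \<in> Y \<Longrightarrow> y \<noteq> p u \<Longrightarrow> \<phi> (u, p u) < \<phi> (u, y)"
  shows "continuous_on U p"
  unfolding continuous_on_def
proof
  fix u assume u: "u \<in> U"
  show "(p \<longlongrightarrow> p u) (at u within U)"
  proof (rule unique_argmin_tendsto[OF Y, where \<Psi> = "\<lambda>v y. \<phi> (v, y)" and \<psi> = "\<lambda>y. \<phi> (u, y)"])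
    show "continuous_on Y (\<lambda>y. \<phi> (u, y))"
      by (rule continuous_on_Pair_slice[OF \<phi> u])
    show "uniform_limit Y (\<lambda>v y. \<phi> (v, y)) (\<lambda>y. \<phi> (u, y)) (at u within U)"
      by (rule uniform_limit_of_continuous_on_Times[OF \<phi> Y u])
    show "\<forall>\<^sub>F v in at u within U. p v \<in> Y \<and> \<phi> (v, p v) \<le> \<phi> (v, p u)"
      using p uniq u by (auto simp: eventually_at_topological intro!: exI[of _ UNIV])
         (metis less_imp_le order_refl)
  qed (use p uniq u in auto)
qed

text \<open>
  Danskin's argument: for \<open>\<eta> i > 0\<close> the quotient of the minimal values lies between the quotients
  of the objectives at the perturbed minimizer \<open>z i\<close> and at the unperturbed one \<open>p\<close>.
\<close>
lemma envelope_tendsto: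
  fixes \<psi> :: "'y::metric_space \<Rightarrow> real" and \<eta> :: "'i \<Rightarrow> real"
  assumes Y: "compact Y" and \<psi>: "continuous_on Y \<psi>" and p: "p \<in> Y"
    and uniq: "\<And>y. y \<in> Y \<Longrightarrow> y \<noteq> p \<Longrightarrow> \<psi> p < \<psi> y"
    and \<eta>: "(\<eta> \<longlongrightarrow> 0) \<F>" "\<forall>\<^sub>F i in \<F>. \<eta> i \<noteq> 0"
    and z: "\<forall>\<^sub>F i in \<F>. z i \<in> Y \<and> \<Psi> i (z i) \<le> \<Psi> i p"
    and bound: "\<forall>\<^sub>F i in \<F>. \<forall>y\<in>Y. \<bar>\<Psi> i y - \<psi> y\<bar> \<le> B * \<bar>\<eta> i\<bar>"
    and lim: "((\<lambda>i. (\<Psi> i p - \<psi> p) / \<eta> i) \<longlongrightarrow> D) \<F>"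
    and equi: "\<And>e. e > 0 \<Longrightarrow> \<exists>d>0. \<forall>\<^sub>F i in \<F>. \<forall>y\<in>Y. dist y p < d \<longrightarrow>
       \<bar>(\<Psi> i y - \<psi> y) / \<eta> i - (\<Psi> i p - \<psi> p) / \<eta> i\<bar> < e"
  shows "((\<lambda>i. (\<Psi> i (z i) - \<psi> p) / \<eta> i) \<longlongrightarrow> D) \<F>"
proof (rule tendstoI)
  fix e :: real assume e: "e > 0"
  have "uniform_limit Y \<Psi> \<psi> \<F>"
  proof (rule uniform_limitI)
    fix k :: real assume "k > 0"
    have "((\<lambda>i. B * \<bar>\<eta> i\<bar>) \<longlongrightarrow> B * \<bar>0\<bar>) \<F>" by (intro tendsto_intros \<eta>)
    then have "\<forall>\<^sub>F i in \<F>. B * \<bar>\<eta> i\<bar> < k" using \<open>k > 0\<close> by (auto dest: order_tendstoD)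
    with bound show "\<forall>\<^sub>F i in \<F>. \<forall>y\<in>Y. dist (\<Psi> i y) (\<psi> y) < k"
      by eventually_elim (force simp: dist_real_def)
  qed
  then have zp: "(z \<longlongrightarrow> p) \<F>" using Y \<psi> p uniq z by (intro unique_argmin_tendsto)
  obtain d where d: "d > 0" "\<forall>\<^sub>F i in \<F>. \<forall>y\<in>Y. dist y p < d \<longrightarrow>
       \<bar>(\<Psi> i y - \<psi> y) / \<eta> i - (\<Psi> i p - \<psi> p) / \<eta> i\<bar> < e / 2"
    using equi[of "e / 2"] e by auto
  have "\<forall>\<^sub>F i in \<F>. dist (z i) p < d" "\<forall>\<^sub>F i in \<F>. dist ((\<Psi> i p - \<psi> p) / \<eta> i) D < e / 2"
    by (rule tendstoD[OF zp d(1)]) (rule tendstoD[OF lim half_gt_zero[OF e]])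
  with z \<eta>(2) d(2) show "\<forall>\<^sub>F i in \<F>. dist ((\<Psi> i (z i) - \<psi> p) / \<eta> i) D < e"
  proof eventually_elim
    case (elim i)
    let ?a = "(\<Psi> i (z i) - \<psi> (z i)) / \<eta> i" and ?b = "(\<Psi> i (z i) - \<psi> p) / \<eta> i"
      and ?c = "(\<Psi> i p - \<psi> p) / \<eta> i"
    \<comment> \<open>Minimality of \<open>p\<close> for \<psi> compares \<open>?a\<close> with
      \<open>?b\<close>, and the choice of \<open>z i\<close> compares \<open>?b\<close> with
      \<open>?c\<close>. A negative \<eta> reverses both comparisons, so the sandwich covers right
      and left derivatives at once.\<close>
    have "\<psi> p \<le> \<psi> (z i)" using elim uniq[of "z i"] by (cases "z i = p") auto
    then have "(?a \<le> ?b \<and> ?b \<le> ?c) \<or> (?c \<le> ?b \<and> ?b \<le> ?a)"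
      using elim by (cases "\<eta> i > 0") (auto simp: divide_simps)
    moreover have "\<bar>?a - ?c\<bar> < e / 2" "\<bar>?c - D\<bar> < e / 2" using elim by (auto simp: dist_real_def)
    ultimately show ?case unfolding dist_real_def by argo
  qed
qed

section \<open>Infima over compact sets\<close>

lemma INF_eq_minimum:
  fixes \<psi> :: "'y \<Rightarrow> real"
  assumes "p \<in> Y" "\<And>y. y \<in> Y \<Longrightarrow> \<psi> p \<le> \<psi> y"
  shows "(INF y\<in>Y. \<psi> y) = \<psi> p"
  using assms by (intro cInf_eq_minimum) auto

lemma INF_compact_attained:
  fixes \<psi> :: "'y::topological_space \<Rightarrow> real"
  assumes "compact Y" "Y \<noteq> {}" "continuous_on Y \<psi>"
  obtains p where "p \<in> Y" "(INF y\<in>Y. \<psi> y) = \<psi> p" "\<And>y. y \<in> Y \<Longrightarrow> \<psi> p \<le> \<psi> y"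
  using continuous_attains_inf[OF assms] INF_eq_minimum[of _ Y \<psi>] by metis

lemma abs_diff_INF_le:
  fixes \<psi> \<psi>' :: "'y::topological_space \<Rightarrow> real"
  assumes "compact Y" "Y \<noteq> {}" "continuous_on Y \<psi>" "continuous_on Y \<psi>'"
    and "\<And>y. y \<in> Y \<Longrightarrow> \<bar>\<psi> y - \<psi>' y\<bar> \<le> e"
  shows "\<bar>(INF y\<in>Y. \<psi> y) - (INF y\<in>Y. \<psi>' y)\<bar> \<le> e"
proof -
  obtain p where p: "p \<in> Y" "(INF y\<in>Y. \<psi> y) = \<psi> p" "\<And>y. y \<in> Y \<Longrightarrow> \<psi> p \<le> \<psi> y"
    using INF_compact_attained[OF assms(1-3)] by blast
  obtain p' where p': "p' \<in> Y" "(INF y\<in>Y. \<psi>' y) = \<psi>' p'" "\<And>y. y \<in> Y \<Longrightarrow> \<psi>' p' \<le> \<psi>' y"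
    using INF_compact_attained[OF assms(1,2,4)] by blast
  show ?thesis unfolding p p'
    using p(3)[OF p'(1)] p'(3)[OF p(1)] assms(5)[OF p(1)] assms(5)[OF p'(1)] by argo
qed

lemma continuous_on_INF_compact:
  fixes \<phi> :: "'u::topological_space \<times> 'y::topological_space \<Rightarrow> real"
  assumes \<phi>: "continuous_on (U \<times> Y) \<phi>" and Y: "compact Y" "Y \<noteq> {}"
  shows "continuous_on U (\<lambda>u. INF y\<in>Y. \<phi> (u, y))"
  unfolding continuous_on_def
proof (intro ballI tendstoI)
  fix u and e :: real assume u: "u \<in> U" and "e > 0"
  note slice = continuous_on_Pair_slice[OF \<phi>]
  have "\<forall>\<^sub>F v in at u within U. \<forall>y\<in>Y. dist (\<phi> (v, y)) (\<phi> (u, y)) < e / 2"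
    using uniform_limit_of_continuous_on_Times[OF \<phi> Y(1) u] half_gt_zero[OF \<open>e > 0\<close>]
    unfolding uniform_limit_iff by blast
  moreover have "\<forall>\<^sub>F v in at u within U. v \<in> U"
    by (auto simp: eventually_at_topological)
  ultimately show "\<forall>\<^sub>F v in at u within U. dist (INF y\<in>Y. \<phi> (v, y)) (INF y\<in>Y. \<phi> (u, y)) < e"
  proof eventually_elim
    case (elim v)
    then have "\<bar>(INF y\<in>Y. \<phi> (v, y)) - (INF y\<in>Y. \<phi> (u, y))\<bar> \<le> e / 2"
      by (intro abs_diff_INF_le Y slice u) (auto simp: dist_real_def less_imp_le)
    then show ?case using \<open>e > 0\<close> by (auto simp: dist_real_def)
  qed
qed

text \<open>As in the Arzela-Ascoli theorem, finitely many balls on which the whole family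
  oscillates by less than 1 reduce a uniform bound to bounds at the centres; there the pointwise
  limits provide them.\<close>

lemma equicontinuous_on_pointwise_bounded:
  fixes Q :: "'i \<Rightarrow> 'b::metric_space \<Rightarrow> real"
  assumes S: "compact S" and Q: "equicontinuous_on S (Q ` H)" and H: "\<forall>\<^sub>F n in \<F>. n \<in> H"
    and lim: "\<And>x. x \<in> S \<Longrightarrow> ((\<lambda>n. Q n x) \<longlongrightarrow> L x) \<F>"
  obtains B where "B \<ge> 0" "\<forall>\<^sub>F n in \<F>. \<forall>x\<in>S. \<bar>Q n x\<bar> \<le> B"
proof -
  have "\<forall>x\<in>S. \<exists>d>0. \<forall>n\<in>H. \<forall>y\<in>S. dist y x < d \<longrightarrow> dist (Q n y) (Q n x) < 1"
    using Q unfolding equicontinuous_on_def by (metis imageI zero_less_one)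
  then obtain d where d: "\<And>x. x \<in> S \<Longrightarrow> d x > 0"
    "\<And>x n y. n \<in> H \<Longrightarrow> x \<in> S \<Longrightarrow> y \<in> S \<Longrightarrow> dist y x < d x \<Longrightarrow> dist (Q n y) (Q n x) < 1"
    by metis
  have cover: "S \<subseteq> (\<Union>x\<in>S. ball x (d x))" using d(1) by force
  obtain C where C: "C \<subseteq> S" "finite C" "S \<subseteq> (\<Union>x\<in>C. ball x (d x))"
    by (rule compactE_image[OF S _ cover]) auto
  \<comment> \<open>The 2 is one unit for the oscillation within a ball and one for the distance of
    \<open>Q n c\<close> to its limit \<open>L c\<close>.\<close>
  define B where "B = (\<Sum>c\<in>C. \<bar>L c\<bar>) + 2"
  have "\<forall>\<^sub>F n in \<F>. \<forall>c\<in>C. dist (Q n c) (L c) < 1"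
    using C lim by (intro eventually_ball_finite) (auto intro!: tendstoD)
  with H have "\<forall>\<^sub>F n in \<F>. \<forall>x\<in>S. \<bar>Q n x\<bar> \<le> B"
  proof eventually_elim
    case (elim n)
    show ?case
    proof
      fix x assume x: "x \<in> S"
      then obtain c where c: "c \<in> C" "dist x c < d c" using C by (auto simp: dist_commute)
      have "dist (Q n x) (Q n c) < 1" using c C x d(2) elim by auto
      moreover have "dist (Q n c) (L c) < 1" using elim c by auto
      moreover have "\<bar>L c\<bar> \<le> (\<Sum>c\<in>C. \<bar>L c\<bar>)" using c C by (intro member_le_sum) auto
      ultimately show "\<bar>Q n x\<bar> \<le> B" by (auto simp: B_def dist_real_def)
    qed
  qed
  moreover have "B \<ge> 0" by (auto simp: B_def sum_nonneg intro!: add_nonneg_nonneg)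
  ultimately show ?thesis using that by blast
qed

section \<open>Kernels and weak continuity\<close>

lemma space_borel_on [simp]: "space (borel_on S) = S"
  by (simp add: space_restrict_space)

lemma borel_measurable_continuous_on_compose:
  fixes f :: "'a::topological_space \<Rightarrow> 'b::topological_space"
  assumes "continuous_on S f" "g \<in> borel_measurable N" "\<And>x. x \<in> space N \<Longrightarrow> g x \<in> S"
  shows "(\<lambda>x. f (g x)) \<in> borel_measurable N"
  using assms
  by (intro measurable_compose[OF _ borel_measurable_continuous_on_restrict[OF assms(1)]]
      measurable_restrict_space2) auto

lemma borel_measurable_restrict_borelD: "g \<in> N \<rightarrow>\<^sub>M borel_on S \<Longrightarrow> g \<in> borel_measurable N"
  by (simp add: measurable_restrict_space2_iff)

lemma borel_measurable_norm_diff_power: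
  fixes f g :: "'b \<Rightarrow> 'a::euclidean_space"
  assumes "f \<in> N \<rightarrow>\<^sub>M borel_on S" "g \<in> N \<rightarrow>\<^sub>M borel_on S"
  shows "(\<lambda>z. norm (f z - g z) ^ k) \<in> borel_measurable N"
proof -
  note [measurable] = assms[THEN borel_measurable_restrict_borelD]
  show ?thesis by measurable
qed

lemma compact_continuous_bounded:
  fixes f :: "'a::topological_space \<Rightarrow> real"
  assumes "compact S" "continuous_on S f"
  obtains B where "B \<ge> 0" "\<And>x. x \<in> S \<Longrightarrow> \<bar>f x\<bar> \<le> B"
proof -
  have "bounded (f ` S)" using assms by (simp add: compact_continuous_image compact_imp_bounded)
  then obtain B where "\<And>x. x \<in> S \<Longrightarrow> \<bar>f x\<bar> \<le> B" by (auto simp: bounded_iff)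
  then show ?thesis using that[of "max B 0"] by (simp add: le_max_iff_disj)
qed

lemma prob_measures_onD:
  assumes "\<mu> \<in> prob_measures_on S"
  shows "prob_space \<mu>" "sets \<mu> = sets (borel_on S)" "space \<mu> = S"
  using assms by (auto simp: space_prob_algebra dest: sets_eq_imp_space_eq)

lemma integrable_continuous_on_compact:
  fixes f :: "'a::topological_space \<Rightarrow> real"
  assumes "\<mu> \<in> prob_measures_on S" "compact S" "continuous_on S f"
  shows "integrable \<mu> f"
proof -
  interpret prob_space \<mu> using assms(1) by (rule prob_measures_onD)
  obtain B where "\<And>x. x \<in> S \<Longrightarrow> \<bar>f x\<bar> \<le> B" using compact_continuous_bounded[OF assms(2,3)] by metis
  then show ?thesis
    using borel_measurable_continuous_on_restrict[OF assms(3)] prob_measures_onD[OF assms(1)]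
    by (intro integrable_const_bound[where B = B]) (auto cong: measurable_cong_sets)
qed

lemma (in prob_space) abs_integral_diff_le:
  fixes f g :: "'a \<Rightarrow> real"
  assumes "integrable M f" "integrable M g" "\<And>x. x \<in> space M \<Longrightarrow> \<bar>f x - g x\<bar> \<le> e"
  shows "\<bar>(\<integral>x. f x \<partial>M) - (\<integral>x. g x \<partial>M)\<bar> \<le> e"
proof -
  have "\<bar>(\<integral>x. f x \<partial>M) - (\<integral>x. g x \<partial>M)\<bar> = \<bar>\<integral>x. f x - g x \<partial>M\<bar>"
    using assms by simp
  also have "\<dots> \<le> (\<integral>x. \<bar>f x - g x\<bar> \<partial>M)"
    by (rule integral_abs_bound)
  also have "\<dots> \<le> (\<integral>x. e \<partial>M)"
    using assms by (intro integral_mono) auto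
  finally show ?thesis by (simp add: prob_space)
qed

text \<open>Integrand and measure move together. The integrand is moved first, at the cost of its
  uniform distance because each \<open>K v\<close> has mass 1; then only the measure moves against a
  fixed continuous slice, which is weak continuity.\<close>

lemma continuous_on_integral_weakly_continuous:
  fixes \<phi> :: "'u::topological_space \<times> 's::topological_space \<Rightarrow> real"
  assumes K: "weakly_continuous_on U S K" "\<And>u. u \<in> U \<Longrightarrow> K u \<in> prob_measures_on S"
    and S: "compact S" and \<phi>: "continuous_on (U \<times> S) \<phi>"
  shows "continuous_on U (\<lambda>u. \<integral>s. \<phi> (u, s) \<partial>K u)"
  unfolding continuous_on_def
proof (intro ballI tendstoI)
  fix u and e :: real assume u: "u \<in> U" and "e > 0"
  note slice = continuous_on_Pair_slice[OF \<phi>]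
  have "\<forall>\<^sub>F v in at u within U. \<forall>y\<in>S. dist (\<phi> (v, y)) (\<phi> (u, y)) < e / 2"
    using uniform_limit_of_continuous_on_Times[OF \<phi> S u] half_gt_zero[OF \<open>e > 0\<close>]
    unfolding uniform_limit_iff by blast
  moreover have "\<forall>\<^sub>F v in at u within U. v \<in> U"
    by (auto simp: eventually_at_topological)
  moreover have "((\<lambda>v. \<integral>s. \<phi> (u, s) \<partial>K v) \<longlongrightarrow> (\<integral>s. \<phi> (u, s) \<partial>K u)) (at u within U)"
    using K(1) slice[OF u] u unfolding weakly_continuous_on_def continuous_on_def by blast
  then have "\<forall>\<^sub>F v in at u within U. dist (\<integral>s. \<phi> (u, s) \<partial>K v) (\<integral>s. \<phi> (u, s) \<partial>K u) < e / 2"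
    by (rule tendstoD[OF _ half_gt_zero[OF \<open>e > 0\<close>]])
  ultimately show "\<forall>\<^sub>F v in at u within U. dist (\<integral>s. \<phi> (v, s) \<partial>K v) (\<integral>s. \<phi> (u, s) \<partial>K u) < e"
  proof eventually_elim
    case (elim v)
    interpret v: prob_space "K v" using K(2) elim by (auto dest: prob_measures_onD)
    have "\<bar>(\<integral>s. \<phi> (v, s) \<partial>K v) - (\<integral>s. \<phi> (u, s) \<partial>K v)\<bar> \<le> e / 2"
      using elim u prob_measures_onD(3)[OF K(2), of v]
      by (intro v.abs_integral_diff_le integrable_continuous_on_compact[OF K(2) S] slice)
        (auto simp: dist_real_def less_imp_le)
    moreover have "\<bar>(\<integral>s. \<phi> (u, s) \<partial>K v) - (\<integral>s. \<phi> (u, s) \<partial>K u)\<bar> < e / 2"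
      using elim by (simp only: dist_real_def)
    ultimately show ?case unfolding dist_real_def by argo
  qed
qed

lemma sets_borel_on_eq_sigma_closed:
  fixes S :: "'a::topological_space set"
  assumes "S \<in> sets borel"
  shows "sets (borel_on S) = sigma_sets S ((\<inter>) S ` Collect closed)"
proof -
  have "sets (borel :: 'a measure) = sigma_sets UNIV (Collect closed)"
    by (subst borel_eq_closed) simp
  then show ?thesis
    using sigma_sets_Int[of S UNIV "Collect closed"] assms
    by (simp add: sets_restrict_space)
qed

text \<open>
  The indicator of a closed set \<open>C\<close> is the limit of the continuous functions
  \<open>max 0 (1 - n * infdist _ C)\<close>.
\<close>
lemma weakly_continuous_imp_measurable_kernel:
  fixes K :: "'u::topological_space \<Rightarrow> 's::metric_space measure"
  assumes K: "weakly_continuous_on U S K" "\<And>u. u \<in> U \<Longrightarrow> K u \<in> prob_measures_on S"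
    and S: "S \<in> sets borel"
  shows "K \<in> borel_on U \<rightarrow>\<^sub>M prob_algebra (borel_on S)"
proof (rule measurable_prob_algebra_generated[OF sets_borel_on_eq_sigma_closed[OF S]])
  show "Int_stable ((\<inter>) S ` Collect closed)"
  proof (rule Int_stableI_image)
    fix a b :: "'s set" assume "a \<in> Collect closed" "b \<in> Collect closed"
    then show "\<exists>c\<in>Collect closed. S \<inter> a \<inter> (S \<inter> b) = S \<inter> c"
      by (intro bexI[of _ "a \<inter> b"]) auto
  qed
  fix E assume "E \<in> (\<inter>) S ` Collect closed"
  then obtain C where C: "closed C" "E = S \<inter> C" by auto
  \<comment> \<open>\<open>infdist\<close> to the empty set is 0 by convention, so the approximating
    functions would be constantly 1 for \<open>C = {}\<close>; that case is split off.\<close>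
  show "(\<lambda>u. emeasure (K u) E) \<in> borel_measurable (borel_on U)"
  proof (cases "C = {}")
    case True then show ?thesis using C by simp
  next
    case False
    define \<phi> where "\<phi> n s = max 0 (1 - real n * infdist s C)" for n s
    have \<phi>: "continuous_on S (\<phi> n)" for n
      unfolding \<phi>_def by (intro continuous_intros)
    have lim: "(\<lambda>n. \<phi> n s) \<longlonglongrightarrow> indicator C s" for s
    proof (cases "s \<in> C")
      case True then show ?thesis by (simp add: \<phi>_def)
    next
      case sC: False
      then have "infdist s C > 0"
        using C(1) False by (metis in_closed_iff_infdist_zero infdist_nonneg less_eq_real_def)
      then have "\<forall>\<^sub>F n in sequentially. real n * infdist s C > 1"
        by real_asymp
      then have "\<forall>\<^sub>F n in sequentially. \<phi> n s = 0"
        by eventually_elim (simp add: \<phi>_def)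
      then show ?thesis using sC by (simp add: tendsto_eventually)
    qed
    have "(\<lambda>u. measure (K u) E) \<in> borel_measurable (borel_on U)"
    proof (rule borel_measurable_LIMSEQ_real[where u = "\<lambda>n u. \<integral>s. \<phi> n s \<partial>K u"])
      show "(\<lambda>u. \<integral>s. \<phi> n s \<partial>K u) \<in> borel_measurable (borel_on U)" for n
        using K(1) \<phi> unfolding weakly_continuous_on_def
        by (intro borel_measurable_continuous_on_restrict) auto
      fix u assume "u \<in> space (borel_on U)"
      then have u: "K u \<in> prob_measures_on S" using K(2) by auto
      interpret prob_space "K u" using u by (rule prob_measures_onD)
      have E: "E \<in> sets (K u)"
        using C prob_measures_onD(2)[OF u] by (auto simp: sets_restrict_space)
      have m: "\<phi> n \<in> borel_measurable (K u)" for n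
        using borel_measurable_continuous_on_restrict[OF \<phi>] prob_measures_onD(2)[OF u]
        by (auto cong: measurable_cong_sets)
      have "(\<lambda>n. \<integral>s. \<phi> n s \<partial>K u) \<longlonglongrightarrow> (\<integral>s. indicator E s \<partial>K u)"
      proof (rule integral_dominated_convergence[where w = "\<lambda>_. 1"])
        show "AE s in K u. (\<lambda>n. \<phi> n s) \<longlonglongrightarrow> indicator E s"
          using lim prob_measures_onD(3)[OF u] by (intro AE_I2) (simp add: C(2) indicator_def)
        show "AE s in K u. norm (\<phi> n s) \<le> 1" for n
          by (auto simp: \<phi>_def infdist_nonneg)
      qed (use E m in auto)
      then show "(\<lambda>n. \<integral>s. \<phi> n s \<partial>K u) \<longlonglongrightarrow> measure (K u) E"
        using E by simp
    qed
    then have "(\<lambda>u. ennreal (measure (K u) E)) \<in> borel_measurable (borel_on U)" by simp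
    also have "?this \<longleftrightarrow> ?thesis"
      by (intro measurable_cong)
        (simp add: finite_measure.emeasure_eq_measure prob_space.finite_measure prob_measures_onD(1)[OF K(2)])
    finally show ?thesis .
  qed
qed (use K(2) in \<open>auto dest: prob_measures_onD\<close>)

section \<open>Couplings and integration against kernels\<close>

lemma distr_pair_snd:
  assumes "prob_space N" "prob_space M"
  shows "distr (N \<Otimes>\<^sub>M M) M snd = M"
proof (intro measure_eqI)
  interpret N: prob_space N by fact
  interpret M: prob_space M by fact
  fix A assume A: "A \<in> sets (distr (N \<Otimes>\<^sub>M M) M snd)"
  then have "emeasure (distr (N \<Otimes>\<^sub>M M) M snd) A = emeasure (N \<Otimes>\<^sub>M M) (space N \<times> A)"
    by (auto simp: emeasure_distr space_pair_measure dest: sets.sets_into_space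
        intro!: arg_cong2[where f = emeasure])
  with A show "emeasure (distr (N \<Otimes>\<^sub>M M) M snd) A = emeasure M A"
    by (simp add: M.emeasure_pair_measure_Times N.emeasure_space_1)
qed simp

text \<open>Makes the infimum in \<open>wasserstein\<close> range over a nonempty set, without which
  a real-valued \<open>INF\<close> carries no information.\<close>

lemma pair_measure_coupling:
  assumes "\<mu> \<in> prob_measures_on S" "\<nu> \<in> prob_measures_on S"
  shows "\<mu> \<Otimes>\<^sub>M \<nu> \<in> couplings S \<mu> \<nu>"
proof -
  note \<mu> = prob_measures_onD[OF assms(1)] and \<nu> = prob_measures_onD[OF assms(2)]
  have "distr (\<mu> \<Otimes>\<^sub>M \<nu>) (borel_on S) fst = distr (\<mu> \<Otimes>\<^sub>M \<nu>) \<mu> fst"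
    by (rule distr_cong[OF refl \<mu>(2)[symmetric] refl])
  moreover have "distr (\<mu> \<Otimes>\<^sub>M \<nu>) (borel_on S) snd = distr (\<mu> \<Otimes>\<^sub>M \<nu>) \<nu> snd"
    by (rule distr_cong[OF refl \<nu>(2)[symmetric] refl])
  moreover have "prob_space (\<mu> \<Otimes>\<^sub>M \<nu>)" by (rule prob_space_pair[OF \<mu>(1) \<nu>(1)])
  moreover have "sets (\<mu> \<Otimes>\<^sub>M \<nu>) = sets (borel_on S \<Otimes>\<^sub>M borel_on S)"
    by (rule sets_pair_measure_cong[OF \<mu>(2) \<nu>(2)])
  ultimately show ?thesis
    unfolding couplings_def space_prob_algebra
    using prob_space.distr_pair_fst[OF \<nu>(1), of \<mu>] distr_pair_snd[OF \<mu>(1) \<nu>(1)] by simp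
qed

text \<open>The directional arguments control only the scalar functions
  \<open>f x \<bullet> b\<close>; the vector integral that defines the gradient is assembled from
  its coordinates.\<close>

lemma integrable_of_inner_Basis:
  fixes f :: "'a \<Rightarrow> 'b::euclidean_space"
  assumes "\<And>b. b \<in> Basis \<Longrightarrow> integrable M (\<lambda>x. f x \<bullet> b)"
  shows "integrable M f"
proof -
  have "integrable M (\<lambda>x. \<Sum>b\<in>Basis. (f x \<bullet> b) *\<^sub>R b)"
    using assms by (intro Bochner_Integration.integrable_sum integrable_scaleR_left) auto
  then show ?thesis by (simp add: euclidean_representation)
qed

lemma measurable_imp_prob_measure:
  "N \<in> \<mu> \<rightarrow>\<^sub>M prob_algebra K \<Longrightarrow> x \<in> space \<mu> \<Longrightarrow> prob_space (N x) \<and> sets (N x) = sets K \<and> space (N x) = space K"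
  by (drule (1) measurable_space) (auto simp: space_prob_algebra dest: sets_eq_imp_space_eq)

lemma integral_bind_prob_algebra:
  fixes f :: "'b \<Rightarrow> real"
  assumes "prob_space \<mu>" and N: "N \<in> \<mu> \<rightarrow>\<^sub>M prob_algebra K"
    and f: "f \<in> borel_measurable K" "\<And>y. y \<in> space K \<Longrightarrow> \<bar>f y\<bar> \<le> B"
  shows "(\<integral>y. f y \<partial>(\<mu> \<bind> N)) = (\<integral>x. \<integral>y. f y \<partial>N x \<partial>\<mu>)"
proof (rule integral_bind[OF f(1), where B = B and B' = 1])
  show "N \<in> \<mu> \<rightarrow>\<^sub>M subprob_algebra K" using N by (rule measurable_prob_algebraD)
  show "finite_measure \<mu>" using assms(1) by (simp add: prob_space.finite_measure)
  show "AE x in \<mu>. emeasure (N x) (space (N x)) \<le> ennreal 1"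
  proof (rule AE_I2)
    fix x assume "x \<in> space \<mu>"
    then have "emeasure (N x) (space (N x)) = 1"
      using measurable_imp_prob_measure[OF N] by (intro prob_space.emeasure_space_1) simp
    then show "emeasure (N x) (space (N x)) \<le> ennreal 1" by (simp only:) simp
  qed
qed (use f in auto)

lemma (in prob_space) abs_integral_le:
  fixes f :: "'a \<Rightarrow> real"
  assumes "f \<in> borel_measurable M" "\<And>x. x \<in> space M \<Longrightarrow> \<bar>f x\<bar> \<le> B"
  shows "\<bar>\<integral>x. f x \<partial>M\<bar> \<le> B"
proof -
  have "integrable M f" using assms by (intro integrable_const_bound[where B = B]) auto
  moreover have "integrable M (\<lambda>_. 0::real)" by simp
  ultimately show ?thesis using abs_integral_diff_le[of f "\<lambda>_. 0" B] assms(2) by simp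
qed

lemma integrable_kernel_integral:
  fixes f :: "'b \<Rightarrow> real"
  assumes "prob_space \<mu>" and N: "N \<in> \<mu> \<rightarrow>\<^sub>M prob_algebra K"
    and f: "f \<in> borel_measurable K" "\<And>y. y \<in> space K \<Longrightarrow> \<bar>f y\<bar> \<le> B"
  shows "integrable \<mu> (\<lambda>x. \<integral>y. f y \<partial>N x)"
proof -
  interpret prob_space \<mu> by fact
  show ?thesis
  proof (rule integrable_const_bound[where B = B])
    show "(\<lambda>x. \<integral>y. f y \<partial>N x) \<in> borel_measurable \<mu>"
      by (rule measurable_compose[OF measurable_prob_algebraD[OF N] integral_measurable_subprob_algebra[OF f(1)]])
    show "AE x in \<mu>. norm (\<integral>y. f y \<partial>N x) \<le> B"
    proof (rule AE_I2)
      fix x assume "x \<in> space \<mu>"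
      note Nx = measurable_imp_prob_measure[OF N this]
      interpret N: prob_space "N x" using Nx by simp
      show "norm (\<integral>y. f y \<partial>N x) \<le> B"
        using N.abs_integral_le[of f B] f Nx by (simp cong: measurable_cong_sets)
    qed
  qed
qed

section \<open>Directional derivatives\<close>

text \<open>The two one-sided limits become one limit over a punctured neighbourhood, so that step
  sizes of either sign are treated together.\<close>

lemma has_dir_deriv_iff: "has_dir_deriv \<phi> \<theta> r D \<longleftrightarrow> (diff_quotient \<phi> \<theta> r \<longlongrightarrow> D) (at 0)"
  by (auto simp: has_dir_deriv_def filterlim_at_split)

lemma has_dir_deriv_of_has_derivative:
  fixes \<phi> :: "'p::real_normed_vector \<Rightarrow> real"
  assumes "(\<phi> has_derivative \<phi>') (at \<theta>)"
  shows "has_dir_deriv \<phi> \<theta> r (\<phi>' r)"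
proof -
  have "((\<lambda>h. \<theta> + h *\<^sub>R r) has_derivative (\<lambda>h. h *\<^sub>R r)) (at 0)"
    by (auto intro!: derivative_eq_intros)
  from has_derivative_compose[OF this, of \<phi> \<phi>'] assms
  have "((\<lambda>h. \<phi> (\<theta> + h *\<^sub>R r)) has_derivative (\<lambda>h. \<phi>' (h *\<^sub>R r))) (at 0)" by simp
  moreover have "(\<lambda>h. \<phi>' (h *\<^sub>R r)) = (*) (\<phi>' r)"
    using linear_cmul[OF has_derivative_linear[OF assms]] by (auto simp: mult.commute)
  ultimately have "((\<lambda>h. \<phi> (\<theta> + h *\<^sub>R r)) has_field_derivative \<phi>' r) (at 0)"
    by (simp add: has_field_derivative_def)
  then show ?thesis
    by (simp add: has_dir_deriv_iff DERIV_def diff_quotient_def[abs_def])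
qed

text \<open>Integrability claims that do not mention a sequence are still proved along one; this
  supplies it. The multiples d/2 * 1/(n+1) lie in the punctured neighbourhood from n = 0 on.\<close>

lemma eventually_at_0_sequence:
  fixes P :: "real \<Rightarrow> bool"
  assumes "eventually P (at 0)"
  obtains \<eta> where "\<eta> \<longlonglongrightarrow> 0" "\<And>n::nat. \<eta> n \<noteq> 0 \<and> P (\<eta> n)"
proof -
  obtain d where d: "d > 0" "\<And>h. h \<noteq> 0 \<Longrightarrow> \<bar>h\<bar> < d \<Longrightarrow> P h"
    using assms by (auto simp: eventually_at dist_real_def)
  have "(\<lambda>n. (d / 2) * inverse (real (Suc n))) \<longlonglongrightarrow> 0"
    using tendsto_mult_right_zero[OF LIMSEQ_inverse_real_of_nat] .
  moreover have "(d / 2) * inverse (real (Suc n)) \<noteq> 0 \<and> P ((d / 2) * inverse (real (Suc n)))" for n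
  proof -
    have "(d / 2) * inverse (real (Suc n)) \<le> (d / 2) * 1"
      using d(1) by (intro mult_left_mono) (auto simp: field_simps)
    then have "\<bar>(d / 2) * inverse (real (Suc n))\<bar> < d" using d(1) by simp
    then show ?thesis using d by simp
  qed
  ultimately show ?thesis by (rule that)
qed

text \<open>Dominated convergence works along sequences. Dropping an initial segment lets
  \<open>P\<close> be assumed for every index, so that the sequential arguments need no
  "eventually".\<close>

lemma tendsto_at_0_of_sequences:
  fixes f :: "real \<Rightarrow> real"
  assumes P: "eventually P (at 0)"
    and seq: "\<And>\<eta>. \<eta> \<longlonglongrightarrow> 0 \<Longrightarrow> (\<And>n::nat. \<eta> n \<noteq> 0 \<and> P (\<eta> n)) \<Longrightarrow> (\<lambda>n. f (\<eta> n)) \<longlonglongrightarrow> L"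
  shows "(f \<longlongrightarrow> L) (at 0)"
  unfolding tendsto_at_iff_sequentially
proof (intro allI impI)
  fix \<eta> :: "nat \<Rightarrow> real" assume \<eta>: "\<forall>i. \<eta> i \<in> UNIV - {0}" "\<eta> \<longlonglongrightarrow> 0"
  then have "filterlim \<eta> (at 0) sequentially" by (auto simp: filterlim_at)
  with P have "eventually (\<lambda>n. P (\<eta> n)) sequentially" by (rule eventually_compose_filterlim)
  then obtain N where N: "\<And>n. n \<ge> N \<Longrightarrow> P (\<eta> n)" by (auto simp: eventually_sequentially)
  have "(\<lambda>n. f (\<eta> (n + N))) \<longlonglongrightarrow> L"
    using \<eta> N by (intro seq LIMSEQ_ignore_initial_segment) auto
  then show "(f \<circ> \<eta>) \<longlonglongrightarrow> L" unfolding comp_def by (rule LIMSEQ_offset)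
qed

section \<open>Duality for a single stage\<close>

text \<open>The setting for duality and dynamic programming at one parameter. Equicontinuity of the
  difference quotients is added in \<open>dr_sensitivity\<close>.\<close>

locale dr_problem =
  fixes M :: "('x::euclidean_space, 'a::euclidean_space, 'p::euclidean_space) dr_model"
    and \<Lambda> :: real
    and lstar :: "nat \<Rightarrow> 'x \<Rightarrow> 'a \<Rightarrow> 'p \<Rightarrow> real"
    and ystar :: "nat \<Rightarrow> 'x \<Rightarrow> 'a \<Rightarrow> 'x \<Rightarrow> 'p \<Rightarrow> 'x"
  assumes model: "wf_model M"
    and f_cont: "\<And>t. t < horizon M \<Longrightarrow>
      continuous_on (states M \<times> acts M \<times> states M) (\<lambda>(x, a, y). reward M t x a y)"
    and g_cont: "continuous_on (states M) (terminal M)"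
    and P0_cont: "\<And>t. t < horizon M \<Longrightarrow>
      weakly_continuous_on (states M \<times> acts M) (states M) (nominal M t)"
    and regular: "regular_policies M"
    and \<Lambda>_bound: "\<And>t \<theta> x a. \<lbrakk>t < horizon M; \<theta> \<in> params M; x \<in> states M; a \<in> acts M\<rbrakk> \<Longrightarrow>
      Lambda_opt M t \<theta> x a = argmax_set (\<lambda>l. F M t \<theta> l x a) {0..\<Lambda>}"
    and dual_unique: "\<And>t x a \<theta>. \<lbrakk>t < horizon M; x \<in> states M; a \<in> acts M; \<theta> \<in> params M\<rbrakk> \<Longrightarrow>
      Lambda_opt M t \<theta> x a = {lstar t x a \<theta>}"
    and inner_unique: "\<And>t x a \<theta> x'.
      \<lbrakk>t < horizon M; x \<in> states M; a \<in> acts M; \<theta> \<in> params M; x' \<in> states M\<rbrakk> \<Longrightarrow>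
      Y_opt M t \<theta> (lstar t x a \<theta>) x a x' = {ystar t x a x' \<theta>}"
begin

abbreviation X where "X \<equiv> states M"
abbreviation A where "A \<equiv> acts M"

lemma compact_X [simp, intro]: "compact X" and X_nonempty: "X \<noteq> {}"
  and compact_A [simp, intro]: "compact A"
  and expo_pos: "0 < expo M" and radius_pos: "0 < radius M"
  using model by (auto simp: wf_model_def)

lemma X_borel [simp]: "X \<in> sets borel" and A_borel [simp]: "A \<in> sets borel"
  by (auto intro!: borel_closed compact_imp_closed)

lemma nominal_kernel: "t < horizon M \<Longrightarrow> nominal M t \<in> kernels M"
  using model by (auto simp: wf_model_def)

lemma kernel_prob:
  assumes "P \<in> kernels M" "x \<in> X" "a \<in> A"
  shows "P (x, a) \<in> prob_measures_on X"
  using measurable_space[of P "borel_on X \<Otimes>\<^sub>M borel_on A" "prob_algebra (borel_on X)" "(x, a)"] assms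
  by (simp add: kernels_def space_pair_measure)

lemma nominal_prob:
  "t < horizon M \<Longrightarrow> x \<in> X \<Longrightarrow> a \<in> A \<Longrightarrow> nominal M t (x, a) \<in> prob_measures_on X"
  using nominal_kernel kernel_prob by blast

lemma policy_prob:
  "t < horizon M \<Longrightarrow> \<theta> \<in> params M \<Longrightarrow> x \<in> X \<Longrightarrow> policy M t \<theta> x \<in> prob_measures_on A"
  using model by (auto simp: wf_model_def space_prob_algebra policy_def)

lemma policy_weakly_continuous:
  assumes "t < horizon M" "\<theta> \<in> params M"
  shows "weakly_continuous_on X A (policy M t \<theta>)"
  unfolding weakly_continuous_on_def
proof (intro allI impI)
  fix \<phi> :: "'a \<Rightarrow> real" assume \<phi>: "continuous_on A \<phi>"
  have "weakly_continuous_on (params M \<times> X) A (\<lambda>(\<theta>, x). policy M t \<theta> x)"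
    using regular assms(1) unfolding regular_policies_def by blast
  with \<phi> have "continuous_on (params M \<times> X) (\<lambda>z. \<integral>a. \<phi> a \<partial>(case z of (\<theta>, x) \<Rightarrow> policy M t \<theta> x))"
    unfolding weakly_continuous_on_def by blast
  from continuous_on_Pair_slice[OF this assms(2)]
  show "continuous_on X (\<lambda>x. \<integral>a. \<phi> a \<partial>policy M t \<theta> x)" by simp
qed

text \<open>\<open>wf_model\<close> gives measurability of the density in the action, one state at a
  time; measurability of the policy in the state comes from its weak continuity.\<close>

lemma policy_kernel:
  assumes "t < horizon M" "\<theta> \<in> params M"
  shows "policy M t \<theta> \<in> borel_on X \<rightarrow>\<^sub>M prob_algebra (borel_on A)"
  by (rule weakly_continuous_imp_measurable_kernel[OF policy_weakly_continuous[OF assms] policy_prob[OF assms] A_borel])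

lemma reward_slice_continuous:
  assumes "t < horizon M" "x \<in> X" "a \<in> A"
  shows "continuous_on X (reward M t x a)"
  using continuous_on_Pair_slice[OF continuous_on_Pair_slice[OF f_cont[OF assms(1)] assms(2)] assms(3)]
  by simp

definition inner_min where
  "inner_min t \<theta> l x a x' = (INF y\<in>X. inner_objective M t \<theta> l x a x' y)"

lemma F_eq: "F M t \<theta> l x a = (\<integral>x'. inner_min t \<theta> l x a x' \<partial>nominal M t (x, a)) - radius M ^ expo M * l"
  by (simp add: F_def inner_min_def)

section \<open>One stage, given a continuous value function at the next time\<close>

context
  fixes t :: nat and \<theta> :: 'p
  assumes t: "t < horizon M" and \<theta>: "\<theta> \<in> params M" and V_cont: "continuous_on X (V M (Suc t) \<theta>)"
begin

text \<open>The tuple is nested to the left so that the last component is the variable to be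
  minimized or integrated over, and all the others form a single parameter.\<close>

lemma inner_objective_continuous:
  "continuous_on ((((X \<times> A) \<times> UNIV) \<times> X) \<times> X)
     (\<lambda>((((x, a), l), x'), y). inner_objective M t \<theta> l x a x' y)"
proof -
  let ?D = "(((X \<times> A) \<times> (UNIV::real set)) \<times> X) \<times> X"
  have "continuous_on ?D (\<lambda>w. (\<lambda>(x, a, y). reward M t x a y)
      (fst (fst (fst (fst w))), snd (fst (fst (fst w))), snd w))"
    by (rule continuous_on_compose2[OF f_cont[OF t]]) (auto intro!: continuous_intros)
  moreover have "continuous_on ?D (\<lambda>w. V M (Suc t) \<theta> (snd w))"
    by (rule continuous_on_compose2[OF V_cont]) (auto intro!: continuous_intros)
  ultimately show ?thesis
    unfolding inner_objective_def case_prod_beta by (auto intro!: continuous_intros)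
qed

lemma inner_objective_slice_continuous:
  assumes "x \<in> X" "a \<in> A" "x' \<in> X"
  shows "continuous_on X (inner_objective M t \<theta> l x a x')"
  using continuous_on_Pair_slice[OF inner_objective_continuous, of "(((x, a), l), x')"] assms
  by simp

lemma inner_min_attained:
  assumes "x \<in> X" "a \<in> A" "x' \<in> X"
  obtains y where "y \<in> X" "inner_min t \<theta> l x a x' = inner_objective M t \<theta> l x a x' y"
    "\<And>z. z \<in> X \<Longrightarrow> inner_objective M t \<theta> l x a x' y \<le> inner_objective M t \<theta> l x a x' z"
  using INF_compact_attained[OF compact_X X_nonempty inner_objective_slice_continuous[OF assms]]
  unfolding inner_min_def by metis

lemma inner_min_le:
  assumes "x \<in> X" "a \<in> A" "x' \<in> X" "y \<in> X"
  shows "inner_min t \<theta> l x a x' \<le> inner_objective M t \<theta> l x a x' y"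
  by (rule inner_min_attained[OF assms(1-3), of l]) (use assms(4) in simp)

lemma inner_min_continuous:
  "continuous_on (((X \<times> A) \<times> UNIV) \<times> X) (\<lambda>(((x, a), l), x'). inner_min t \<theta> l x a x')"
  using continuous_on_INF_compact[OF inner_objective_continuous compact_X X_nonempty]
  by (simp add: inner_min_def case_prod_beta)

lemma inner_min_slice_continuous:
  assumes "x \<in> X" "a \<in> A"
  shows "continuous_on X (inner_min t \<theta> l x a)"
  using continuous_on_Pair_slice[OF inner_min_continuous, of "((x, a), l)"] assms
  by simp

lemma inner_min_integrable:
  assumes "x \<in> X" "a \<in> A"
  shows "integrable (nominal M t (x, a)) (inner_min t \<theta> l x a)"
  using assms t
  by (intro integrable_continuous_on_compact[OF nominal_prob] inner_min_slice_continuous) auto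

lemma F_continuous: "continuous_on ((X \<times> A) \<times> UNIV) (\<lambda>((x, a), l). F M t \<theta> l x a)"
proof -
  have "continuous_on ((X \<times> A) \<times> UNIV)
      (\<lambda>u. \<integral>x'. (\<lambda>(((x, a), l), x'). inner_min t \<theta> l x a x') (u, x') \<partial>nominal M t (fst u))"
  proof (rule continuous_on_integral_weakly_continuous[OF _ _ compact_X inner_min_continuous])
    show "weakly_continuous_on ((X \<times> A) \<times> UNIV) X (\<lambda>u::('x \<times> 'a) \<times> real. nominal M t (fst u))"
      unfolding weakly_continuous_on_def
    proof (intro allI impI)
      fix \<phi> :: "'x \<Rightarrow> real" assume "continuous_on X \<phi>"
      then have "continuous_on (X \<times> A) (\<lambda>u. \<integral>s. \<phi> s \<partial>nominal M t u)"
        using P0_cont[OF t] by (simp add: weakly_continuous_on_def)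
      then show "continuous_on ((X \<times> A) \<times> UNIV) (\<lambda>u::('x \<times> 'a) \<times> real. \<integral>s. \<phi> s \<partial>nominal M t (fst u))"
        by (rule continuous_on_compose2) (auto intro!: continuous_intros)
    qed
  qed (use t nominal_prob in auto)
  then show ?thesis
    unfolding F_eq case_prod_beta by (auto intro!: continuous_intros)
qed

text \<open>\<open>\<Lambda>_bound\<close> places the maximizer in an interval common to all
  arguments; the strict inequality holds because the set of maximizers over the half-line is a
  singleton.\<close>

lemma lstar_props:
  assumes "x \<in> X" "a \<in> A"
  shows "lstar t x a \<theta> \<in> {0..\<Lambda>}"
    and "l \<ge> 0 \<Longrightarrow> F M t \<theta> l x a \<le> F M t \<theta> (lstar t x a \<theta>) x a"
    and "l \<ge> 0 \<Longrightarrow> l \<noteq> lstar t x a \<theta> \<Longrightarrow> F M t \<theta> l x a < F M t \<theta> (lstar t x a \<theta>) x a"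
proof -
  have "lstar t x a \<theta> \<in> argmax_set (\<lambda>l. F M t \<theta> l x a) {0..\<Lambda>}"
    using \<Lambda>_bound[OF t \<theta> assms] dual_unique[OF t assms \<theta>] by auto
  then show "lstar t x a \<theta> \<in> {0..\<Lambda>}"
    by (simp add: argmax_set_def is_arg_max_def)
  have *: "argmax_set (\<lambda>l. F M t \<theta> l x a) {0..} = {lstar t x a \<theta>}"
    using dual_unique[OF t assms \<theta>] by (simp add: Lambda_opt_def)
  then have "lstar t x a \<theta> \<in> argmax_set (\<lambda>l. F M t \<theta> l x a) {0..}" by simp
  then show le: "F M t \<theta> l x a \<le> F M t \<theta> (lstar t x a \<theta>) x a" if "l \<ge> 0" for l
    using that by (force simp: argmax_set_def is_arg_max_def)
  show "F M t \<theta> l x a < F M t \<theta> (lstar t x a \<theta>) x a" if l: "l \<ge> 0" "l \<noteq> lstar t x a \<theta>" for l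
  proof -
    have "l \<notin> argmax_set (\<lambda>l. F M t \<theta> l x a) {0..}" using * l by auto
    then obtain k where "k \<ge> 0" "F M t \<theta> l x a < F M t \<theta> k x a"
      using l by (auto simp: argmax_set_def is_arg_max_def)
    then show ?thesis using le by force
  qed
qed

lemma G_eq:
  assumes "x \<in> X" "a \<in> A"
  shows "G M t \<theta> x a = F M t \<theta> (lstar t x a \<theta>) x a"
  unfolding G_def using lstar_props[OF assms] by (intro cSup_eq_maximum) auto

lemma ystar_props:
  assumes "x \<in> X" "a \<in> A" "x' \<in> X"
  shows "ystar t x a x' \<theta> \<in> X"
    and "y \<in> X \<Longrightarrow> y \<noteq> ystar t x a x' \<theta> \<Longrightarrow>
      inner_objective M t \<theta> (lstar t x a \<theta>) x a x' (ystar t x a x' \<theta>)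
        < inner_objective M t \<theta> (lstar t x a \<theta>) x a x' y"
    and "inner_min t \<theta> (lstar t x a \<theta>) x a x'
        = inner_objective M t \<theta> (lstar t x a \<theta>) x a x' (ystar t x a x' \<theta>)"
proof -
  let ?\<psi> = "inner_objective M t \<theta> (lstar t x a \<theta>) x a x'"
  have *: "argmin_set ?\<psi> X = {ystar t x a x' \<theta>}"
    using inner_unique[OF t assms(1,2) \<theta> assms(3)] by (simp add: Y_opt_def)
  then have y: "ystar t x a x' \<theta> \<in> argmin_set ?\<psi> X" by simp
  then show "ystar t x a x' \<theta> \<in> X" by (simp add: argmin_set_def is_arg_min_def)
  have le: "?\<psi> (ystar t x a x' \<theta>) \<le> ?\<psi> y" if "y \<in> X" for y
    using that y by (force simp: argmin_set_def is_arg_min_def)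
  show "?\<psi> (ystar t x a x' \<theta>) < ?\<psi> y" if y': "y \<in> X" "y \<noteq> ystar t x a x' \<theta>" for y
  proof -
    have "y \<notin> argmin_set ?\<psi> X" using * y' by auto
    then obtain k where "k \<in> X" "?\<psi> k < ?\<psi> y"
      using y' by (auto simp: argmin_set_def is_arg_min_def)
    then show ?thesis using le[of k] by linarith
  qed
  show "inner_min t \<theta> (lstar t x a \<theta>) x a x' = ?\<psi> (ystar t x a x' \<theta>)"
    unfolding inner_min_def using le \<open>ystar t x a x' \<theta> \<in> X\<close> by (intro INF_eq_minimum)
qed

lemma lstar_continuous: "continuous_on (X \<times> A) (\<lambda>(x, a). lstar t x a \<theta>)"
proof (rule continuous_on_unique_argmin[where Y = "{0..\<Lambda>}" and \<phi> = "\<lambda>((x, a), l). - F M t \<theta> l x a"])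
  show "continuous_on ((X \<times> A) \<times> {0..\<Lambda>}) (\<lambda>((x, a), l). - F M t \<theta> l x a)"
    using continuous_on_minus[OF continuous_on_subset[OF F_continuous, of "(X \<times> A) \<times> {0..\<Lambda>}"]]
    by (auto simp: case_prod_beta)
qed (use lstar_props in auto)

lemma ystar_continuous: "continuous_on ((X \<times> A) \<times> X) (\<lambda>((x, a), x'). ystar t x a x' \<theta>)"
proof (rule continuous_on_unique_argmin[where Y = X and
      \<phi> = "\<lambda>(((x, a), x'), y). inner_objective M t \<theta> (lstar t x a \<theta>) x a x' y"])
  let ?D = "((X \<times> A) \<times> X) \<times> X"
  have *: "continuous_on ?D (\<lambda>w. (\<lambda>(x, a). lstar t x a \<theta>) (fst (fst w)))"
    by (rule continuous_on_compose2[OF lstar_continuous]) (auto intro!: continuous_intros)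
  have "continuous_on ?D (\<lambda>w. (\<lambda>((((x, a), l), x'), y). inner_objective M t \<theta> l x a x' y)
     (((fst (fst w), (\<lambda>(x, a). lstar t x a \<theta>) (fst (fst w))), snd (fst w)), snd w))"
    by (rule continuous_on_compose2[OF inner_objective_continuous])
      (auto intro!: continuous_intros *)
  then show "continuous_on ?D (\<lambda>(((x, a), x'), y). inner_objective M t \<theta> (lstar t x a \<theta>) x a x' y)"
    by (simp add: case_prod_beta)
qed (use ystar_props in auto)

lemma ystar_slice_continuous:
  assumes "x \<in> X" "a \<in> A"
  shows "continuous_on X (\<lambda>x'. ystar t x a x' \<theta>)"
  using continuous_on_Pair_slice[OF ystar_continuous, of "(x, a)"] assms
  by simp

lemma G_continuous: "continuous_on (X \<times> A) (\<lambda>(x, a). G M t \<theta> x a)"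
proof -
  have "continuous_on (X \<times> A) (\<lambda>u. (\<lambda>((x, a), l). F M t \<theta> l x a) (u, (\<lambda>(x, a). lstar t x a \<theta>) u))"
    by (rule continuous_on_compose2[OF F_continuous]) (auto intro!: continuous_intros lstar_continuous)
  then show ?thesis
    by (rule continuous_on_eq) (auto simp: G_eq)
qed

lemma G_slice_continuous:
  assumes "x \<in> X" shows "continuous_on A (G M t \<theta> x)"
  using continuous_on_Pair_slice[OF G_continuous assms] by simp

section \<open>First-order condition in the multiplier\<close>

abbreviation cost where "cost x a x' \<equiv> norm (x' - ystar t x a x' \<theta>) ^ expo M"

lemma cost_continuous:
  assumes "x \<in> X" "a \<in> A" shows "continuous_on X (cost x a)"
  by (intro continuous_intros ystar_slice_continuous assms)

text \<open>Danskin's argument in \<lambda>: the inner objective is affine in \<lambda> with slope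
  the transport cost, so the inner minimum has as derivative the cost at the unique minimizer.
  \<open>F\<close> makes sense for negative multipliers too, since the inner infimum is over a
  compact set; hence \<eta> may have any sign here.\<close>

lemma F_quotient_tendsto:
  assumes x: "x \<in> X" "a \<in> A" and \<eta>: "\<eta> \<longlonglongrightarrow> 0" "\<And>n. \<eta> n \<noteq> 0"
  defines "l \<equiv> lstar t x a \<theta>"
  shows "(\<lambda>n. (F M t \<theta> (l + \<eta> n) x a - F M t \<theta> l x a) / \<eta> n)
    \<longlonglongrightarrow> (\<integral>x'. cost x a x' \<partial>nominal M t (x, a)) - radius M ^ expo M"
proof -
  define P where "P = nominal M t (x, a)"
  have P: "P \<in> prob_measures_on X" using nominal_prob t x by (simp add: P_def)
  interpret prob_space P using P by (rule prob_measures_onD)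
  have "continuous_on (X \<times> X) (\<lambda>z. norm (fst z - snd z) ^ expo M)" by (intro continuous_intros)
  then obtain B where B: "\<And>z. z \<in> X \<times> X \<Longrightarrow> \<bar>norm (fst z - snd z) ^ expo M\<bar> \<le> B"
    by (rule compact_continuous_bounded[rotated]) (auto intro: compact_Times)
  have diff: "inner_objective M t \<theta> (l + h) x a x' y - inner_objective M t \<theta> l x a x' y
      = h * norm (x' - y) ^ expo M" for h x' y
    by (simp add: inner_objective_def algebra_simps)
  let ?q = "\<lambda>n x'. (inner_min t \<theta> (l + \<eta> n) x a x' - inner_min t \<theta> l x a x') / \<eta> n"
  have "(\<lambda>n. \<integral>x'. ?q n x' \<partial>P) \<longlonglongrightarrow> (\<integral>x'. cost x a x' \<partial>P)"
  proof (rule integral_dominated_convergence[where w = "\<lambda>_. B"])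
    show "AE x' in P. norm (?q n x') \<le> B" for n
    proof (rule AE_I2)
      fix x' assume "x' \<in> space P"
      then have x': "x' \<in> X" using P by (auto dest: prob_measures_onD)
      have "\<bar>inner_min t \<theta> (l + \<eta> n) x a x' - inner_min t \<theta> l x a x'\<bar> \<le> \<bar>\<eta> n\<bar> * B"
        unfolding inner_min_def
      proof (intro abs_diff_INF_le inner_objective_slice_continuous x x' X_nonempty compact_X)
        fix y assume "y \<in> X"
        with B[of "(x', y)"] x' show "\<bar>inner_objective M t \<theta> (l + \<eta> n) x a x' y
            - inner_objective M t \<theta> l x a x' y\<bar> \<le> \<bar>\<eta> n\<bar> * B"
          unfolding diff by (auto simp: abs_mult intro!: mult_left_mono)
      qed
      then show "norm (?q n x') \<le> B" using \<eta>(2)[of n] by (simp add: divide_simps mult.commute)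
    qed
    show "AE x' in P. (\<lambda>n. ?q n x') \<longlonglongrightarrow> cost x a x'"
    proof (rule AE_I2)
      fix x' assume "x' \<in> space P"
      then have x': "x' \<in> X" using P by (auto dest: prob_measures_onD)
      let ?\<Psi> = "\<lambda>n. inner_objective M t \<theta> (l + \<eta> n) x a x'" and ?\<psi> = "inner_objective M t \<theta> l x a x'"
      let ?p = "ystar t x a x' \<theta>"
      have "\<exists>z. z \<in> X \<and> inner_min t \<theta> (l + \<eta> n) x a x' = ?\<Psi> n z \<and> (\<forall>y\<in>X. ?\<Psi> n z \<le> ?\<Psi> n y)" for n
        using inner_min_attained[OF x x'] by metis
      then obtain z where z: "\<And>n. z n \<in> X" "\<And>n. inner_min t \<theta> (l + \<eta> n) x a x' = ?\<Psi> n (z n)"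
        "\<And>n y. y \<in> X \<Longrightarrow> ?\<Psi> n (z n) \<le> ?\<Psi> n y" by metis
      \<comment> \<open>The quotient does not depend on n, so equicontinuity at the minimizer is
        just continuity of y \<mapsto> |x' - y|^q.\<close>
      have quot: "(?\<Psi> n y - ?\<psi> y) / \<eta> n = norm (x' - y) ^ expo M" for n y
        using \<eta>(2)[of n] by (simp add: diff)
      have "(\<lambda>n. (?\<Psi> n (z n) - ?\<psi> ?p) / \<eta> n) \<longlonglongrightarrow> cost x a x'"
      proof (rule envelope_tendsto[where Y = X and B = B])
        show "\<forall>\<^sub>F n in sequentially. \<forall>y\<in>X. \<bar>?\<Psi> n y - ?\<psi> y\<bar> \<le> B * \<bar>\<eta> n\<bar>"
        proof (intro always_eventually allI ballI)
          fix n y assume "y \<in> X"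
          with B[of "(x', y)"] x' show "\<bar>?\<Psi> n y - ?\<psi> y\<bar> \<le> B * \<bar>\<eta> n\<bar>"
            unfolding diff by (auto simp: abs_mult mult.commute[of B] intro!: mult_left_mono)
        qed
        show "(\<lambda>n. (?\<Psi> n ?p - ?\<psi> ?p) / \<eta> n) \<longlonglongrightarrow> cost x a x'" unfolding quot by simp
        fix e :: real assume "e > 0"
        have "isCont (\<lambda>y. norm (x' - y) ^ expo M) ?p" by (intro continuous_intros)
        with \<open>e > 0\<close> obtain d where "d > 0" "\<And>y. dist y ?p < d \<Longrightarrow>
            dist (norm (x' - y) ^ expo M) (norm (x' - ?p) ^ expo M) < e"
          unfolding continuous_at_eps_delta by metis
        then show "\<exists>d>0. \<forall>\<^sub>F n in sequentially. \<forall>y\<in>X. dist y ?p < d \<longrightarrow>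
            \<bar>(?\<Psi> n y - ?\<psi> y) / \<eta> n - (?\<Psi> n ?p - ?\<psi> ?p) / \<eta> n\<bar> < e"
          unfolding quot by (auto simp: dist_real_def)
      qed (use ystar_props[OF x x'] z \<eta> inner_objective_slice_continuous[OF x x'] in \<open>auto simp: l_def\<close>)
      then show "(\<lambda>n. ?q n x') \<longlonglongrightarrow> cost x a x'"
        by (simp add: z(2) ystar_props(3)[OF x x', folded l_def] flip: l_def)
    qed
    show "cost x a \<in> borel_measurable P"
      using integrable_continuous_on_compact[OF P compact_X cost_continuous[OF x]] by simp
    show "?q n \<in> borel_measurable P" for n
      using inner_min_integrable[OF x] by (auto simp: P_def)
  qed simp
  then have "(\<lambda>n. (\<integral>x'. ?q n x' \<partial>P) - radius M ^ expo M)
      \<longlonglongrightarrow> (\<integral>x'. cost x a x' \<partial>P) - radius M ^ expo M"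
    by (intro tendsto_intros)
  moreover have "(F M t \<theta> (l + \<eta> n) x a - F M t \<theta> l x a) / \<eta> n = (\<integral>x'. ?q n x' \<partial>P) - radius M ^ expo M" for n
    using \<eta>(2)[of n] inner_min_integrable[OF x] by (simp add: F_eq P_def field_simps)
  ultimately show ?thesis by (simp add: P_def)
qed

text \<open>The Karush-Kuhn-Tucker conditions of the dual problem. Increasing \<lambda> from its
  maximizer gives a nonpositive derivative, which is feasibility; if the maximizer is positive it
  can also be decreased, the derivative vanishes, and complementary slackness follows.\<close>

lemma optimal_cost:
  assumes x: "x \<in> X" "a \<in> A"
  shows "(\<integral>x'. cost x a x' \<partial>nominal M t (x, a)) \<le> radius M ^ expo M"
    and "lstar t x a \<theta> * ((\<integral>x'. cost x a x' \<partial>nominal M t (x, a)) - radius M ^ expo M) = 0"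
proof -
  let ?l = "lstar t x a \<theta>" and ?D = "(\<integral>x'. cost x a x' \<partial>nominal M t (x, a)) - radius M ^ expo M"
  have l: "?l \<ge> 0" using lstar_props(1)[OF x] by simp
  have inv: "(\<lambda>n. c * inverse (real (Suc n))) \<longlonglongrightarrow> 0" for c
    using tendsto_mult_right_zero[OF LIMSEQ_inverse_real_of_nat] .
  \<comment> \<open>The factor 1 keeps the step in the shape
    \<open>c * inverse (real (Suc n))\<close> of \<open>inv\<close>.\<close>
  have "(\<lambda>n. (F M t \<theta> (?l + 1 * inverse (real (Suc n))) x a - F M t \<theta> ?l x a)
      / (1 * inverse (real (Suc n)))) \<longlonglongrightarrow> ?D"
    by (rule F_quotient_tendsto[OF x inv]) auto
  then show le: "(\<integral>x'. cost x a x' \<partial>nominal M t (x, a)) \<le> radius M ^ expo M"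
    using lstar_props(2)[OF x] l
    by (subst diff_le_0_iff_le[symmetric], elim tendsto_upperbound)
      (auto intro!: always_eventually divide_nonpos_nonneg)
  show "?l * ?D = 0"
  proof (cases "?l = 0")
    case False
    then have pos: "?l > 0" using l by simp
    \<comment> \<open>The perturbed multiplier is \<open>?l\<close> times 1 - 1/(n+1). It stays
      nonnegative, where \<open>?l\<close> is known to be optimal.\<close>
    have "(\<lambda>n. (F M t \<theta> (?l + (- ?l) * inverse (real (Suc n))) x a - F M t \<theta> ?l x a)
      / ((- ?l) * inverse (real (Suc n)))) \<longlonglongrightarrow> ?D"
      using pos by (intro F_quotient_tendsto[OF x inv]) auto
    moreover have "0 \<le> (F M t \<theta> (?l + (- ?l) * inverse (real (Suc n))) x a - F M t \<theta> ?l x a)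
      / ((- ?l) * inverse (real (Suc n)))" for n
    proof (rule divide_nonpos_nonpos)
      have "?l * inverse (real (Suc n)) \<le> ?l * 1"
        using pos by (intro mult_left_mono) (auto simp: field_simps)
      then show "F M t \<theta> (?l + (- ?l) * inverse (real (Suc n))) x a - F M t \<theta> ?l x a \<le> 0"
        using lstar_props(2)[OF x, of "?l + (- ?l) * inverse (real (Suc n))"] by simp
    qed (use pos in simp)
    ultimately have "0 \<le> ?D"
      by (elim tendsto_lowerbound) (auto intro!: always_eventually)
    then show ?thesis using le by simp
  qed simp
qed

section \<open>The worst-case kernel and weak duality\<close>

definition worst where
  "worst = (\<lambda>(x, a). distr (nominal M t (x, a)) (borel_on X) (\<lambda>x'. ystar t x a x' \<theta>))"

lemma ystar_measurable:
  assumes "x \<in> X" "a \<in> A"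
  shows "(\<lambda>x'. ystar t x a x' \<theta>) \<in> nominal M t (x, a) \<rightarrow>\<^sub>M borel_on X"
proof -
  note P = prob_measures_onD[OF nominal_prob[OF t assms]]
  have "(\<lambda>x'. ystar t x a x' \<theta>) \<in> borel_on X \<rightarrow>\<^sub>M borel_on X"
    using borel_measurable_continuous_on_restrict[OF ystar_slice_continuous[OF assms]] ystar_props(1)[OF assms]
    by (intro measurable_restrict_space2) auto
  then show ?thesis using P by (simp cong: measurable_cong_sets)
qed

text \<open>Joint continuity of \<open>ystar\<close> in state, action and nominal successor gives a
  measurable map, so no measurable selection theorem is called for.\<close>

lemma worst_kernel: "worst \<in> kernels M"
proof -
  have "(\<lambda>x. distr (nominal M t x) (borel_on X) (\<lambda>x'. (\<lambda>((x, a), x'). ystar t x a x' \<theta>) (x, x')))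
      \<in> (borel_on X \<Otimes>\<^sub>M borel_on A) \<rightarrow>\<^sub>M prob_algebra (borel_on X)"
  proof (rule measurable_distr_prob_space2)
    show "nominal M t \<in> borel_on X \<Otimes>\<^sub>M borel_on A \<rightarrow>\<^sub>M prob_algebra (borel_on X)"
      using nominal_kernel[OF t] by (simp add: kernels_def)
    let ?N = "(borel_on X \<Otimes>\<^sub>M borel_on A) \<Otimes>\<^sub>M borel_on X"
    \<comment> \<open>The identity, written by components, is measurable from the product
      sigma-algebra to the Borel sets of the product space, where the continuity of
      \<open>ystar\<close> can be used.\<close>
    have "(\<lambda>w. ((fst (fst w), snd (fst w)), snd w)) \<in> borel_measurable ?N"
      by (intro borel_measurable_Pair
          borel_measurable_restrict_borelD[OF measurable_compose[OF measurable_fst measurable_fst]]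
          borel_measurable_restrict_borelD[OF measurable_compose[OF measurable_fst measurable_snd]]
          borel_measurable_restrict_borelD[OF measurable_snd])
    from borel_measurable_continuous_on_compose[OF ystar_continuous this]
    have "(\<lambda>w. (\<lambda>((x, a), x'). ystar t x a x' \<theta>) ((fst (fst w), snd (fst w)), snd w)) \<in> borel_measurable ?N"
      by (auto simp: space_pair_measure)
    then have "(\<lambda>w. (\<lambda>((x, a), x'). ystar t x a x' \<theta>) ((fst (fst w), snd (fst w)), snd w)) \<in> ?N \<rightarrow>\<^sub>M borel_on X"
      using ystar_props(1) by (intro measurable_restrict_space2) (auto simp: space_pair_measure)
    then show "(\<lambda>(x, x'). (\<lambda>((x, a), x'). ystar t x a x' \<theta>) (x, x')) \<in> ?N \<rightarrow>\<^sub>M borel_on X"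
      by (simp add: case_prod_beta)
  qed
  then show ?thesis by (simp add: kernels_def worst_def case_prod_unfold)
qed

text \<open>The joint law of (y*(x'), x') under the nominal kernel couples the push-forward with the
  nominal law. Its cost is the mean cost of \<open>optimal_cost(1)\<close>, hence at most
  \<open>radius M ^ expo M\<close>.\<close>

lemma worst_in_ball:
  assumes x: "x \<in> X" "a \<in> A"
  shows "worst (x, a) \<in> ambiguity_ball M t x a"
proof -
  define P where "P = nominal M t (x, a)"
  have P: "P \<in> prob_measures_on X" using nominal_prob t x by (simp add: P_def)
  interpret prob_space P using P by (rule prob_measures_onD)
  have y: "(\<lambda>x'. ystar t x a x' \<theta>) \<in> P \<rightarrow>\<^sub>M borel_on X"
    using ystar_measurable[OF x] by (simp add: P_def)
  have i: "(\<lambda>x'. x') \<in> P \<rightarrow>\<^sub>M borel_on X"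
    using prob_measures_onD(2)[OF P] by (simp cong: measurable_cong_sets)
  let ?pair = "\<lambda>x'. (ystar t x a x' \<theta>, x')"
  have pair: "?pair \<in> P \<rightarrow>\<^sub>M borel_on X \<Otimes>\<^sub>M borel_on X" using y i by measurable
  define \<gamma> where "\<gamma> = distr P (borel_on X \<Otimes>\<^sub>M borel_on X) ?pair"
  have "distr P (borel_on X) (\<lambda>x'. x') = P"
    using prob_measures_onD(2)[OF P] by (intro distr_id2) simp
  then have \<gamma>: "\<gamma> \<in> couplings X (worst (x, a)) P"
    using pair prob_space_distr[OF pair]
    by (auto simp: couplings_def \<gamma>_def space_prob_algebra distr_distr comp_def worst_def P_def)
  have "(INF \<gamma>\<in>couplings X (worst (x, a)) P. \<integral>z. norm (fst z - snd z) ^ expo M \<partial>\<gamma>)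
      \<le> (\<integral>z. norm (fst z - snd z) ^ expo M \<partial>\<gamma>)"
    by (rule cINF_lower[OF _ \<gamma>]) (auto intro!: bdd_belowI2[where m = 0])
  also have "\<dots> = (\<integral>x'. cost x a x' \<partial>P)"
  proof -
    have "(\<lambda>z. norm (fst z - snd z) ^ expo M) \<in> borel_measurable (borel_on X \<Otimes>\<^sub>M borel_on X)"
      by (rule borel_measurable_norm_diff_power[OF measurable_fst measurable_snd])
    then show ?thesis
      unfolding \<gamma>_def by (subst integral_distr[OF pair]) (auto simp: norm_minus_commute)
  qed
  also have "\<dots> \<le> radius M ^ expo M" using optimal_cost(1)[OF x] by (simp add: P_def)
  finally have "wasserstein (expo M) X (worst (x, a)) P \<le> root (expo M) (radius M ^ expo M)"
    unfolding wasserstein_def using expo_pos by simp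
  also have "\<dots> = radius M" using expo_pos radius_pos by (simp add: real_root_power_cancel)
  finally show ?thesis
    using kernel_prob[OF worst_kernel x] by (simp add: ambiguity_ball_def P_def)
qed

lemma reward_plus_V_continuous:
  assumes "x \<in> X" "a \<in> A" shows "continuous_on X (\<lambda>y. reward M t x a y + V M (Suc t) \<theta> y)"
  using t assms by (intro continuous_intros reward_slice_continuous V_cont)

text \<open>Along the optimal map, reward plus next value is the inner minimum minus \<lambda> times
  the cost. Complementary slackness replaces the mean of that term by \<lambda> \<epsilon>^q, and
  what remains is \<open>F\<close> at its maximizer.\<close>

lemma worst_attains:
  assumes x: "x \<in> X" "a \<in> A"
  shows "(\<integral>y. reward M t x a y + V M (Suc t) \<theta> y \<partial>worst (x, a)) = G M t \<theta> x a"
proof -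
  define P where "P = nominal M t (x, a)"
  have P: "P \<in> prob_measures_on X" using nominal_prob t x by (simp add: P_def)
  interpret prob_space P using P by (rule prob_measures_onD)
  let ?l = "lstar t x a \<theta>"
  have "(\<integral>y. reward M t x a y + V M (Suc t) \<theta> y \<partial>worst (x, a))
      = (\<integral>x'. reward M t x a (ystar t x a x' \<theta>) + V M (Suc t) \<theta> (ystar t x a x' \<theta>) \<partial>P)"
    unfolding worst_def P_def
    by (simp, subst integral_distr[OF ystar_measurable[OF x]
          borel_measurable_continuous_on_restrict[OF reward_plus_V_continuous[OF x]]], simp)
  also have "\<dots> = (\<integral>x'. inner_min t \<theta> ?l x a x' - ?l * cost x a x' \<partial>P)"
    using prob_measures_onD(3)[OF P] ystar_props(3)[OF x]
    by (intro Bochner_Integration.integral_cong) (auto simp: inner_objective_def)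
  also have "\<dots> = (\<integral>x'. inner_min t \<theta> ?l x a x' \<partial>P) - ?l * (\<integral>x'. cost x a x' \<partial>P)"
    using inner_min_integrable[OF x] integrable_continuous_on_compact[OF P compact_X cost_continuous[OF x]]
    by (simp add: P_def)
  also have "\<dots> = F M t \<theta> ?l x a"
    using optimal_cost(2)[OF x] unfolding F_eq P_def right_diff_distrib by (simp only: mult.commute)
  finally show ?thesis using G_eq[OF x] by simp
qed

text \<open>Weak duality. For a coupling of \<mu> with the nominal law, the inner minimum at the
  nominal point is at most reward plus next value plus \<lambda> times the cost at the other point.
  Integrating and making the cost of the coupling almost \<epsilon>^q bounds \<open>F\<close> from
  above.\<close>

lemma ball_lower_bound:
  assumes x: "x \<in> X" "a \<in> A" and \<mu>: "\<mu> \<in> ambiguity_ball M t x a"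
  shows "G M t \<theta> x a \<le> (\<integral>y. reward M t x a y + V M (Suc t) \<theta> y \<partial>\<mu>)"
proof -
  define P where "P = nominal M t (x, a)"
  have P: "P \<in> prob_measures_on X" using nominal_prob t x by (simp add: P_def)
  have \<mu>': "\<mu> \<in> prob_measures_on X" using \<mu> by (simp add: ambiguity_ball_def)
  define l where "l = lstar t x a \<theta>"
  have l: "l \<ge> 0" using lstar_props(1)[OF x] by (simp add: l_def)
  define I where "I \<gamma> = (\<integral>z. norm (fst z - snd z) ^ expo M \<partial>\<gamma>)" for \<gamma> :: "('x \<times> 'x) measure"
  have ne: "couplings X \<mu> P \<noteq> {}"
    using pair_measure_coupling[OF \<mu>' P] by blast
  have bound: "(\<integral>x'. inner_min t \<theta> l x a x' \<partial>P) - l * I \<gamma> \<le> (\<integral>y. reward M t x a y + V M (Suc t) \<theta> y \<partial>\<mu>)"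
    if \<gamma>: "\<gamma> \<in> couplings X \<mu> P" for \<gamma>
  proof -
    have \<gamma>': "prob_space \<gamma>" "sets \<gamma> = sets (borel_on X \<Otimes>\<^sub>M borel_on X)"
      "distr \<gamma> (borel_on X) fst = \<mu>" "distr \<gamma> (borel_on X) snd = P"
      using \<gamma> by (auto simp: couplings_def space_prob_algebra)
    have space: "space \<gamma> = X \<times> X" using sets_eq_imp_space_eq[OF \<gamma>'(2)] by (simp add: space_pair_measure)
    interpret prob_space \<gamma> by fact
    have m: "fst \<in> \<gamma> \<rightarrow>\<^sub>M borel_on X" "snd \<in> \<gamma> \<rightarrow>\<^sub>M borel_on X"
      unfolding measurable_cong_sets[OF \<gamma>'(2) refl] by (rule measurable_fst, rule measurable_snd)
    have c: "(\<lambda>z. norm (fst z - snd z) ^ expo M) \<in> borel_measurable \<gamma>"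
      by (rule borel_measurable_norm_diff_power[OF m])
    have "continuous_on (X \<times> X) (\<lambda>z. norm (fst z - snd z) ^ expo M)" by (intro continuous_intros)
    then obtain B where B: "\<And>z. z \<in> X \<times> X \<Longrightarrow> \<bar>norm (fst z - snd z) ^ expo M\<bar> \<le> B"
      by (rule compact_continuous_bounded[rotated]) (auto intro: compact_Times)
    have ic: "integrable \<gamma> (\<lambda>z. norm (fst z - snd z) ^ expo M)"
      using B c space by (intro integrable_const_bound[where B = B]) auto
    have im: "integrable \<gamma> (\<lambda>z. inner_min t \<theta> l x a (snd z))"
    proof (rule integrable_distr[OF m(2)])
      show "integrable (distr \<gamma> (borel_on X) snd) (inner_min t \<theta> l x a)"
        unfolding \<gamma>'(4) P_def by (rule inner_min_integrable[OF x])
    qed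
    have iw: "integrable \<gamma> (\<lambda>z. reward M t x a (fst z) + V M (Suc t) \<theta> (fst z))"
    proof (rule integrable_distr[OF m(1)])
      show "integrable (distr \<gamma> (borel_on X) fst) (\<lambda>y. reward M t x a y + V M (Suc t) \<theta> y)"
        unfolding \<gamma>'(3) by (rule integrable_continuous_on_compact[OF \<mu>' compact_X reward_plus_V_continuous[OF x]])
    qed
    have "(\<integral>x'. inner_min t \<theta> l x a x' \<partial>P) - l * I \<gamma>
        = (\<integral>z. inner_min t \<theta> l x a (snd z) - l * norm (fst z - snd z) ^ expo M \<partial>\<gamma>)"
    proof -
      have "(\<integral>x'. inner_min t \<theta> l x a x' \<partial>P) = (\<integral>z. inner_min t \<theta> l x a (snd z) \<partial>\<gamma>)"
        unfolding \<gamma>'(4)[symmetric]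
        by (rule integral_distr[OF m(2) borel_measurable_continuous_on_restrict[OF inner_min_slice_continuous[OF x]]])
      then show ?thesis using ic im by (simp add: I_def)
    qed
    also have "\<dots> \<le> (\<integral>z. reward M t x a (fst z) + V M (Suc t) \<theta> (fst z) \<partial>\<gamma>)"
    proof (rule integral_mono[OF _ iw])
      show "integrable \<gamma> (\<lambda>z. inner_min t \<theta> l x a (snd z) - l * norm (fst z - snd z) ^ expo M)"
        by (rule Bochner_Integration.integrable_diff[OF im integrable_mult_right[OF ic]])
      fix z assume "z \<in> space \<gamma>"
      then have z: "fst z \<in> X" "snd z \<in> X" unfolding space mem_Times_iff by simp_all
      have "inner_min t \<theta> l x a (snd z) \<le> inner_objective M t \<theta> l x a (snd z) (fst z)"
        by (rule inner_min_le[OF x z(2) z(1)])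
      then show "inner_min t \<theta> l x a (snd z) - l * norm (fst z - snd z) ^ expo M
          \<le> reward M t x a (fst z) + V M (Suc t) \<theta> (fst z)"
        unfolding inner_objective_def norm_minus_commute[of "fst z" "snd z"] by linarith
    qed
    also have "\<dots> = (\<integral>y. reward M t x a y + V M (Suc t) \<theta> y \<partial>\<mu>)"
      unfolding \<gamma>'(3)[symmetric]
      by (rule integral_distr[symmetric, OF m(1)
            borel_measurable_continuous_on_restrict[OF reward_plus_V_continuous[OF x]]])
    finally show ?thesis .
  qed
  let ?W = "INF \<gamma>\<in>couplings X \<mu> P. I \<gamma>"
  have bdd: "bdd_below (I ` couplings X \<mu> P)"
    by (auto intro!: bdd_belowI2[where m = 0] simp: I_def)
  have W0: "?W \<ge> 0" using ne by (intro cINF_greatest) (auto simp: I_def)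
  have "root (expo M) ?W \<le> radius M"
    using \<mu> by (simp add: ambiguity_ball_def wasserstein_def I_def P_def)
  then have "root (expo M) ?W ^ expo M \<le> radius M ^ expo M"
    using W0 expo_pos by (intro power_mono) auto
  then have W: "?W \<le> radius M ^ expo M" using W0 expo_pos by simp
  have "F M t \<theta> l x a \<le> (\<integral>y. reward M t x a y + V M (Suc t) \<theta> y \<partial>\<mu>)"
  proof (rule field_le_epsilon)
    fix e :: real assume e: "e > 0"
    \<comment> \<open>No optimal coupling is constructed. The slack e/(l+1) costs at most e after
      multiplication by l, and the 1 in the denominator covers l = 0.\<close>
    have "?W < radius M ^ expo M + e / (l + 1)" using W e l by (smt (verit) divide_pos_pos)
    then obtain \<gamma> where \<gamma>: "\<gamma> \<in> couplings X \<mu> P" "I \<gamma> < radius M ^ expo M + e / (l + 1)"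
      using cINF_less_iff[OF ne bdd] by blast
    have "l * I \<gamma> \<le> l * (radius M ^ expo M + e / (l + 1))"
      using \<gamma>(2) l by (intro mult_left_mono) auto
    also have "\<dots> \<le> l * radius M ^ expo M + e"
      using l e by (simp add: field_simps)
    finally show "F M t \<theta> l x a \<le> (\<integral>y. reward M t x a y + V M (Suc t) \<theta> y \<partial>\<mu>) + e"
      using bound[OF \<gamma>(1)] by (simp add: F_eq P_def algebra_simps)
  qed
  then show ?thesis using G_eq[OF x] by (simp add: l_def)
qed

text \<open>Hands the continuity of the value function back from time t + 1 to time t, as the
  backward induction requires.\<close>

lemma policy_integral_G_continuous: "continuous_on X (\<lambda>x. \<integral>a. G M t \<theta> x a \<partial>policy M t \<theta> x)"
  using continuous_on_integral_weakly_continuous[OF policy_weakly_continuous[OF t \<theta>]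
      policy_prob[OF t \<theta>] compact_A G_continuous] by simp

end

end

section \<open>Dynamic programming\<close>

context dr_problem
begin

section \<open>Path laws as iterated kernels\<close>

lemma space_path_space:
  "space (path_space M t s) = {\<omega>. (\<forall>l\<in>{t..s}. fst \<omega> l \<in> X) \<and> (\<forall>l\<in>{t..<s}. snd \<omega> l \<in> A)
     \<and> fst \<omega> \<in> extensional {t..s} \<and> snd \<omega> \<in> extensional {t..<s}}"
  by (auto simp: path_space_def space_pair_measure space_PiM PiE_def Pi_def)

lemma state_measurable: "l \<in> {t..s} \<Longrightarrow> (\<lambda>\<omega>. fst \<omega> l) \<in> path_space M t s \<rightarrow>\<^sub>M borel_on X"
  unfolding path_space_def by (rule measurable_compose[OF measurable_fst measurable_component_singleton])

lemma act_measurable: "l \<in> {t..<s} \<Longrightarrow> (\<lambda>\<omega>. snd \<omega> l) \<in> path_space M t s \<rightarrow>\<^sub>M borel_on A"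
  unfolding path_space_def by (rule measurable_compose[OF measurable_snd measurable_component_singleton])

text \<open>After n transitions a path has states up to index t + n and actions up to t + n - 1, so
  the new action gets index t + n and the new state t + n + 1.\<close>

definition extend :: "nat \<Rightarrow> nat \<Rightarrow> (nat \<Rightarrow> 'x) \<times> (nat \<Rightarrow> 'a) \<Rightarrow> 'a \<Rightarrow> 'x \<Rightarrow> (nat \<Rightarrow> 'x) \<times> (nat \<Rightarrow> 'a)" where
  "extend t n \<omega> a y = ((fst \<omega>)(t + Suc n := y), (snd \<omega>)(t + n := a))"

text \<open>One step of \<open>path_law\<close> is cut at the action: \<open>next_state\<close> is
  the kernel once the action is known, and \<open>next_step\<close> averages it over the policy.
  Integrals against the step then unfold one \<open>bind\<close> at a time.\<close>

definition next_state where
  "next_state P t n = (\<lambda>(\<omega>, a). P (t + n) (fst \<omega> (t + n), a) \<bind>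
     (\<lambda>y. return (path_space M t (t + Suc n)) (extend t n \<omega> a y)))"

definition next_step where
  "next_step \<theta> P t n = (\<lambda>\<omega>. policy M (t + n) \<theta> (fst \<omega> (t + n)) \<bind> (\<lambda>a. next_state P t n (\<omega>, a)))"

lemma path_law_Suc:
  "path_law M \<theta> P t x (Suc n) = path_law M \<theta> P t x n \<bind> next_step \<theta> P t n"
  by (simp add: next_step_def next_state_def extend_def case_prod_unfold)

context
  fixes P :: "nat \<Rightarrow> 'x \<times> 'a \<Rightarrow> 'x measure" and t n :: nat
  assumes n: "t + n < horizon M" and P: "P (t + n) \<in> kernels M"
begin

lemma extend_measurable:
  "(\<lambda>w. extend t n (fst (fst w)) (snd (fst w)) (snd w))
     \<in> (path_space M t (t + n) \<Otimes>\<^sub>M borel_on A) \<Otimes>\<^sub>M borel_on X \<rightarrow>\<^sub>M path_space M t (t + Suc n)"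
proof -
  let ?S = "path_space M t (t + n)"
  let ?N = "(?S \<Otimes>\<^sub>M borel_on A) \<Otimes>\<^sub>M borel_on X"
  have "(\<lambda>w. fst (fst w)) \<in> ?N \<rightarrow>\<^sub>M ?S"
    by (rule measurable_compose[OF measurable_fst measurable_fst])
  then have *: "(\<lambda>w. fst (fst (fst w))) \<in> ?N \<rightarrow>\<^sub>M (\<Pi>\<^sub>M l\<in>{t..t + n}. borel_on X)"
    "(\<lambda>w. snd (fst (fst w))) \<in> ?N \<rightarrow>\<^sub>M (\<Pi>\<^sub>M l\<in>{t..<t + n}. borel_on A)"
    unfolding path_space_def
    by (rule measurable_compose[OF _ measurable_fst], rule measurable_compose[OF _ measurable_snd])
  have "(\<lambda>w. (fst (fst (fst w)))(t + Suc n := snd w)) \<in> ?N \<rightarrow>\<^sub>M (\<Pi>\<^sub>M l\<in>{t..t + Suc n}. borel_on X)"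
    by (rule measurable_fun_upd[OF _ *(1) measurable_snd]) auto
  moreover have "(\<lambda>w. (snd (fst (fst w)))(t + n := snd (fst w))) \<in> ?N \<rightarrow>\<^sub>M (\<Pi>\<^sub>M l\<in>{t..<t + Suc n}. borel_on A)"
    by (rule measurable_fun_upd[OF _ *(2) measurable_compose[OF measurable_fst measurable_snd]]) auto
  ultimately show ?thesis
    unfolding extend_def path_space_def[of M t "t + Suc n"] by (rule measurable_Pair)
qed

lemma kernel_measurable:
  "(\<lambda>w. P (t + n) (fst (fst w) (t + n), snd w))
     \<in> path_space M t (t + n) \<Otimes>\<^sub>M borel_on A \<rightarrow>\<^sub>M prob_algebra (borel_on X)"
proof (rule measurable_compose[where g = "P (t + n)"])
  show "P (t + n) \<in> borel_on X \<Otimes>\<^sub>M borel_on A \<rightarrow>\<^sub>M prob_algebra (borel_on X)"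
    using P by (simp add: kernels_def)
  show "(\<lambda>w. (fst (fst w) (t + n), snd w))
      \<in> path_space M t (t + n) \<Otimes>\<^sub>M borel_on A \<rightarrow>\<^sub>M borel_on X \<Otimes>\<^sub>M borel_on A"
    by (intro measurable_Pair measurable_snd measurable_compose[OF measurable_fst state_measurable]) auto
qed

lemma next_state_measurable:
  "next_state P t n \<in> path_space M t (t + n) \<Otimes>\<^sub>M borel_on A \<rightarrow>\<^sub>M prob_algebra (path_space M t (t + Suc n))"
  using measurable_bind_prob_space2[OF kernel_measurable, where R = "path_space M t (t + Suc n)" and
      g = "\<lambda>w y. return (path_space M t (t + Suc n)) (extend t n (fst w) (snd w) y)"]
    measurable_compose[OF extend_measurable measurable_return_prob_space]
  by (simp add: next_state_def case_prod_unfold)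

lemma next_step_measurable:
  assumes \<theta>: "\<theta> \<in> params M"
  shows "next_step \<theta> P t n \<in> path_space M t (t + n) \<rightarrow>\<^sub>M prob_algebra (path_space M t (t + Suc n))"
  unfolding next_step_def
proof (rule measurable_bind_prob_space2)
  show "(\<lambda>\<omega>. policy M (t + n) \<theta> (fst \<omega> (t + n))) \<in> path_space M t (t + n) \<rightarrow>\<^sub>M prob_algebra (borel_on A)"
    by (rule measurable_compose[OF state_measurable policy_kernel[OF n \<theta>]]) auto
  show "(\<lambda>(\<omega>, a). next_state P t n (\<omega>, a))
      \<in> path_space M t (t + n) \<Otimes>\<^sub>M borel_on A \<rightarrow>\<^sub>M prob_algebra (path_space M t (t + Suc n))"
    using next_state_measurable by simp
qed

lemma integral_next_state:
  fixes \<Phi> :: "(nat \<Rightarrow> 'x) \<times> (nat \<Rightarrow> 'a) \<Rightarrow> real"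
  assumes \<Phi>: "\<Phi> \<in> borel_measurable (path_space M t (t + Suc n))"
      "\<And>\<omega>. \<omega> \<in> space (path_space M t (t + Suc n)) \<Longrightarrow> \<bar>\<Phi> \<omega>\<bar> \<le> B"
    and \<omega>: "\<omega> \<in> space (path_space M t (t + n))" and a: "a \<in> A"
  shows "(\<integral>w. \<Phi> w \<partial>next_state P t n (\<omega>, a)) = (\<integral>y. \<Phi> (extend t n \<omega> a y) \<partial>P (t + n) (fst \<omega> (t + n), a))"
proof -
  let ?S' = "path_space M t (t + Suc n)"
  have "fst \<omega> (t + n) \<in> X" using \<omega> by (simp add: space_path_space)
  note Q = prob_measures_onD[OF kernel_prob[OF P this a]]
  have u: "extend t n \<omega> a \<in> borel_on X \<rightarrow>\<^sub>M ?S'"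
    using measurable_compose[OF measurable_Pair1'[of "(\<omega>, a)"] extend_measurable] \<omega> a
    by (simp add: space_pair_measure)
  have "(\<lambda>y. return ?S' (extend t n \<omega> a y)) \<in> P (t + n) (fst \<omega> (t + n), a) \<rightarrow>\<^sub>M prob_algebra ?S'"
    unfolding measurable_cong_sets[OF Q(2) refl]
    by (rule measurable_compose[OF u measurable_return_prob_space])
  from integral_bind_prob_algebra[OF Q(1) this \<Phi>]
  have "(\<integral>w. \<Phi> w \<partial>next_state P t n (\<omega>, a))
      = (\<integral>y. \<integral>w. \<Phi> w \<partial>return ?S' (extend t n \<omega> a y) \<partial>P (t + n) (fst \<omega> (t + n), a))"
    by (simp add: next_state_def)
  also have "\<dots> = (\<integral>y. \<Phi> (extend t n \<omega> a y) \<partial>P (t + n) (fst \<omega> (t + n), a))"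
    using measurable_space[OF u] Q(3) \<Phi>(1)
    by (intro Bochner_Integration.integral_cong integral_return) auto
  finally show ?thesis .
qed

lemma integral_next_step:
  fixes \<Phi> :: "(nat \<Rightarrow> 'x) \<times> (nat \<Rightarrow> 'a) \<Rightarrow> real"
  assumes \<theta>: "\<theta> \<in> params M"
    and \<Phi>: "\<Phi> \<in> borel_measurable (path_space M t (t + Suc n))"
      "\<And>\<omega>. \<omega> \<in> space (path_space M t (t + Suc n)) \<Longrightarrow> \<bar>\<Phi> \<omega>\<bar> \<le> B"
    and \<omega>: "\<omega> \<in> space (path_space M t (t + n))"
  shows "(\<integral>w. \<Phi> w \<partial>next_step \<theta> P t n \<omega>)
      = (\<integral>a. \<integral>w. \<Phi> w \<partial>next_state P t n (\<omega>, a) \<partial>policy M (t + n) \<theta> (fst \<omega> (t + n)))"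
    and "integrable (policy M (t + n) \<theta> (fst \<omega> (t + n))) (\<lambda>a. \<integral>w. \<Phi> w \<partial>next_state P t n (\<omega>, a))"
proof -
  have "fst \<omega> (t + n) \<in> X" using \<omega> by (simp add: space_path_space)
  note Q = prob_measures_onD[OF policy_prob[OF n \<theta> this]]
  have N: "(\<lambda>a. next_state P t n (\<omega>, a))
      \<in> policy M (t + n) \<theta> (fst \<omega> (t + n)) \<rightarrow>\<^sub>M prob_algebra (path_space M t (t + Suc n))"
    unfolding measurable_cong_sets[OF Q(2) refl]
    by (rule measurable_compose[OF measurable_Pair1'[OF \<omega>] next_state_measurable])
  show "(\<integral>w. \<Phi> w \<partial>next_step \<theta> P t n \<omega>)
      = (\<integral>a. \<integral>w. \<Phi> w \<partial>next_state P t n (\<omega>, a) \<partial>policy M (t + n) \<theta> (fst \<omega> (t + n)))"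
    unfolding next_step_def by (rule integral_bind_prob_algebra[OF Q(1) N \<Phi>])
  show "integrable (policy M (t + n) \<theta> (fst \<omega> (t + n))) (\<lambda>a. \<integral>w. \<Phi> w \<partial>next_state P t n (\<omega>, a))"
    by (rule integrable_kernel_integral[OF Q(1) N \<Phi>])
qed

end

lemma path_law_prob:
  assumes "\<theta> \<in> params M" "\<And>l. l \<in> {t..<horizon M} \<Longrightarrow> P l \<in> kernels M" "x \<in> X"
  shows "t + n \<le> horizon M \<Longrightarrow> path_law M \<theta> P t x n \<in> space (prob_algebra (path_space M t (t + n)))"
proof (induction n)
  case 0
  have "(\<lambda>l\<in>{t}. x, \<lambda>l\<in>{}. undefined) \<in> space (path_space M t t)"
    using assms(3) by (auto simp: space_path_space)
  then show ?case by (simp add: space_prob_algebra prob_space_return)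
next
  case (Suc n)
  then have law: "path_law M \<theta> P t x n \<in> space (prob_algebra (path_space M t (t + n)))" by simp
  have "next_step \<theta> P t n \<in> path_space M t (t + n) \<rightarrow>\<^sub>M prob_algebra (path_space M t (t + Suc n))"
    using Suc.prems assms by (intro next_step_measurable) auto
  then have "(\<lambda>\<mu>. \<mu> \<bind> next_step \<theta> P t n) \<in> prob_algebra (path_space M t (t + n)) \<rightarrow>\<^sub>M prob_algebra (path_space M t (t + Suc n))"
    by (intro measurable_bind_prob_space2[where N = "path_space M t (t + n)"])
      (auto intro: measurable_compose[OF measurable_snd] simp: case_prod_unfold)
  from measurable_space[OF this law] show ?case unfolding path_law_Suc .
qed

section \<open>Bellman values along a path\<close>

definition bellman :: "nat \<Rightarrow> 'p \<Rightarrow> 'x \<Rightarrow> real" where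
  "bellman t \<theta> x = (if t = horizon M then terminal M x else \<integral>a. G M t \<theta> x a \<partial>policy M t \<theta> x)"

text \<open>Interpolates between the two quantities to be compared: at n = 0 it is the Bellman value
  of the initial state, at n = \<open>horizon M - t\<close> the total reward.\<close>

definition running :: "nat \<Rightarrow> 'p \<Rightarrow> nat \<Rightarrow> (nat \<Rightarrow> 'x) \<times> (nat \<Rightarrow> 'a) \<Rightarrow> real" where
  "running t \<theta> n \<omega> = (\<Sum>l=t..<t + n. reward M l (fst \<omega> l) (snd \<omega> l) (fst \<omega> (Suc l)))
     + bellman (t + n) \<theta> (fst \<omega> (t + n))"

lemma running_measurable:
  assumes n: "t + n \<le> horizon M" and cont: "continuous_on X (bellman (t + n) \<theta>)"
  shows "running t \<theta> n \<in> borel_measurable (path_space M t (t + n))"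
proof -
  let ?S = "path_space M t (t + n)"
  have "(\<lambda>\<omega>. reward M l (fst \<omega> l) (snd \<omega> l) (fst \<omega> (Suc l))) \<in> borel_measurable ?S"
    if l: "l \<in> {t..<t + n}" for l
  proof -
    have "(\<lambda>\<omega>. (\<lambda>(x, a, y). reward M l x a y) (fst \<omega> l, snd \<omega> l, fst \<omega> (Suc l))) \<in> borel_measurable ?S"
    proof (rule borel_measurable_continuous_on_compose[OF f_cont])
      show "l < horizon M" using l n by auto
      show "(\<lambda>\<omega>. (fst \<omega> l, snd \<omega> l, fst \<omega> (Suc l))) \<in> borel_measurable ?S"
        using l by (intro borel_measurable_Pair borel_measurable_restrict_borelD[OF state_measurable]
            borel_measurable_restrict_borelD[OF act_measurable]) auto
    qed (use l in \<open>auto simp: space_path_space\<close>)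
    then show ?thesis by simp
  qed
  moreover have "(\<lambda>\<omega>. bellman (t + n) \<theta> (fst \<omega> (t + n))) \<in> borel_measurable ?S"
    by (rule borel_measurable_continuous_on_compose[OF cont borel_measurable_restrict_borelD[OF state_measurable]])
      (auto simp: space_path_space)
  ultimately show ?thesis unfolding running_def by (intro borel_measurable_add borel_measurable_sum) auto
qed

lemma running_bounded:
  assumes n: "t + n \<le> horizon M" and cont: "continuous_on X (bellman (t + n) \<theta>)"
  obtains B where "\<And>\<omega>. \<omega> \<in> space (path_space M t (t + n)) \<Longrightarrow> \<bar>running t \<theta> n \<omega>\<bar> \<le> B"
proof -
  have "\<exists>C. \<forall>z\<in>X \<times> A \<times> X. \<bar>(\<lambda>(x, a, y). reward M l x a y) z\<bar> \<le> C" if "l < horizon M" for l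
    using compact_continuous_bounded[OF compact_Times[OF compact_X compact_Times[OF compact_A compact_X]] f_cont[OF that]]
    by metis
  then obtain C where "\<And>l. l < horizon M \<Longrightarrow> \<forall>z\<in>X \<times> A \<times> X. \<bar>(\<lambda>(x, a, y). reward M l x a y) z\<bar> \<le> C l"
    by metis
  then have C: "\<bar>reward M l x a y\<bar> \<le> C l" if "l < horizon M" "x \<in> X" "a \<in> A" "y \<in> X" for l x a y
    using that by force
  obtain B where B: "\<And>x. x \<in> X \<Longrightarrow> \<bar>bellman (t + n) \<theta> x\<bar> \<le> B"
    using compact_continuous_bounded[OF compact_X cont] by metis
  show ?thesis
  proof (rule that)
    fix \<omega> assume "\<omega> \<in> space (path_space M t (t + n))"
    then have \<omega>: "\<And>l. l \<in> {t..t + n} \<Longrightarrow> fst \<omega> l \<in> X" "\<And>l. l \<in> {t..<t + n} \<Longrightarrow> snd \<omega> l \<in> A"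
      by (auto simp: space_path_space)
    have "\<bar>\<Sum>l=t..<t + n. reward M l (fst \<omega> l) (snd \<omega> l) (fst \<omega> (Suc l))\<bar> \<le> (\<Sum>l=t..<t + n. C l)"
      using n \<omega> by (intro order_trans[OF sum_abs] sum_mono C) auto
    moreover have "\<bar>bellman (t + n) \<theta> (fst \<omega> (t + n))\<bar> \<le> B" using \<omega> by (intro B) auto
    ultimately show "\<bar>running t \<theta> n \<omega>\<bar> \<le> (\<Sum>l=t..<t + n. C l) + B" unfolding running_def by linarith
  qed
qed

lemma running_extend:
  "running t \<theta> (Suc n) (extend t n \<omega> a y)
    = (\<Sum>l=t..<t + n. reward M l (fst \<omega> l) (snd \<omega> l) (fst \<omega> (Suc l)))
      + (reward M (t + n) (fst \<omega> (t + n)) a y + bellman (Suc (t + n)) \<theta> y)"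
proof -
  have "(\<Sum>l=t..<t + n. reward M l (fst (extend t n \<omega> a y) l) (snd (extend t n \<omega> a y) l) (fst (extend t n \<omega> a y) (Suc l)))
     = (\<Sum>l=t..<t + n. reward M l (fst \<omega> l) (snd \<omega> l) (fst \<omega> (Suc l)))"
    by (intro sum.cong) (auto simp: extend_def)
  then show ?thesis by (simp add: running_def extend_def)
qed

section \<open>The induction step: from later times to time t\<close>

context
  fixes \<theta> :: 'p and t :: nat
  assumes \<theta>: "\<theta> \<in> params M"
    and V_cont: "\<And>s. t < s \<Longrightarrow> s \<le> horizon M \<Longrightarrow> continuous_on X (V M s \<theta>)"
    and V_bellman: "\<And>s x. t < s \<Longrightarrow> s \<le> horizon M \<Longrightarrow> x \<in> X \<Longrightarrow> V M s \<theta> x = bellman s \<theta> x"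
begin

lemma bellman_continuous:
  assumes "t \<le> s" "s \<le> horizon M" shows "continuous_on X (bellman s \<theta>)"
  using assms policy_integral_G_continuous[of s \<theta>] V_cont[of "Suc s"] \<theta> g_cont
  by (cases "s = horizon M") (auto simp: bellman_def[abs_def])

text \<open>
  Along the law of a path, the accumulated reward plus the Bellman value of the current state is
  a submartingale for every admissible kernel, and a martingale for the worst-case kernel.
\<close>
lemma running_step:
  assumes n: "t + n < horizon M" and P: "\<And>l. l \<in> {t..<horizon M} \<Longrightarrow> P l \<in> kernels M" and x: "x \<in> X"
  defines "q \<equiv> \<lambda>x a. \<integral>y. reward M (t + n) x a y + V M (Suc (t + n)) \<theta> y \<partial>P (t + n) (x, a)"
  shows "(\<And>x a. x \<in> X \<Longrightarrow> a \<in> A \<Longrightarrow> G M (t + n) \<theta> x a \<le> q x a) \<Longrightarrow>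
      (\<integral>\<omega>. running t \<theta> n \<omega> \<partial>path_law M \<theta> P t x n) \<le> (\<integral>\<omega>. running t \<theta> (Suc n) \<omega> \<partial>path_law M \<theta> P t x (Suc n))"
    and "(\<And>x a. x \<in> X \<Longrightarrow> a \<in> A \<Longrightarrow> q x a = G M (t + n) \<theta> x a) \<Longrightarrow>
      (\<integral>\<omega>. running t \<theta> (Suc n) \<omega> \<partial>path_law M \<theta> P t x (Suc n)) = (\<integral>\<omega>. running t \<theta> n \<omega> \<partial>path_law M \<theta> P t x n)"
proof -
  let ?S = "path_space M t (t + n)" and ?law = "path_law M \<theta> P t x n"
  let ?c = "\<lambda>\<omega>. \<Sum>l=t..<t + n. reward M l (fst \<omega> l) (snd \<omega> l) (fst \<omega> (Suc l))"
  have Pn: "P (t + n) \<in> kernels M" using P n by auto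
  have W: "continuous_on X (V M (Suc (t + n)) \<theta>)" using V_cont n by auto
  have "?law \<in> space (prob_algebra ?S)" using path_law_prob[OF \<theta> P x] n by simp
  then have law: "prob_space ?law" "sets ?law = sets ?S" "space ?law = space ?S"
    by (auto simp: space_prob_algebra dest: sets_eq_imp_space_eq)
  interpret prob_space ?law by fact
  have b: "continuous_on X (bellman (t + Suc n) \<theta>)" "continuous_on X (bellman (t + n) \<theta>)"
    using bellman_continuous n by auto
  have m: "running t \<theta> (Suc n) \<in> borel_measurable (path_space M t (t + Suc n))"
    "running t \<theta> n \<in> borel_measurable ?S"
    by (rule running_measurable[OF _ b(1)], use n in simp, rule running_measurable[OF _ b(2)], use n in simp)
  obtain B where B: "\<And>\<omega>. \<omega> \<in> space (path_space M t (t + Suc n)) \<Longrightarrow> \<bar>running t \<theta> (Suc n) \<omega>\<bar> \<le> B"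
    by (rule running_bounded[OF _ b(1)]) (use n in auto)
  obtain B' where B': "\<And>\<omega>. \<omega> \<in> space ?S \<Longrightarrow> \<bar>running t \<theta> n \<omega>\<bar> \<le> B'"
    by (rule running_bounded[OF _ b(2)]) (use n in auto)
  have N: "next_step \<theta> P t n \<in> ?law \<rightarrow>\<^sub>M prob_algebra (path_space M t (t + Suc n))"
    unfolding measurable_cong_sets[OF law(2) refl] by (rule next_step_measurable[where P = P, OF n Pn \<theta>])
  have int: "integrable ?law (\<lambda>\<omega>. \<integral>w. running t \<theta> (Suc n) w \<partial>next_step \<theta> P t n \<omega>)"
    by (rule integrable_kernel_integral[OF law(1) N m(1) B])
  have int': "integrable ?law (running t \<theta> n)"
    using B' m(2) law by (intro integrable_const_bound[where B = B']) (auto cong: measurable_cong_sets)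
  have eq: "(\<integral>\<omega>. running t \<theta> (Suc n) \<omega> \<partial>path_law M \<theta> P t x (Suc n))
      = (\<integral>\<omega>. \<integral>w. running t \<theta> (Suc n) w \<partial>next_step \<theta> P t n \<omega> \<partial>?law)"
    unfolding path_law_Suc by (rule integral_bind_prob_algebra[OF law(1) N m(1) B])
  have state: "(\<integral>w. running t \<theta> (Suc n) w \<partial>next_state P t n (\<omega>, a)) = ?c \<omega> + q (fst \<omega> (t + n)) a"
    if \<omega>: "\<omega> \<in> space ?S" and a: "a \<in> A" for \<omega> a
  proof -
    have x': "fst \<omega> (t + n) \<in> X" using \<omega> by (simp add: space_path_space)
    note Q = kernel_prob[OF Pn x' a]
    interpret Q: prob_space "P (t + n) (fst \<omega> (t + n), a)" using Q by (rule prob_measures_onD)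
    have "(\<integral>w. running t \<theta> (Suc n) w \<partial>next_state P t n (\<omega>, a))
        = (\<integral>y. ?c \<omega> + (reward M (t + n) (fst \<omega> (t + n)) a y + bellman (Suc (t + n)) \<theta> y) \<partial>P (t + n) (fst \<omega> (t + n), a))"
      unfolding running_extend[symmetric] by (rule integral_next_state[where P = P, OF n Pn m(1) B \<omega> a])
    \<comment> \<open>Time t + n + 1 is later than t, so the induction hypothesis turns the Bellman
      value into \<open>V\<close>, the function out of which \<open>G\<close> is built.\<close>
    also have "\<dots> = (\<integral>y. ?c \<omega> + (reward M (t + n) (fst \<omega> (t + n)) a y + V M (Suc (t + n)) \<theta> y) \<partial>P (t + n) (fst \<omega> (t + n), a))"
      using V_bellman[of "Suc (t + n)"] n prob_measures_onD(3)[OF Q]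
      by (intro Bochner_Integration.integral_cong) auto
    also have "\<dots> = ?c \<omega> + q (fst \<omega> (t + n)) a"
      using integrable_continuous_on_compact[OF Q compact_X reward_plus_V_continuous[OF n \<theta> W x' a]]
      by (simp add: q_def Q.prob_space)
    finally show ?thesis .
  qed
  have step: "(\<integral>w. running t \<theta> (Suc n) w \<partial>next_step \<theta> P t n \<omega>)
      = (\<integral>a. \<integral>w. running t \<theta> (Suc n) w \<partial>next_state P t n (\<omega>, a) \<partial>policy M (t + n) \<theta> (fst \<omega> (t + n)))"
    and step_int: "integrable (policy M (t + n) \<theta> (fst \<omega> (t + n)))
      (\<lambda>a. \<integral>w. running t \<theta> (Suc n) w \<partial>next_state P t n (\<omega>, a))"
    if \<omega>: "\<omega> \<in> space ?S" for \<omega>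
    by (rule integral_next_step[where P = P, OF n Pn \<theta> m(1) B \<omega>], assumption)+
  have run: "running t \<theta> n \<omega> = (\<integral>a. ?c \<omega> + G M (t + n) \<theta> (fst \<omega> (t + n)) a \<partial>policy M (t + n) \<theta> (fst \<omega> (t + n)))"
    and G_int: "integrable (policy M (t + n) \<theta> (fst \<omega> (t + n))) (\<lambda>a. ?c \<omega> + G M (t + n) \<theta> (fst \<omega> (t + n)) a)"
    if \<omega>: "\<omega> \<in> space ?S" for \<omega>
  proof -
    have x': "fst \<omega> (t + n) \<in> X" using \<omega> by (simp add: space_path_space)
    note Q = policy_prob[OF n \<theta> x']
    interpret Q: prob_space "policy M (t + n) \<theta> (fst \<omega> (t + n))" using Q by (rule prob_measures_onD)
    have i: "integrable (policy M (t + n) \<theta> (fst \<omega> (t + n))) (G M (t + n) \<theta> (fst \<omega> (t + n)))"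
      by (rule integrable_continuous_on_compact[OF Q compact_A G_slice_continuous[OF n \<theta> W x']])
    then show "integrable (policy M (t + n) \<theta> (fst \<omega> (t + n))) (\<lambda>a. ?c \<omega> + G M (t + n) \<theta> (fst \<omega> (t + n)) a)"
      by simp
    show "running t \<theta> n \<omega> = (\<integral>a. ?c \<omega> + G M (t + n) \<theta> (fst \<omega> (t + n)) a \<partial>policy M (t + n) \<theta> (fst \<omega> (t + n)))"
      using i n by (simp add: running_def bellman_def Q.prob_space)
  qed
  have space_policy: "space (policy M (t + n) \<theta> (fst \<omega> (t + n))) = A" if "\<omega> \<in> space ?S" for \<omega>
    using that by (intro prob_measures_onD(3)[OF policy_prob[OF n \<theta>]]) (auto simp: space_path_space)
  {
    assume le: "\<And>x a. x \<in> X \<Longrightarrow> a \<in> A \<Longrightarrow> G M (t + n) \<theta> x a \<le> q x a"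
    show "(\<integral>\<omega>. running t \<theta> n \<omega> \<partial>?law) \<le> (\<integral>\<omega>. running t \<theta> (Suc n) \<omega> \<partial>path_law M \<theta> P t x (Suc n))"
      unfolding eq
    proof (rule integral_mono[OF int' int])
      fix \<omega> assume "\<omega> \<in> space ?law"
      then have \<omega>: "\<omega> \<in> space ?S" using law by simp
      then have x': "fst \<omega> (t + n) \<in> X" by (simp add: space_path_space)
      show "running t \<theta> n \<omega> \<le> (\<integral>w. running t \<theta> (Suc n) w \<partial>next_step \<theta> P t n \<omega>)"
        unfolding run[OF \<omega>] step[OF \<omega>]
      proof (rule integral_mono[OF G_int[OF \<omega>] step_int[OF \<omega>]])
        fix a assume "a \<in> space (policy M (t + n) \<theta> (fst \<omega> (t + n)))"
        then have a: "a \<in> A" using space_policy[OF \<omega>] by simp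
        show "?c \<omega> + G M (t + n) \<theta> (fst \<omega> (t + n)) a \<le> (\<integral>w. running t \<theta> (Suc n) w \<partial>next_state P t n (\<omega>, a))"
          unfolding state[OF \<omega> a] using le[OF x' a] by simp
      qed
    qed
  }
  {
    assume q: "\<And>x a. x \<in> X \<Longrightarrow> a \<in> A \<Longrightarrow> q x a = G M (t + n) \<theta> x a"
    show "(\<integral>\<omega>. running t \<theta> (Suc n) \<omega> \<partial>path_law M \<theta> P t x (Suc n)) = (\<integral>\<omega>. running t \<theta> n \<omega> \<partial>?law)"
      unfolding eq
    proof (rule Bochner_Integration.integral_cong[OF refl])
      fix \<omega> assume "\<omega> \<in> space ?law"
      then have \<omega>: "\<omega> \<in> space ?S" using law by simp
      then have x': "fst \<omega> (t + n) \<in> X" by (simp add: space_path_space)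
      show "(\<integral>w. running t \<theta> (Suc n) w \<partial>next_step \<theta> P t n \<omega>) = running t \<theta> n \<omega>"
        unfolding run[OF \<omega>] step[OF \<omega>]
      proof (rule Bochner_Integration.integral_cong[OF refl])
        fix a assume "a \<in> space (policy M (t + n) \<theta> (fst \<omega> (t + n)))"
        then have a: "a \<in> A" using space_policy[OF \<omega>] by simp
        show "(\<integral>w. running t \<theta> (Suc n) w \<partial>next_state P t n (\<omega>, a)) = ?c \<omega> + G M (t + n) \<theta> (fst \<omega> (t + n)) a"
          unfolding state[OF \<omega> a] using q[OF x' a] by simp
      qed
    qed
  }
qed

lemma running_0:
  assumes "t \<le> horizon M" "x \<in> X"
  shows "(\<integral>\<omega>. running t \<theta> 0 \<omega> \<partial>path_law M \<theta> P t x 0) = bellman t \<theta> x"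
proof -
  have "(\<lambda>l\<in>{t}. x, \<lambda>l\<in>{}. undefined) \<in> space (path_space M t t)"
    using assms by (auto simp: space_path_space)
  moreover have "running t \<theta> 0 \<in> borel_measurable (path_space M t t)"
    using running_measurable[of t 0 \<theta>] bellman_continuous assms by simp
  ultimately show ?thesis by (simp add: integral_return) (simp add: running_def)
qed

text \<open>The infimum over admissible kernels is a minimum, attained by taking the worst-case
  kernel at every time. Both halves iterate \<open>running_step\<close> from n = 0 to n =
  \<open>horizon M - t\<close>: with equality for the worst case, with an inequality for an
  arbitrary competitor.\<close>

lemma V_eq_bellman:
  assumes t: "t \<le> horizon M" and x: "x \<in> X"
  shows "V M t \<theta> x = bellman t \<theta> x"
proof -
  define J where "J P = (\<integral>\<omega>. total_reward M t \<omega> \<partial>path_law M \<theta> P t x (horizon M - t))" for P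
  have "total_reward M t \<omega> = running t \<theta> (horizon M - t) \<omega>" for \<omega>
    using t by (cases \<omega>) (simp add: running_def total_reward_def bellman_def)
  then have J: "J P = (\<integral>\<omega>. running t \<theta> (horizon M - t) \<omega> \<partial>path_law M \<theta> P t x (horizon M - t))" for P
    by (simp only: J_def)
  have W: "continuous_on X (V M (Suc s) \<theta>)" if "t \<le> s" "s < horizon M" for s
    using V_cont that by auto
  have "(INF P\<in>admissible_kernels M t. J P) = bellman t \<theta> x"
  proof (rule cInf_eq_minimum)
    define P where "P s = worst s \<theta>" for s
    have ker: "P s \<in> kernels M" if "s \<in> {t..<horizon M}" for s
      unfolding P_def using that by (intro worst_kernel W \<theta>) auto
    have "P s (x, a) \<in> ambiguity_ball M s x a" if "s \<in> {t..<horizon M}" "x \<in> X" "a \<in> A" for s x a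
      unfolding P_def using that by (intro worst_in_ball W \<theta>) auto
    with ker have "P \<in> admissible_kernels M t"
      unfolding admissible_kernels_def by blast
    moreover have "t + n \<le> horizon M \<Longrightarrow> (\<integral>\<omega>. running t \<theta> n \<omega> \<partial>path_law M \<theta> P t x n) = bellman t \<theta> x" for n
    proof (induction n)
      case (Suc n)
      then have n: "t + n < horizon M" by simp
      have "(\<integral>\<omega>. running t \<theta> (Suc n) \<omega> \<partial>path_law M \<theta> P t x (Suc n))
          = (\<integral>\<omega>. running t \<theta> n \<omega> \<partial>path_law M \<theta> P t x n)"
      proof (rule running_step(2)[OF n ker x])
        fix x a assume "x \<in> X" "a \<in> A"
        then show "(\<integral>y. reward M (t + n) x a y + V M (Suc (t + n)) \<theta> y \<partial>P (t + n) (x, a)) = G M (t + n) \<theta> x a"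
          unfolding P_def using n by (intro worst_attains \<theta> W) auto
      qed
      then show ?case using Suc by simp
    qed (use running_0[OF t x] in simp)
    from this[of "horizon M - t"] have "J P = bellman t \<theta> x" unfolding J using t by simp
    ultimately show "bellman t \<theta> x \<in> J ` admissible_kernels M t" by force
  next
    fix j assume "j \<in> J ` admissible_kernels M t"
    then obtain P where P: "P \<in> admissible_kernels M t" and j: "j = J P" by auto
    have "t + n \<le> horizon M \<Longrightarrow> bellman t \<theta> x \<le> (\<integral>\<omega>. running t \<theta> n \<omega> \<partial>path_law M \<theta> P t x n)" for n
    proof (induction n)
      case (Suc n)
      then have n: "t + n < horizon M" by simp
      have "(\<integral>\<omega>. running t \<theta> n \<omega> \<partial>path_law M \<theta> P t x n)
          \<le> (\<integral>\<omega>. running t \<theta> (Suc n) \<omega> \<partial>path_law M \<theta> P t x (Suc n))"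
      proof (rule running_step(1)[OF n _ x])
        show "P l \<in> kernels M" if "l \<in> {t..<horizon M}" for l
          using P that unfolding admissible_kernels_def by blast
        fix x a assume xa: "x \<in> X" "a \<in> A"
        have "P (t + n) (x, a) \<in> ambiguity_ball M (t + n) x a"
          using P xa n unfolding admissible_kernels_def by auto
        with xa show "G M (t + n) \<theta> x a
            \<le> (\<integral>y. reward M (t + n) x a y + V M (Suc (t + n)) \<theta> y \<partial>P (t + n) (x, a))"
          using n by (intro ball_lower_bound \<theta> W) auto
      qed
      then show ?case using Suc by simp
    qed (use running_0[OF t x] in simp)
    from this[of "horizon M - t"] show "bellman t \<theta> x \<le> j" unfolding j J using t by simp
  qed
  then show ?thesis by (simp add: V_def J_def)
qed

end

text \<open>Continuity and the recursion are proved together: continuity at later times makes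
  duality available, and the recursion then yields continuity at time t. The induction is over all
  later times because a path law started at t passes through each of them, and
  \<open>bellman\<close> refers to the true value \<open>V\<close> at the next time instead of to
  itself.\<close>

lemma dynamic_programming:
  assumes \<theta>: "\<theta> \<in> params M"
  shows "t \<le> horizon M \<Longrightarrow> continuous_on X (V M t \<theta>) \<and> (\<forall>x\<in>X. V M t \<theta> x = bellman t \<theta> x)"
proof (induction "horizon M - t" arbitrary: t rule: less_induct)
  case less
  have IH: "continuous_on X (V M s \<theta>) \<and> (\<forall>x\<in>X. V M s \<theta> x = bellman s \<theta> x)"
    if "t < s" "s \<le> horizon M" for s using that by (intro less.hyps) simp_all
  note cont = IH[THEN conjunct1] and val = IH[THEN conjunct2, rule_format]
  have eq: "V M t \<theta> x = bellman t \<theta> x" if "x \<in> X" for x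
    by (rule V_eq_bellman[OF \<theta> cont val less.prems that])
  have "continuous_on X (bellman t \<theta>)"
    by (rule bellman_continuous[OF \<theta> cont val order_refl less.prems])
  then have "continuous_on X (V M t \<theta>)" by (rule continuous_on_eq) (simp add: eq)
  then show ?case using eq by simp
qed

end

section \<open>Sensitivity\<close>

locale dr_sensitivity = dr_problem M \<Lambda> lstar ystar
  for M :: "('x::euclidean_space, 'a::euclidean_space, 'p::euclidean_space) dr_model"
    and \<Lambda> :: real
    and lstar :: "nat \<Rightarrow> 'x \<Rightarrow> 'a \<Rightarrow> 'p \<Rightarrow> real"
    and ystar :: "nat \<Rightarrow> 'x \<Rightarrow> 'a \<Rightarrow> 'x \<Rightarrow> 'p \<Rightarrow> 'x" +
  assumes equicont: "\<And>\<theta> r. \<theta> \<in> interior (params M) \<Longrightarrow>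
      \<exists>h0>0.
        (\<forall>s\<le>horizon M. equicontinuous_on (states M)
           {(\<lambda>x. diff_quotient (\<lambda>\<theta>'. V M s \<theta>' x) \<theta> r h) | h.
              0 < \<bar>h\<bar> \<and> \<bar>h\<bar> \<le> h0 \<and> \<theta> + h *\<^sub>R r \<in> params M}) \<and>
        (\<forall>s<horizon M. equicontinuous_on (states M \<times> acts M \<times> {0..\<Lambda>})
           {(\<lambda>(x, a, l). diff_quotient (\<lambda>\<theta>'. F M s \<theta>' l x a) \<theta> r h) | h.
              0 < \<bar>h\<bar> \<and> \<bar>h\<bar> \<le> h0 \<and> \<theta> + h *\<^sub>R r \<in> params M})"
begin

lemma V_continuous: "\<theta> \<in> params M \<Longrightarrow> t \<le> horizon M \<Longrightarrow> continuous_on X (V M t \<theta>)"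
  using dynamic_programming by blast

lemma V_terminal: "\<theta> \<in> params M \<Longrightarrow> x \<in> X \<Longrightarrow> V M (horizon M) \<theta> x = terminal M x"
  using dynamic_programming[of \<theta> "horizon M"] by (simp add: bellman_def)

lemma V_recursion:
  "\<theta> \<in> params M \<Longrightarrow> t < horizon M \<Longrightarrow> x \<in> X \<Longrightarrow> V M t \<theta> x = (\<integral>a. G M t \<theta> x a \<partial>policy M t \<theta> x)"
  using dynamic_programming[of \<theta> t] by (simp add: bellman_def)

section \<open>Change of parameter in the policy\<close>

lemma space_refm: "space (refm M) = A" and sets_refm: "sets (refm M) = sets (borel_on A)"
  using model by (auto simp: wf_model_def dest: sets_eq_imp_space_eq)

lemma dens_props:
  assumes "t < horizon M" "\<theta> \<in> params M" "x \<in> X"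
  shows "dens M t \<theta> x \<in> borel_measurable (borel_on A)" "\<And>a. a \<in> A \<Longrightarrow> 0 < dens M t \<theta> x a"
  using assms model regular by (auto simp: wf_model_def regular_policies_def)

text \<open>Moves the perturbed parameter from the measure into the integrand, so that dominated
  convergence can be applied under one fixed measure. Dividing by the density is legitimate because
  it is positive.\<close>

lemma policy_change:
  fixes \<phi> :: "'a \<Rightarrow> real"
  assumes t: "t < horizon M" and x: "x \<in> X" and \<theta>: "\<theta> \<in> params M" "\<theta>' \<in> params M"
    and \<phi>: "\<phi> \<in> borel_measurable (borel_on A)"
  shows "(\<integral>a. \<phi> a \<partial>policy M t \<theta>' x) = (\<integral>a. \<phi> a * (dens M t \<theta>' x a / dens M t \<theta> x a) \<partial>policy M t \<theta> x)"
proof -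
  note d = dens_props[OF t \<theta>(1) x] and d' = dens_props[OF t \<theta>(2) x]
  have m: "dens M t \<theta> x \<in> borel_measurable (refm M)" "dens M t \<theta>' x \<in> borel_measurable (refm M)"
    "\<phi> \<in> borel_measurable (refm M)"
    using d(1) d'(1) \<phi> by (simp_all add: measurable_cong_sets[OF sets_refm refl])
  have "(\<integral>a. \<phi> a \<partial>policy M t \<theta>' x) = (\<integral>a. dens M t \<theta>' x a *\<^sub>R \<phi> a \<partial>refm M)"
    unfolding policy_def using m d'(2) by (intro integral_density AE_I2) (auto simp: space_refm less_imp_le)
  also have "\<dots> = (\<integral>a. dens M t \<theta> x a *\<^sub>R (\<phi> a * (dens M t \<theta>' x a / dens M t \<theta> x a)) \<partial>refm M)"
    using d(2) by (intro Bochner_Integration.integral_cong) (auto simp: space_refm less_imp_neq[symmetric])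
  also have "\<dots> = (\<integral>a. \<phi> a * (dens M t \<theta>' x a / dens M t \<theta> x a) \<partial>policy M t \<theta> x)"
    unfolding policy_def using m d(2)
    by (intro integral_density[symmetric] AE_I2) (auto simp: space_refm less_imp_le)
  finally show ?thesis .
qed

text \<open>The mean value inequality with the bounded score. It requires a convex set, which
  \<open>params M\<close> need not be; hence the ball inside it.\<close>

lemma log_density_lipschitz:
  obtains C where "C \<ge> 0" "\<And>t x a \<theta> \<theta>' \<rho>. t < horizon M \<Longrightarrow> x \<in> X \<Longrightarrow> a \<in> A \<Longrightarrow> ball \<theta> \<rho> \<subseteq> params M
    \<Longrightarrow> \<theta>' \<in> ball \<theta> \<rho> \<Longrightarrow> \<bar>ln (dens M t \<theta>' x a) - ln (dens M t \<theta> x a)\<bar> \<le> C * norm (\<theta>' - \<theta>)"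
proof -
  obtain score C where C: "\<forall>t<horizon M. \<forall>\<theta>\<in>params M. \<forall>x\<in>X. \<forall>a\<in>A.
        ((\<lambda>\<theta>'. ln (dens M t \<theta>' x a)) has_derivative (\<lambda>v. score t \<theta> x a \<bullet> v))
          (at \<theta> within params M) \<and> norm (score t \<theta> x a) \<le> C"
    using regular unfolding regular_policies_def by blast
  \<comment> \<open>The maximum with 0 makes the constant nonnegative without an argument that the
    bound on the score is ever instantiated.\<close>
  show ?thesis
  proof (rule that[of "max C 0"])
    fix t x a \<theta> \<theta>' \<rho>
    assume *: "t < horizon M" "x \<in> X" "a \<in> A" "ball \<theta> \<rho> \<subseteq> params M" "\<theta>' \<in> ball \<theta> \<rho>"
    have "norm (ln (dens M t \<theta>' x a) - ln (dens M t \<theta> x a)) \<le> max C 0 * norm (\<theta>' - \<theta>)"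
    proof (rule differentiable_bound[where S = "ball \<theta> \<rho>" and f' = "\<lambda>\<theta> v. score t \<theta> x a \<bullet> v"])
      show "\<theta> \<in> ball \<theta> \<rho>" using *(5) by (auto intro: le_less_trans[OF zero_le_dist])
      fix \<theta>'' assume "\<theta>'' \<in> ball \<theta> \<rho>"
      then have "\<theta>'' \<in> params M" using * by auto
      with C * have **: "((\<lambda>\<theta>'. ln (dens M t \<theta>' x a)) has_derivative (\<lambda>v. score t \<theta>'' x a \<bullet> v)) (at \<theta>'' within params M)"
        "norm (score t \<theta>'' x a) \<le> C" by blast+
      show "((\<lambda>\<theta>'. ln (dens M t \<theta>' x a)) has_derivative (\<lambda>v. score t \<theta>'' x a \<bullet> v)) (at \<theta>'' within ball \<theta> \<rho>)"
        by (rule has_derivative_subset[OF **(1) *(4)])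
      show "onorm (\<lambda>v. score t \<theta>'' x a \<bullet> v) \<le> max C 0"
      proof (rule onorm_le)
        fix v
        have "norm (score t \<theta>'' x a \<bullet> v) \<le> norm (score t \<theta>'' x a) * norm v"
          using Cauchy_Schwarz_ineq2 by simp
        also have "\<dots> \<le> max C 0 * norm v" using **(2) by (intro mult_right_mono) auto
        finally show "norm (score t \<theta>'' x a \<bullet> v) \<le> max C 0 * norm v" .
      qed
    qed (use * in auto)
    then show "\<bar>ln (dens M t \<theta>' x a) - ln (dens M t \<theta> x a)\<bar> \<le> max C 0 * norm (\<theta>' - \<theta>)" by simp
  qed simp
qed

section \<open>One backward step, given gradients \<open>gv\<close> at the next time\<close>

context
  fixes t :: nat and \<theta> :: 'p and gv :: "'x \<Rightarrow> 'p"
  assumes t: "t < horizon M" and \<theta>: "\<theta> \<in> interior (params M)"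
    and gv: "\<And>x r. x \<in> X \<Longrightarrow> has_dir_deriv (\<lambda>\<theta>'. V M (Suc t) \<theta>' x) \<theta> r (gv x \<bullet> r)"
begin

lemma \<theta>_params: "\<theta> \<in> params M" using \<theta> interior_subset by blast

lemma V_cont': "\<theta>' \<in> params M \<Longrightarrow> continuous_on X (V M (Suc t) \<theta>')"
  using V_continuous t by simp

text \<open>Collects what holds for all small step sizes, so that a sequence may be assumed to
  satisfy it at every index. What does not depend on the step size is kept apart in
  \<open>uniform_scale\<close>.\<close>

definition good where
  "good r \<rho> h0 B h \<longleftrightarrow> \<bar>h\<bar> \<le> h0 \<and> \<theta> + h *\<^sub>R r \<in> ball \<theta> \<rho> \<and> \<theta> + h *\<^sub>R r \<in> params M
     \<and> (\<forall>y\<in>X. \<bar>V M (Suc t) (\<theta> + h *\<^sub>R r) y - V M (Suc t) \<theta> y\<bar> \<le> B * \<bar>h\<bar>)"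

definition uniform_scale where
  "uniform_scale r \<rho> h0 B \<longleftrightarrow> B \<ge> 0 \<and> h0 > 0 \<and> ball \<theta> \<rho> \<subseteq> params M \<and>
        equicontinuous_on X
           {(\<lambda>x. diff_quotient (\<lambda>\<theta>'. V M (Suc t) \<theta>' x) \<theta> r h) | h.
              0 < \<bar>h\<bar> \<and> \<bar>h\<bar> \<le> h0 \<and> \<theta> + h *\<^sub>R r \<in> params M} \<and>
        equicontinuous_on (X \<times> A \<times> {0..\<Lambda>})
           {(\<lambda>(x, a, l). diff_quotient (\<lambda>\<theta>'. F M t \<theta>' l x a) \<theta> r h) | h.
              0 < \<bar>h\<bar> \<and> \<bar>h\<bar> \<le> h0 \<and> \<theta> + h *\<^sub>R r \<in> params M}"

text \<open>The radius \<rho> comes from \<theta> being interior and \<open>h0\<close> from the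
  equicontinuity hypothesis. The constant \<open>B\<close> bounds the quotients of the next value
  uniformly: they converge at each state to \<open>gv x \<bullet> r\<close>, and equicontinuity
  spreads this over the compact state space.\<close>

lemma eventually_good:
  obtains \<rho> h0 B where "uniform_scale r \<rho> h0 B" "eventually (good r \<rho> h0 B) (at 0)"
proof -
  obtain h0 where h0: "h0 > 0"
    "\<forall>s\<le>horizon M. equicontinuous_on X
           {(\<lambda>x. diff_quotient (\<lambda>\<theta>'. V M s \<theta>' x) \<theta> r h) | h.
              0 < \<bar>h\<bar> \<and> \<bar>h\<bar> \<le> h0 \<and> \<theta> + h *\<^sub>R r \<in> params M}"
    "\<forall>s<horizon M. equicontinuous_on (X \<times> A \<times> {0..\<Lambda>})
           {(\<lambda>(x, a, l). diff_quotient (\<lambda>\<theta>'. F M s \<theta>' l x a) \<theta> r h) | h.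
              0 < \<bar>h\<bar> \<and> \<bar>h\<bar> \<le> h0 \<and> \<theta> + h *\<^sub>R r \<in> params M}"
    using equicont[OF \<theta>, of r] by blast
  obtain \<rho> where \<rho>: "\<rho> > 0" "ball \<theta> \<rho> \<subseteq> params M"
    using \<theta> by (auto simp: mem_interior)
  let ?Q = "\<lambda>h x. diff_quotient (\<lambda>\<theta>'. V M (Suc t) \<theta>' x) \<theta> r h"
  let ?H = "{h. 0 < \<bar>h\<bar> \<and> \<bar>h\<bar> \<le> h0 \<and> \<theta> + h *\<^sub>R r \<in> params M}"
  have "((\<lambda>h::real. \<theta> + h *\<^sub>R r) \<longlongrightarrow> \<theta> + 0 *\<^sub>R r) (at 0)" by (intro tendsto_intros)
  then have ball: "\<forall>\<^sub>F h in at (0::real). \<theta> + h *\<^sub>R r \<in> ball \<theta> \<rho>"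
    using \<rho>(1) by (auto dest!: tendstoD[where e = \<rho>] simp: dist_commute)
  have small: "\<forall>\<^sub>F h in at (0::real). 0 < \<bar>h\<bar> \<and> \<bar>h\<bar> \<le> h0"
    using h0(1) by (auto simp: eventually_at dist_real_def intro!: exI[of _ h0])
  have H: "\<forall>\<^sub>F h in at 0. h \<in> ?H" using ball small by eventually_elim (use \<rho> in auto)
  have e: "equicontinuous_on X (?Q ` ?H)"
    by (rule h0(2)[rule_format, OF Suc_leI[OF t], unfolded setcompr_eq_image])
  obtain B where B: "B \<ge> 0" "\<forall>\<^sub>F h in at 0. \<forall>x\<in>X. \<bar>?Q h x\<bar> \<le> B"
    by (rule equicontinuous_on_pointwise_bounded[OF compact_X e H, of "\<lambda>x. gv x \<bullet> r"])
      (use gv in \<open>auto simp: has_dir_deriv_iff\<close>)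
  have "eventually (good r \<rho> h0 B) (at 0)"
    using ball H B(2)
  proof eventually_elim
    case (elim h)
    have "\<bar>V M (Suc t) (\<theta> + h *\<^sub>R r) y - V M (Suc t) \<theta> y\<bar> \<le> B * \<bar>h\<bar>" if "y \<in> X" for y
    proof -
      have "\<bar>V M (Suc t) (\<theta> + h *\<^sub>R r) y - V M (Suc t) \<theta> y\<bar> / \<bar>h\<bar> \<le> B"
        using elim(3) that by (simp add: diff_quotient_def)
      then show ?thesis using elim(2) by (simp add: pos_divide_le_eq)
    qed
    then show ?case using elim(1,2) by (simp add: good_def)
  qed
  moreover have "uniform_scale r \<rho> h0 B"
    unfolding uniform_scale_def
    by (intro conjI B h0(1) \<rho>(2) h0(2)[rule_format, OF Suc_leI[OF t]] h0(3)[rule_format, OF t])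
  ultimately show ?thesis using that by blast
qed

section \<open>Limits along a fixed sequence of step sizes\<close>

context
  fixes r :: 'p and \<rho> h0 B :: real and \<eta> :: "nat \<Rightarrow> real"
  assumes scale: "uniform_scale r \<rho> h0 B" and \<eta>: "\<eta> \<longlonglongrightarrow> 0" "\<And>n. \<eta> n \<noteq> 0 \<and> good r \<rho> h0 B (\<eta> n)"
begin

abbreviation pert where "pert n \<equiv> \<theta> + \<eta> n *\<^sub>R r"

lemma pert_params: "pert n \<in> params M" using \<eta>(2) by (simp add: good_def)

lemma V_diff_le: "y \<in> X \<Longrightarrow> \<bar>V M (Suc t) (pert n) y - V M (Suc t) \<theta> y\<bar> \<le> B * \<bar>\<eta> n\<bar>"
  using \<eta>(2) by (simp add: good_def)

lemma V_quotient_tendsto: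
  "y \<in> X \<Longrightarrow> (\<lambda>n. (V M (Suc t) (pert n) y - V M (Suc t) \<theta> y) / \<eta> n) \<longlonglongrightarrow> gv y \<bullet> r"
  using gv[of y r] \<eta> unfolding has_dir_deriv_iff tendsto_at_iff_sequentially
  by (auto simp: diff_quotient_def comp_def)

text \<open>Reward and transport cost cancel, so perturbing \<theta> changes the objective by the
  change of the next value alone. Every bound of order \<open>B\<close> times |\<eta> n| on the
  inner minimum, on \<open>F\<close> and on \<open>G\<close> descends from this.\<close>

lemma inner_objective_diff:
  "inner_objective M t (pert n) l x a x' y - inner_objective M t \<theta> l x a x' y
    = V M (Suc t) (pert n) y - V M (Suc t) \<theta> y"
  by (simp add: inner_objective_def)

lemma inner_min_diff_le:
  assumes "x \<in> X" "a \<in> A" "x' \<in> X"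
  shows "\<bar>inner_min t (pert n) l x a x' - inner_min t \<theta> l x a x'\<bar> \<le> B * \<bar>\<eta> n\<bar>"
  unfolding inner_min_def
  by (intro abs_diff_INF_le compact_X X_nonempty inner_objective_slice_continuous t pert_params \<theta>_params
      V_cont' assms) (simp add: inner_objective_diff V_diff_le)

lemma F_diff_eq:
  assumes x: "x \<in> X" "a \<in> A"
  shows "F M t (pert n) l x a - F M t \<theta> l x a
    = (\<integral>x'. inner_min t (pert n) l x a x' - inner_min t \<theta> l x a x' \<partial>nominal M t (x, a))"
  using inner_min_integrable[OF t \<theta>_params V_cont' x] inner_min_integrable[OF t pert_params V_cont' x]
    \<theta>_params pert_params by (simp add: F_eq)

lemma F_diff_le:
  assumes x: "x \<in> X" "a \<in> A"
  shows "\<bar>F M t (pert n) l x a - F M t \<theta> l x a\<bar> \<le> B * \<bar>\<eta> n\<bar>"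
proof -
  note P = prob_measures_onD[OF nominal_prob[OF t x]]
  interpret prob_space "nominal M t (x, a)" by (rule P)
  show ?thesis unfolding F_diff_eq[OF x]
  proof (rule abs_integral_le)
    show "(\<lambda>x'. inner_min t (pert n) l x a x' - inner_min t \<theta> l x a x') \<in> borel_measurable (nominal M t (x, a))"
      by (intro borel_measurable_diff borel_measurable_integrable inner_min_integrable t pert_params \<theta>_params V_cont' x)
  qed (use inner_min_diff_le[OF x] P(3) in auto)
qed

text \<open>Danskin's argument in y, with the multiplier held at its value for the unperturbed
  \<theta>; its motion is dealt with separately in \<open>G_quotient_tendsto\<close>. Holding it
  there makes the limit minimizer the unique point \<open>ystar\<close>.\<close>

lemma inner_min_quotient_tendsto:
  assumes x: "x \<in> X" "a \<in> A" and x': "x' \<in> X"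
  defines "l \<equiv> lstar t x a \<theta>"
  shows "(\<lambda>n. (inner_min t (pert n) l x a x' - inner_min t \<theta> l x a x') / \<eta> n)
    \<longlonglongrightarrow> gv (ystar t x a x' \<theta>) \<bullet> r"
proof -
  let ?\<Psi> = "\<lambda>n. inner_objective M t (pert n) l x a x'" and ?\<psi> = "inner_objective M t \<theta> l x a x'"
  let ?p = "ystar t x a x' \<theta>"
  note y = ystar_props[OF t \<theta>_params V_cont'[OF \<theta>_params] x x']
  have "\<exists>z. z \<in> X \<and> inner_min t (pert n) l x a x' = ?\<Psi> n z \<and> (\<forall>y\<in>X. ?\<Psi> n z \<le> ?\<Psi> n y)" for n
    by (rule inner_min_attained[OF t pert_params V_cont'[OF pert_params] x x', of n l]) blast
  then obtain z where z: "\<And>n. z n \<in> X" "\<And>n. inner_min t (pert n) l x a x' = ?\<Psi> n (z n)"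
    "\<And>n y. y \<in> X \<Longrightarrow> ?\<Psi> n (z n) \<le> ?\<Psi> n y" by metis
  have "(\<lambda>n. (?\<Psi> n (z n) - ?\<psi> ?p) / \<eta> n) \<longlonglongrightarrow> gv ?p \<bullet> r"
  proof (rule envelope_tendsto[where Y = X and B = B])
    show "continuous_on X ?\<psi>"
      by (rule inner_objective_slice_continuous[OF t \<theta>_params V_cont'[OF \<theta>_params] x x'])
    show "\<forall>\<^sub>F n in sequentially. \<forall>y\<in>X. \<bar>?\<Psi> n y - ?\<psi> y\<bar> \<le> B * \<bar>\<eta> n\<bar>"
      by (simp add: inner_objective_diff V_diff_le)
    show "(\<lambda>n. (?\<Psi> n ?p - ?\<psi> ?p) / \<eta> n) \<longlonglongrightarrow> gv ?p \<bullet> r"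
      unfolding inner_objective_diff by (rule V_quotient_tendsto[OF y(1)])
    fix e :: real assume "e > 0"
    then obtain d where d: "d > 0" "\<forall>\<phi>\<in>{(\<lambda>x. diff_quotient (\<lambda>\<theta>'. V M (Suc t) \<theta>' x) \<theta> r h) | h.
              0 < \<bar>h\<bar> \<and> \<bar>h\<bar> \<le> h0 \<and> \<theta> + h *\<^sub>R r \<in> params M}. \<forall>y\<in>X. dist y ?p < d \<longrightarrow> dist (\<phi> y) (\<phi> ?p) < e"
      using scale y(1) unfolding uniform_scale_def equicontinuous_on_def by blast
    have mem: "(\<lambda>x. diff_quotient (\<lambda>\<theta>'. V M (Suc t) \<theta>' x) \<theta> r (\<eta> n)) \<in> {(\<lambda>x. diff_quotient (\<lambda>\<theta>'. V M (Suc t) \<theta>' x) \<theta> r h) | h.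
              0 < \<bar>h\<bar> \<and> \<bar>h\<bar> \<le> h0 \<and> \<theta> + h *\<^sub>R r \<in> params M}" for n
      using \<eta>(2)[of n] by (auto simp: good_def)
    show "\<exists>d>0. \<forall>\<^sub>F n in sequentially. \<forall>y\<in>X. dist y ?p < d \<longrightarrow>
        \<bar>(?\<Psi> n y - ?\<psi> y) / \<eta> n - (?\<Psi> n ?p - ?\<psi> ?p) / \<eta> n\<bar> < e"
    proof (intro exI[of _ d] conjI always_eventually allI ballI impI)
      fix n y assume "y \<in> X" "dist y ?p < d"
      with d(2)[rule_format, OF mem[of n]]
      have "dist (diff_quotient (\<lambda>\<theta>'. V M (Suc t) \<theta>' y) \<theta> r (\<eta> n)) (diff_quotient (\<lambda>\<theta>'. V M (Suc t) \<theta>' ?p) \<theta> r (\<eta> n)) < e"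
        by blast
      then show "\<bar>(?\<Psi> n y - ?\<psi> y) / \<eta> n - (?\<Psi> n ?p - ?\<psi> ?p) / \<eta> n\<bar> < e"
        unfolding inner_objective_diff by (simp only: dist_real_def diff_quotient_def)
    qed (rule d(1))
  qed (use y z \<eta> in \<open>auto simp: l_def\<close>)
  then show ?thesis using z(2) y(3) by (simp only: l_def)
qed

abbreviation gdir where "gdir x a x' \<equiv> gv (ystar t x a x' \<theta>) \<bullet> r"

lemma gdir_integrable:
  assumes x: "x \<in> X" "a \<in> A"
  shows "integrable (nominal M t (x, a)) (gdir x a)"
    and "(\<lambda>n. (F M t (pert n) (lstar t x a \<theta>) x a - F M t \<theta> (lstar t x a \<theta>) x a) / \<eta> n)
      \<longlonglongrightarrow> (\<integral>x'. gdir x a x' \<partial>nominal M t (x, a))"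
proof -
  let ?P = "nominal M t (x, a)" and ?l = "lstar t x a \<theta>"
  note P = prob_measures_onD[OF nominal_prob[OF t x]]
  interpret prob_space ?P by (rule P)
  let ?q = "\<lambda>n x'. (inner_min t (pert n) ?l x a x' - inner_min t \<theta> ?l x a x') / \<eta> n"
  have q: "?q n \<in> borel_measurable ?P" for n
    by (intro borel_measurable_divide borel_measurable_const borel_measurable_diff borel_measurable_integrable
        inner_min_integrable t pert_params \<theta>_params V_cont' x)
  have lim: "(\<lambda>n. ?q n x') \<longlonglongrightarrow> gdir x a x'" if "x' \<in> space ?P" for x'
    using inner_min_quotient_tendsto[OF x] that P(3) by simp
  \<comment> \<open>Measurability of \<open>gv\<close> along the optimal map is read off from the
    quotients of the inner minimum, which converge to it at every point.\<close>
  have m: "gdir x a \<in> borel_measurable ?P"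
    by (rule borel_measurable_LIMSEQ_real[OF lim q])
  have b: "norm (?q n x') \<le> B" if "x' \<in> space ?P" for n x'
    using inner_min_diff_le[OF x, of x' n ?l] that P(3) \<eta>(2)[of n] by (simp add: divide_simps)
  show "integrable ?P (gdir x a)"
    by (rule integrable_dominated_convergence[where w = "\<lambda>_. B" and s = ?q])
      (use m q lim b in \<open>auto intro!: AE_I2\<close>)
  have "(\<lambda>n. \<integral>x'. ?q n x' \<partial>?P) \<longlonglongrightarrow> (\<integral>x'. gdir x a x' \<partial>?P)"
    by (rule integral_dominated_convergence[where w = "\<lambda>_. B"])
      (use m q lim b in \<open>auto intro!: AE_I2\<close>)
  then show "(\<lambda>n. (F M t (pert n) ?l x a - F M t \<theta> ?l x a) / \<eta> n) \<longlonglongrightarrow> (\<integral>x'. gdir x a x' \<partial>?P)"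
    unfolding F_diff_eq[OF x] by simp
qed

text \<open>Danskin's argument in \<lambda>, applied to -F on [0, \<Lambda>] because the envelope
  lemma is about minima. The derivative of \<open>F\<close> at the fixed multiplier is already
  known; equicontinuity of the quotients of \<open>F\<close> controls the effect of the moving
  maximizer.\<close>

lemma G_quotient_tendsto:
  assumes x: "x \<in> X" "a \<in> A"
  shows "(\<lambda>n. (G M t (pert n) x a - G M t \<theta> x a) / \<eta> n) \<longlonglongrightarrow> (\<integral>x'. gdir x a x' \<partial>nominal M t (x, a))"
proof -
  let ?\<Psi> = "\<lambda>n l. - F M t (pert n) l x a" and ?\<psi> = "\<lambda>l. - F M t \<theta> l x a" and ?p = "lstar t x a \<theta>"
  let ?D = "\<integral>x'. gdir x a x' \<partial>nominal M t (x, a)"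
  note l = lstar_props[OF t \<theta>_params V_cont'[OF \<theta>_params] x]
  note ln = lstar_props[OF t pert_params V_cont'[OF pert_params] x]
  have "(\<lambda>n. (?\<Psi> n (lstar t x a (pert n)) - ?\<psi> ?p) / \<eta> n) \<longlonglongrightarrow> - ?D"
  proof (rule envelope_tendsto[where Y = "{0..\<Lambda>}" and B = B and \<Psi> = ?\<Psi> and \<psi> = ?\<psi> and p = ?p
        and z = "\<lambda>n. lstar t x a (pert n)"])
    show "continuous_on {0..\<Lambda>} ?\<psi>"
      using continuous_on_minus[OF continuous_on_subset[OF
          continuous_on_Pair_slice[OF F_continuous[OF t \<theta>_params V_cont'[OF \<theta>_params]], of "(x, a)"], of "{0..\<Lambda>}"]] x
      by simp
    show "\<forall>\<^sub>F n in sequentially. \<forall>l\<in>{0..\<Lambda>}. \<bar>?\<Psi> n l - ?\<psi> l\<bar> \<le> B * \<bar>\<eta> n\<bar>"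
      unfolding minus_diff_minus abs_minus_cancel by (intro always_eventually allI ballI F_diff_le x)
    have "(\<lambda>n. - ((F M t (pert n) ?p x a - F M t \<theta> ?p x a) / \<eta> n)) \<longlonglongrightarrow> - ?D"
      by (rule tendsto_minus[OF gdir_integrable(2)[OF x]])
    then show "(\<lambda>n. (?\<Psi> n ?p - ?\<psi> ?p) / \<eta> n) \<longlonglongrightarrow> - ?D"
      by (simp only: minus_diff_minus minus_divide_left)
    show "\<forall>\<^sub>F n in sequentially. lstar t x a (pert n) \<in> {0..\<Lambda>} \<and> ?\<Psi> n (lstar t x a (pert n)) \<le> ?\<Psi> n ?p"
      using ln(1,2) l(1) by auto
    show "?\<psi> ?p < ?\<psi> l'" if "l' \<in> {0..\<Lambda>}" "l' \<noteq> ?p" for l'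
      using l(3)[of l'] that by auto
    fix e :: real assume "e > 0"
    then obtain d where d: "d > 0" "\<forall>\<phi>\<in>{(\<lambda>(x, a, l). diff_quotient (\<lambda>\<theta>'. F M t \<theta>' l x a) \<theta> r h) | h.
              0 < \<bar>h\<bar> \<and> \<bar>h\<bar> \<le> h0 \<and> \<theta> + h *\<^sub>R r \<in> params M}.
        \<forall>u\<in>X \<times> A \<times> {0..\<Lambda>}. dist u (x, a, ?p) < d \<longrightarrow> dist (\<phi> u) (\<phi> (x, a, ?p)) < e"
      using scale x l(1) unfolding uniform_scale_def equicontinuous_on_def by blast
    have mem: "(\<lambda>(x, a, l). diff_quotient (\<lambda>\<theta>'. F M t \<theta>' l x a) \<theta> r (\<eta> n)) \<in>
      {(\<lambda>(x, a, l). diff_quotient (\<lambda>\<theta>'. F M t \<theta>' l x a) \<theta> r h) | h.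
              0 < \<bar>h\<bar> \<and> \<bar>h\<bar> \<le> h0 \<and> \<theta> + h *\<^sub>R r \<in> params M}" for n
      using \<eta>(2)[of n] by (auto simp: good_def)
    show "\<exists>d>0. \<forall>\<^sub>F n in sequentially. \<forall>l\<in>{0..\<Lambda>}. dist l ?p < d \<longrightarrow>
        \<bar>(?\<Psi> n l - ?\<psi> l) / \<eta> n - (?\<Psi> n ?p - ?\<psi> ?p) / \<eta> n\<bar> < e"
    proof (intro exI[of _ d] conjI always_eventually allI ballI impI)
      fix n l assume "l \<in> {0..\<Lambda>}" "dist l ?p < d"
      \<comment> \<open>Equicontinuity is stated in the triple; with state and action fixed, the
        distance in the product is the distance of the multipliers.\<close>
      then have *: "(x, a, l) \<in> X \<times> A \<times> {0..\<Lambda>}" "dist (x, a, l) (x, a, ?p) < d"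
        using x by (auto simp: dist_Pair_Pair)
      from d(2)[rule_format, OF mem[of n] *]
      have "dist (diff_quotient (\<lambda>\<theta>'. F M t \<theta>' l x a) \<theta> r (\<eta> n)) (diff_quotient (\<lambda>\<theta>'. F M t \<theta>' ?p x a) \<theta> r (\<eta> n)) < e"
        by (simp only: prod.case)
      moreover have "(?\<Psi> n l' - ?\<psi> l') / \<eta> n = - diff_quotient (\<lambda>\<theta>'. F M t \<theta>' l' x a) \<theta> r (\<eta> n)" for l'
        by (simp only: diff_quotient_def minus_diff_minus minus_divide_left)
      ultimately show "\<bar>(?\<Psi> n l - ?\<psi> l) / \<eta> n - (?\<Psi> n ?p - ?\<psi> ?p) / \<eta> n\<bar> < e"
        by (simp only: dist_real_def minus_diff_minus abs_minus_cancel)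
    qed (rule d(1))
  qed (use l \<eta> in auto)
  from tendsto_minus[OF this] show ?thesis
    by (simp only: minus_minus minus_diff_minus minus_divide_left
        G_eq[OF t pert_params V_cont'[OF pert_params] x] G_eq[OF t \<theta>_params V_cont'[OF \<theta>_params] x])
qed

lemma G_diff_le:
  assumes x: "x \<in> X" "a \<in> A"
  shows "\<bar>G M t (pert n) x a - G M t \<theta> x a\<bar> \<le> B * \<bar>\<eta> n\<bar>"
proof -
  note l = lstar_props[OF t \<theta>_params V_cont'[OF \<theta>_params] x]
  note ln = lstar_props[OF t pert_params V_cont'[OF pert_params] x]
  \<comment> \<open>Testing each supremum at the maximizer of the other reduces both directions to
    increments of \<open>F\<close> at one multiplier.\<close>
  have "F M t (pert n) (lstar t x a \<theta>) x a \<le> F M t (pert n) (lstar t x a (pert n)) x a"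
    "F M t \<theta> (lstar t x a (pert n)) x a \<le> F M t \<theta> (lstar t x a \<theta>) x a"
    using l(1,2) ln(1,2) by auto
  then show ?thesis
    using F_diff_le[OF x, of n "lstar t x a \<theta>"] F_diff_le[OF x, of n "lstar t x a (pert n)"]
    unfolding G_eq[OF t pert_params V_cont'[OF pert_params] x] G_eq[OF t \<theta>_params V_cont'[OF \<theta>_params] x]
    by linarith
qed

lemma G_quotient_measurable:
  assumes x: "x \<in> X"
  shows "(\<lambda>a. (G M t (pert n) x a - G M t \<theta> x a) / \<eta> n) \<in> borel_measurable (borel_on A)"
  using G_slice_continuous[OF t pert_params V_cont'[OF pert_params] x]
    G_slice_continuous[OF t \<theta>_params V_cont'[OF \<theta>_params] x]
  by (intro borel_measurable_divide borel_measurable_const borel_measurable_diff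
      borel_measurable_continuous_on_restrict)

lemma gdir_integral_measurable:
  assumes x: "x \<in> X"
  shows "(\<lambda>a. \<integral>x'. gdir x a x' \<partial>nominal M t (x, a)) \<in> borel_measurable (borel_on A)"
  by (rule borel_measurable_LIMSEQ_real[OF G_quotient_tendsto[OF x] G_quotient_measurable[OF x]]) simp

lemma G_quotient_le:
  assumes x: "x \<in> X" "a \<in> A"
  shows "\<bar>(G M t (pert n) x a - G M t \<theta> x a) / \<eta> n\<bar> \<le> B"
  using G_diff_le[OF x, of n] \<eta>(2)[of n] by (simp add: abs_divide divide_simps)

lemma gdir_integral_le:
  assumes x: "x \<in> X" "a \<in> A"
  shows "\<bar>\<integral>x'. gdir x a x' \<partial>nominal M t (x, a)\<bar> \<le> B"
proof (rule tendsto_upperbound[OF tendsto_rabs[OF G_quotient_tendsto[OF x]]])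
  show "\<forall>\<^sub>F n in sequentially. \<bar>(G M t (pert n) x a - G M t \<theta> x a) / \<eta> n\<bar> \<le> B"
    by (intro always_eventually allI G_quotient_le x)
qed simp

lemma gdir_integral_integrable:
  assumes x: "x \<in> X"
  shows "integrable (policy M t \<theta> x) (\<lambda>a. \<integral>x'. gdir x a x' \<partial>nominal M t (x, a))"
proof -
  note Q = prob_measures_onD[OF policy_prob[OF t \<theta>_params x]]
  interpret prob_space "policy M t \<theta> x" by (rule Q)
  show ?thesis
  proof (rule integrable_const_bound[where B = B])
    show "(\<lambda>a. \<integral>x'. gdir x a x' \<partial>nominal M t (x, a)) \<in> borel_measurable (policy M t \<theta> x)"
      unfolding measurable_cong_sets[OF Q(2) refl] by (rule gdir_integral_measurable[OF x])
  qed (use gdir_integral_le[OF x] Q(3) in \<open>auto intro!: AE_I2\<close>)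
qed

lemma V_quotient_step_tendsto:
  assumes x: "x \<in> X"
    and D: "((\<lambda>\<theta>'. \<integral>a. G M t \<theta> x a \<partial>policy M t \<theta>' x) has_derivative (\<lambda>v. D \<bullet> v)) (at \<theta>)"
  shows "(\<lambda>n. (V M t (pert n) x - V M t \<theta> x) / \<eta> n)
    \<longlonglongrightarrow> (\<integral>a. \<integral>x'. gdir x a x' \<partial>nominal M t (x, a) \<partial>policy M t \<theta> x) + D \<bullet> r"
proof -
  let ?\<pi> = "policy M t \<theta> x" and ?g = "\<lambda>n a. (G M t (pert n) x a - G M t \<theta> x a) / \<eta> n"
  let ?ratio = "\<lambda>n a. dens M t (pert n) x a / dens M t \<theta> x a"
  let ?I = "\<lambda>a. \<integral>x'. gdir x a x' \<partial>nominal M t (x, a)"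
  note Q = prob_measures_onD[OF policy_prob[OF t \<theta>_params x]]
  interpret prob_space ?\<pi> by (rule Q)
  obtain C where C: "C \<ge> 0" "\<And>a n. a \<in> A \<Longrightarrow> \<bar>ln (dens M t (pert n) x a) - ln (dens M t \<theta> x a)\<bar> \<le> C * norm (pert n - \<theta>)"
  proof (rule log_density_lipschitz)
    fix C :: real
    assume "C \<ge> 0" and C: "\<And>t x a \<theta> \<theta>' \<rho>. t < horizon M \<Longrightarrow> x \<in> X \<Longrightarrow> a \<in> A \<Longrightarrow> ball \<theta> \<rho> \<subseteq> params M
      \<Longrightarrow> \<theta>' \<in> ball \<theta> \<rho> \<Longrightarrow> \<bar>ln (dens M t \<theta>' x a) - ln (dens M t \<theta> x a)\<bar> \<le> C * norm (\<theta>' - \<theta>)"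
    have "ball \<theta> \<rho> \<subseteq> params M" using scale by (simp add: uniform_scale_def)
    moreover have "pert n \<in> ball \<theta> \<rho>" for n using \<eta>(2)[of n] by (simp add: good_def)
    ultimately show ?thesis using C t x \<open>C \<ge> 0\<close> by (intro that[of C]) blast+
  qed
  note d = dens_props[OF t \<theta>_params x] and dn = dens_props[OF t pert_params x]
  have ratio: "?ratio n a = exp (ln (dens M t (pert n) x a) - ln (dens M t \<theta> x a))" if "a \<in> A" for n a
    using d(2) dn(2) that by (simp add: exp_diff)
  have ratio_lim: "(\<lambda>n. ?ratio n a) \<longlonglongrightarrow> 1" if a: "a \<in> A" for a
  proof -
    have "(\<lambda>n. C * norm (\<eta> n *\<^sub>R r)) \<longlonglongrightarrow> C * norm (0 *\<^sub>R r)" by (intro tendsto_intros \<eta>(1))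
    then have "(\<lambda>n. C * norm (\<eta> n *\<^sub>R r)) \<longlonglongrightarrow> 0" by simp
    then have "(\<lambda>n. ln (dens M t (pert n) x a) - ln (dens M t \<theta> x a)) \<longlonglongrightarrow> 0"
      by (rule Lim_null_comparison[rotated]) (use C(2)[OF a] in simp)
    from tendsto_exp[OF this] show ?thesis by (simp only: ratio[OF a] exp_zero)
  qed
  \<comment> \<open>The logarithm of the ratio is at most C |\<eta> n| |r|, and |\<eta> n| \<le> h0
    for good step sizes.\<close>
  have ratio_le: "0 \<le> ?ratio n a" "?ratio n a \<le> exp (C * (h0 * norm r))" if a: "a \<in> A" for n a
  proof -
    have "C * norm (pert n - \<theta>) \<le> C * (h0 * norm r)"
      using \<eta>(2)[of n] C(1) by (auto simp: good_def intro!: mult_left_mono mult_right_mono)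
    then show "?ratio n a \<le> exp (C * (h0 * norm r))" unfolding ratio[OF a] using C(2)[OF a, of n] by simp
    show "0 \<le> ?ratio n a" unfolding ratio[OF a] by simp
  qed
  have gm: "?g n \<in> borel_measurable (borel_on A)" for n by (rule G_quotient_measurable[OF x])
  have "(\<lambda>n. \<integral>a. ?g n a * ?ratio n a \<partial>?\<pi>) \<longlonglongrightarrow> (\<integral>a. ?I a \<partial>?\<pi>)"
  proof (rule integral_dominated_convergence[where w = "\<lambda>_. B * exp (C * (h0 * norm r))"])
    show "?I \<in> borel_measurable ?\<pi>"
      unfolding measurable_cong_sets[OF Q(2) refl] by (rule gdir_integral_measurable[OF x])
    show "(\<lambda>a. ?g n a * ?ratio n a) \<in> borel_measurable ?\<pi>" for n
      unfolding measurable_cong_sets[OF Q(2) refl]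
      by (intro borel_measurable_times borel_measurable_divide gm d(1) dn(1))
    show "AE a in ?\<pi>. (\<lambda>n. ?g n a * ?ratio n a) \<longlonglongrightarrow> ?I a"
    proof (rule AE_I2)
      fix a assume "a \<in> space ?\<pi>"
      then have a: "a \<in> A" using Q(3) by simp
      show "(\<lambda>n. ?g n a * ?ratio n a) \<longlonglongrightarrow> ?I a"
        using tendsto_mult[OF G_quotient_tendsto[OF x a] ratio_lim[OF a]] by simp
    qed
    show "AE a in ?\<pi>. norm (?g n a * ?ratio n a) \<le> B * exp (C * (h0 * norm r))" for n
    proof (rule AE_I2)
      fix a assume "a \<in> space ?\<pi>"
      then have a: "a \<in> A" using Q(3) by simp
      show "norm (?g n a * ?ratio n a) \<le> B * exp (C * (h0 * norm r))"
        unfolding real_norm_def abs_mult using ratio_le[OF a, of n] G_quotient_le[OF x a, of n] scale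
        by (intro mult_mono) (auto simp: uniform_scale_def)
    qed
  qed simp
  \<comment> \<open>Here only the policy moves, so this is the directional derivative of the
    integral of a fixed function.\<close>
  moreover have "(\<lambda>n. ((\<integral>a. G M t \<theta> x a \<partial>policy M t (pert n) x) - (\<integral>a. G M t \<theta> x a \<partial>?\<pi>)) / \<eta> n) \<longlonglongrightarrow> D \<bullet> r"
    using has_dir_deriv_of_has_derivative[OF D, of r] \<eta>
    unfolding has_dir_deriv_iff tendsto_at_iff_sequentially by (auto simp: diff_quotient_def comp_def)
  ultimately have "(\<lambda>n. (\<integral>a. ?g n a * ?ratio n a \<partial>?\<pi>)
      + ((\<integral>a. G M t \<theta> x a \<partial>policy M t (pert n) x) - (\<integral>a. G M t \<theta> x a \<partial>?\<pi>)) / \<eta> n)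
      \<longlonglongrightarrow> (\<integral>a. ?I a \<partial>?\<pi>) + D \<bullet> r"
    by (rule tendsto_add)
  moreover have "(V M t (pert n) x - V M t \<theta> x) / \<eta> n = (\<integral>a. ?g n a * ?ratio n a \<partial>?\<pi>)
      + ((\<integral>a. G M t \<theta> x a \<partial>policy M t (pert n) x) - (\<integral>a. G M t \<theta> x a \<partial>?\<pi>)) / \<eta> n" for n
  proof -
    note Qn = policy_prob[OF t pert_params x, of n]
    have "integrable (policy M t (pert n) x) (G M t (pert n) x)" "integrable (policy M t (pert n) x) (G M t \<theta> x)"
      by (rule integrable_continuous_on_compact[OF Qn compact_A G_slice_continuous[OF t pert_params V_cont'[OF pert_params] x]],
          rule integrable_continuous_on_compact[OF Qn compact_A G_slice_continuous[OF t \<theta>_params V_cont'[OF \<theta>_params] x]])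
    then have "(\<integral>a. ?g n a \<partial>policy M t (pert n) x)
        = ((\<integral>a. G M t (pert n) x a \<partial>policy M t (pert n) x) - (\<integral>a. G M t \<theta> x a \<partial>policy M t (pert n) x)) / \<eta> n"
      by simp
    then show ?thesis
      unfolding policy_change[OF t x \<theta>_params pert_params gm, symmetric]
        V_recursion[OF \<theta>_params t x] V_recursion[OF pert_params t x]
      by (simp add: diff_divide_distrib)
  qed
  ultimately show ?thesis by simp
qed

end

section \<open>From sequences to directional derivatives\<close>

lemma gradient_integrable:
  assumes x: "x \<in> X" "a \<in> A"
  shows "integrable (nominal M t (x, a)) (\<lambda>x'. gv (ystar t x a x' \<theta>))"
proof (rule integrable_of_inner_Basis)
  fix b :: 'p
  \<comment> \<open>The coordinate along \<open>b\<close> is the directional limit for r = b, whose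
    integrability is known along any good sequence; a single one is enough.\<close>
  obtain \<rho> h0 B where scale: "uniform_scale b \<rho> h0 B" and ev: "eventually (good b \<rho> h0 B) (at 0)"
    by (rule eventually_good)
  obtain \<eta> where "\<eta> \<longlonglongrightarrow> 0" "\<And>n::nat. \<eta> n \<noteq> 0 \<and> good b \<rho> h0 B (\<eta> n)"
    by (rule eventually_at_0_sequence[OF ev]) blast
  from gdir_integrable(1)[OF scale this x]
  show "integrable (nominal M t (x, a)) (\<lambda>x'. gv (ystar t x a x' \<theta>) \<bullet> b)" .
qed

lemma G_has_dir_deriv:
  assumes x: "x \<in> X" "a \<in> A"
  shows "has_dir_deriv (\<lambda>\<theta>'. G M t \<theta>' x a) \<theta> r
    ((\<integral>x'. gv (ystar t x a x' \<theta>) \<partial>nominal M t (x, a)) \<bullet> r)"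
proof -
  obtain \<rho> h0 B where scale: "uniform_scale r \<rho> h0 B" and ev: "eventually (good r \<rho> h0 B) (at 0)"
    by (rule eventually_good)
  have "(\<integral>x'. gv (ystar t x a x' \<theta>) \<partial>nominal M t (x, a)) \<bullet> r
      = (\<integral>x'. gv (ystar t x a x' \<theta>) \<bullet> r \<partial>nominal M t (x, a))"
    using gradient_integrable[OF x] by (subst integral_inner_left) auto
  then show ?thesis
    unfolding has_dir_deriv_iff
    using tendsto_at_0_of_sequences[OF ev, of "diff_quotient (\<lambda>\<theta>'. G M t \<theta>' x a) \<theta> r"]
      G_quotient_tendsto[OF scale _ _ x] by (simp add: diff_quotient_def)
qed

text \<open>The vector is the policy average of the gradients of \<open>G\<close> plus
  \<open>D (\<theta>, x)\<close>, the contribution of the moving policy. Both terms are linear in r,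
  the first because integration commutes with the inner product.\<close>

lemma V_has_dir_deriv:
  assumes x: "x \<in> X"
  shows "\<exists>v. \<forall>r. has_dir_deriv (\<lambda>\<theta>'. V M t \<theta>' x) \<theta> r (v \<bullet> r)"
proof -
  have "continuous_on A (G M t \<theta> x)"
    by (rule G_slice_continuous[OF t \<theta>_params V_cont'[OF \<theta>_params] x])
  \<comment> \<open>The test function is \<open>G M t \<theta> x\<close> with both \<theta> and x
    frozen. The derivative is supplied at all parameters and states and afterwards evaluated at the
    same \<theta> and x, hence the separate bound variables.\<close>
  then obtain D where "\<forall>\<theta>\<^sub>1\<in>params M. \<forall>x\<^sub>1\<in>X. ((\<lambda>\<theta>'. \<integral>a. G M t \<theta> x a \<partial>policy M t \<theta>' x\<^sub>1)
      has_derivative (\<lambda>v. D (\<theta>\<^sub>1, x\<^sub>1) \<bullet> v)) (at \<theta>\<^sub>1 within params M)"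
    using regular t unfolding regular_policies_def by blast
  then have "((\<lambda>\<theta>'. \<integral>a. G M t \<theta> x a \<partial>policy M t \<theta>' x) has_derivative (\<lambda>v. D (\<theta>, x) \<bullet> v)) (at \<theta> within params M)"
    using \<theta>_params x by blast
  then have D: "((\<lambda>\<theta>'. \<integral>a. G M t \<theta> x a \<partial>policy M t \<theta>' x) has_derivative (\<lambda>v. D (\<theta>, x) \<bullet> v)) (at \<theta>)"
    by (simp only: at_within_interior[OF \<theta>])
  let ?I = "\<lambda>a. \<integral>x'. gv (ystar t x a x' \<theta>) \<partial>nominal M t (x, a)"
  note Q = prob_measures_onD[OF policy_prob[OF t \<theta>_params x]]
  have inner: "?I a \<bullet> r = (\<integral>x'. gv (ystar t x a x' \<theta>) \<bullet> r \<partial>nominal M t (x, a))" if "a \<in> A" for a r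
    using gradient_integrable[OF x that] by (subst integral_inner_left) auto
  \<comment> \<open>Scale, constants and sequence depend on the direction, so everything is done for
    one r at a time; the choice of a basis vector for r then gives integrability of the
    vector-valued \<open>?I\<close>.\<close>
  have int: "integrable (policy M t \<theta> x) (\<lambda>a. ?I a \<bullet> r)
      \<and> has_dir_deriv (\<lambda>\<theta>'. V M t \<theta>' x) \<theta> r ((\<integral>a. ?I a \<bullet> r \<partial>policy M t \<theta> x) + D (\<theta>, x) \<bullet> r)" for r
  proof -
    obtain \<rho> h0 B where scale: "uniform_scale r \<rho> h0 B" and ev: "eventually (good r \<rho> h0 B) (at 0)"
      by (rule eventually_good)
    obtain \<eta> where "\<eta> \<longlonglongrightarrow> 0" "\<And>n::nat. \<eta> n \<noteq> 0 \<and> good r \<rho> h0 B (\<eta> n)"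
      by (rule eventually_at_0_sequence[OF ev]) blast
    from gdir_integral_integrable[OF scale this x]
    have "integrable (policy M t \<theta> x) (\<lambda>a. ?I a \<bullet> r)"
      by (rule Bochner_Integration.integrable_cong[OF refl, THEN iffD1, rotated]) (simp add: inner Q(3))
    moreover have "(\<integral>a. ?I a \<bullet> r \<partial>policy M t \<theta> x)
        = (\<integral>a. \<integral>x'. gv (ystar t x a x' \<theta>) \<bullet> r \<partial>nominal M t (x, a) \<partial>policy M t \<theta> x)"
      by (rule Bochner_Integration.integral_cong) (simp_all add: inner Q(3))
    then have "has_dir_deriv (\<lambda>\<theta>'. V M t \<theta>' x) \<theta> r ((\<integral>a. ?I a \<bullet> r \<partial>policy M t \<theta> x) + D (\<theta>, x) \<bullet> r)"
      unfolding has_dir_deriv_iff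
      using tendsto_at_0_of_sequences[OF ev, of "diff_quotient (\<lambda>\<theta>'. V M t \<theta>' x) \<theta> r"]
        V_quotient_step_tendsto[OF scale _ _ x D] by (simp add: diff_quotient_def)
    ultimately show ?thesis ..
  qed
  have "integrable (policy M t \<theta> x) ?I"
    by (rule integrable_of_inner_Basis) (use int in blast)
  then have "(\<integral>a. ?I a \<bullet> r \<partial>policy M t \<theta> x) = (\<integral>a. ?I a \<partial>policy M t \<theta> x) \<bullet> r" for r
    by (subst integral_inner_left) auto
  with int show ?thesis
    by (intro exI[of _ "(\<integral>a. ?I a \<partial>policy M t \<theta> x) + D (\<theta>, x)"]) (simp add: inner_add_left)
qed

end

lemma V_gradient_exists:
  assumes \<theta>: "\<theta> \<in> interior (params M)"
  shows "t \<le> horizon M \<Longrightarrow> x \<in> X \<Longrightarrow> \<exists>v. \<forall>r. has_dir_deriv (\<lambda>\<theta>'. V M t \<theta>' x) \<theta> r (v \<bullet> r)"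
proof (induction t arbitrary: x rule: inc_induct)
  case base
  \<comment> \<open>The terminal value does not vary with the parameter, so the quotient vanishes.
    \<open>V_terminal\<close> speaks of parameters in \<open>params M\<close>, which is why h is
    first made small enough to stay in a ball.\<close>
  have "has_dir_deriv (\<lambda>\<theta>'. V M (horizon M) \<theta>' x) \<theta> r (0 \<bullet> r)" for r
  proof -
    obtain \<rho> where \<rho>: "\<rho> > 0" "ball \<theta> \<rho> \<subseteq> params M"
      using \<theta> by (auto simp: mem_interior)
    have "((\<lambda>h::real. \<theta> + h *\<^sub>R r) \<longlongrightarrow> \<theta> + 0 *\<^sub>R r) (at 0)" by (intro tendsto_intros)
    then have "\<forall>\<^sub>F h in at (0::real). \<theta> + h *\<^sub>R r \<in> ball \<theta> \<rho>"
      using \<rho>(1) by (auto dest!: tendstoD[where e = \<rho>] simp: dist_commute)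
    then have "\<forall>\<^sub>F h in at 0. diff_quotient (\<lambda>\<theta>'. V M (horizon M) \<theta>' x) \<theta> r h = 0"
    proof eventually_elim
      case (elim h)
      have "\<theta> + h *\<^sub>R r \<in> params M" "\<theta> \<in> params M" using elim \<rho> by auto
      then show ?case using V_terminal base by (simp add: diff_quotient_def)
    qed
    then show ?thesis by (simp add: has_dir_deriv_iff tendsto_eventually)
  qed
  then show ?case by blast
next
  case (step t)
  then obtain gv where "\<And>x r. x \<in> X \<Longrightarrow> has_dir_deriv (\<lambda>\<theta>'. V M (Suc t) \<theta>' x) \<theta> r (gv x \<bullet> r)"
    by metis
  from V_has_dir_deriv[OF step.hyps(2) \<theta> this step.prems] show ?case .
qed

end

theorem lemma3p2:
  fixes M :: "('x::euclidean_space, 'a::euclidean_space, 'p::euclidean_space) dr_model"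
    and \<Lambda> :: real
    and lstar :: "nat \<Rightarrow> 'x \<Rightarrow> 'a \<Rightarrow> 'p \<Rightarrow> real"
    and ystar :: "nat \<Rightarrow> 'x \<Rightarrow> 'a \<Rightarrow> 'x \<Rightarrow> 'p \<Rightarrow> 'x"
  assumes model: "wf_model M"
    and f_cont: "\<And>t. t < horizon M \<Longrightarrow>
      continuous_on (states M \<times> acts M \<times> states M) (\<lambda>(x, a, y). reward M t x a y)"
    and g_cont: "continuous_on (states M) (terminal M)"
    and P0_cont: "\<And>t. t < horizon M \<Longrightarrow>
      weakly_continuous_on (states M \<times> acts M) (states M) (nominal M t)"
    and regular: "regular_policies M"
    and \<Lambda>_bound: "\<And>t \<theta> x a. \<lbrakk>t < horizon M; \<theta> \<in> params M; x \<in> states M; a \<in> acts M\<rbrakk> \<Longrightarrow>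
      Lambda_opt M t \<theta> x a = argmax_set (\<lambda>l. F M t \<theta> l x a) {0..\<Lambda>}"
    and equicont: "\<And>\<theta> r. \<theta> \<in> interior (params M) \<Longrightarrow>
      \<exists>h0>0.
        (\<forall>s\<le>horizon M. equicontinuous_on (states M)
           {(\<lambda>x. diff_quotient (\<lambda>\<theta>'. V M s \<theta>' x) \<theta> r h) | h.
              0 < \<bar>h\<bar> \<and> \<bar>h\<bar> \<le> h0 \<and> \<theta> + h *\<^sub>R r \<in> params M}) \<and>
        (\<forall>s<horizon M. equicontinuous_on (states M \<times> acts M \<times> {0..\<Lambda>})
           {(\<lambda>(x, a, l). diff_quotient (\<lambda>\<theta>'. F M s \<theta>' l x a) \<theta> r h) | h.
              0 < \<bar>h\<bar> \<and> \<bar>h\<bar> \<le> h0 \<and> \<theta> + h *\<^sub>R r \<in> params M})"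
    and dual_unique: "\<And>t x a \<theta>. \<lbrakk>t < horizon M; x \<in> states M; a \<in> acts M; \<theta> \<in> params M\<rbrakk> \<Longrightarrow>
      Lambda_opt M t \<theta> x a = {lstar t x a \<theta>}"
    and inner_unique: "\<And>t x a \<theta> x'.
      \<lbrakk>t < horizon M; x \<in> states M; a \<in> acts M; \<theta> \<in> params M; x' \<in> states M\<rbrakk> \<Longrightarrow>
      Y_opt M t \<theta> (lstar t x a \<theta>) x a x' = {ystar t x a x' \<theta>}"
  shows "\<exists>gradV :: nat \<Rightarrow> 'p \<Rightarrow> 'x \<Rightarrow> 'p.
    (\<forall>\<theta>\<in>interior (params M). \<forall>t\<le>horizon M. \<forall>x\<in>states M. \<forall>r.
       has_dir_deriv (\<lambda>\<theta>'. V M t \<theta>' x) \<theta> r (gradV t \<theta> x \<bullet> r)) \<and>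
    (\<forall>\<theta>\<in>interior (params M). \<forall>t<horizon M. \<forall>x\<in>states M. \<forall>a\<in>acts M.
       integrable (nominal M t (x, a)) (\<lambda>x'. gradV (Suc t) \<theta> (ystar t x a x' \<theta>)) \<and>
       (\<forall>r. has_dir_deriv (\<lambda>\<theta>'. G M t \<theta>' x a) \<theta> r
          ((\<integral>x'. gradV (Suc t) \<theta> (ystar t x a x' \<theta>) \<partial>nominal M t (x, a)) \<bullet> r)))"
proof -
  interpret dr_sensitivity M \<Lambda> lstar ystar
    by unfold_locales (fact assms)+
  \<comment> \<open>The choice is harmless: inner products with all r are limits, hence unique, and
    determine the vector. One function of all three arguments is fixed so that the formula for
    \<open>G\<close> refers to the same gradients.\<close>
  define gradV where
    "gradV t \<theta> x = (SOME v. \<forall>r. has_dir_deriv (\<lambda>\<theta>'. V M t \<theta>' x) \<theta> r (v \<bullet> r))" for t \<theta> x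
  have grad: "has_dir_deriv (\<lambda>\<theta>'. V M t \<theta>' x) \<theta> r (gradV t \<theta> x \<bullet> r)"
    if "\<theta> \<in> interior (params M)" "t \<le> horizon M" "x \<in> states M" for \<theta> t x r
    using someI_ex[OF V_gradient_exists[OF that]] by (simp add: gradV_def)
  have grad': "has_dir_deriv (\<lambda>\<theta>'. V M (Suc t) \<theta>' x) \<theta> r (gradV (Suc t) \<theta> x \<bullet> r)"
    if "\<theta> \<in> interior (params M)" "t < horizon M" "x \<in> states M" for \<theta> t x r
    using grad that by simp
  show ?thesis
    by (intro exI[of _ gradV] conjI ballI allI impI grad
        gradient_integrable[OF _ _ grad'] G_has_dir_deriv[OF _ _ grad'])
qed

end
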